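(* The inclusion $\mathcal{A}\subset\mathcal{B}_0\rtimes_\beta G$ is isomorphic to the Longo-Rehren inclusion $\mathcal{A}\subset\mathcal{B}$ for $\mathcal{C}$ (i.e. there is an isomorphism of $\mathcal{B}_0\rtimes_\beta G$ onto $\mathcal{B}$ carrying $\mathcal{A}$ onto $\mathcal{A}$).
   Context: $\mathcal{M}$ is a type III factor with a faithful normal state; $\mathrm{End}_0(\mathcal{M})$ is the set of finite index endomorphisms; $(\rho,\sigma)=\{T\in\mathcal{M}\mid T\rho(x)=\sigma(x)T\ \forall x\}$. For $\rho\in\mathrm{End}_0(\mathcal{M})$ with conjugate $\bar\rho$ and dimension $d(\rho)$ a solution of the conjugate equation $R_\rho\in(\mathrm{id},\bar\rho\rho)$, $\bar R_\rho\in(\mathrm{id},\rho\bar\rho)$, $R_\rho^*R_\rho=\bar R_\rho^*\bar R_\rho=d(\rho)$, $R_\rho^*\bar\rho(\bar R_\rho)=\bar R_\rho^*\rho(R_\rho)=1$ is fixed. $\mathcal{C}\subset\mathrm{End}_0(\mathcal{M})$ is a rigid C$^*$-tensor category (full, closed under unitary equivalence, composition, conjugates, finite direct sums and subobjects, containing $\mathrm{id}$) with at most countable set $\mathrm{Irr}(\mathcal{C})$ of representatives of irreducibles. $G$ is a discrete group with neutral element $0$ (written multiplicatively) and $\mathcal{C}$ is $G$-graded with components $\mathcal{C}_g\ne0$: every irreducible lies in exactly one $\mathcal{C}_g$, $\mathcal{C}_g\mathcal{C}_h\subset\mathcal{C}_{gh}$, $\overline{\mathcal{C}_g}=\mathcal{C}_{g^{-1}}$.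 $j:\mathcal{M}\to\mathcal{M}^{\mathrm{op}}$, $j(x)=x^*$, $\pi^{\mathrm{op}}=j\pi j^{-1}$, $\mathcal{A}=\mathcal{M}\otimes\mathcal{M}^{\mathrm{op}}$. The Longo-Rehren inclusion $\mathcal{A}\subset\mathcal{B}$ of $\mathcal{C}$: $\mathcal{B}$ is the von Neumann algebra generated by $\mathcal{A}$ and elements $\lambda_\pi$ ($\pi\in\mathcal{C}$) with $\lambda_\pi a=(\pi\otimes\pi^{\mathrm{op}})(a)\lambda_\pi$ ($a\in\mathcal{A}$), $\lambda_\pi\lambda_\rho=\lambda_{\pi\rho}$, $\lambda_\pi^*=(R_\pi\otimes j(R_\pi))^*\lambda_{\bar\pi}$, $(T\otimes1)\lambda_\pi=(1\otimes j(T^* ))\lambda_\rho$ for $T\in(\pi,\rho)$, together with a faithful normal conditional expectation $E:\mathcal{B}\to\mathcal{A}$, $E(a\lambda_\pi)=\delta_{\mathrm{id},\pi}a$ for $\pi\in\mathrm{Irr}(\mathcal{C})$. $\mathcal{B}_g$ is the $\sigma$-weak closure of $\{\sum_{\pi\in\mathrm{Irr}(\mathcal{C}_g)}a_\pi\lambda_\pi\}$ (finite sums, $a_\pi\in\mathcal{A}$); $\mathcal{B}_0$ is the Longo-Rehren algebra of $\mathcal{C}_0$. $\beta$ is the action of $G$ on $\mathcal{B}_0$ attached to the grading: there are (fixed) unitaries $u_g\in\mathcal{B}_g$, $g\in G$, with $u_gu_h=u_{gh}$ and $\beta_g=\mathrm{Ad}\,u_g|_{\mathcal{B}_0}$. 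*)

theory Defs
  imports "HOL-Analysis.Analysis"
begin

section \<open>Complex Hilbert spaces\<close>

class scaleC =
  fixes scaleC :: "complex \<Rightarrow> 'a \<Rightarrow> 'a"  (infixr \<open>*\<^sub>C\<close> 75)

text \<open>A complex Hilbert space is a complete real inner product space together with a compatible
  complex structure for which multiplication by \<open>\<i>\<close> is isometric. The real inner product is the
  real part of the complex one, which is conjugate linear in the first argument.\<close>

class chilbert_space = real_inner + complete_space + scaleC +
  assumes scaleC_add_right: "c *\<^sub>C (x + y) = c *\<^sub>C x + c *\<^sub>C y"
    and scaleC_add_left: "(c + d) *\<^sub>C x = c *\<^sub>C x + d *\<^sub>C x"
    and scaleC_scaleC: "c *\<^sub>C d *\<^sub>C x = (c * d) *\<^sub>C x"
    and scaleC_of_real: "complex_of_real r *\<^sub>C x = r *\<^sub>R x"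
    and inner_ii: "inner (\<i> *\<^sub>C x) (\<i> *\<^sub>C y) = inner x y"

definition cinner :: "'h::chilbert_space \<Rightarrow> 'h \<Rightarrow> complex" where
  "cinner x y = Complex (inner x y) (inner (\<i> *\<^sub>C x) y)"

lemma scaleC_eq:
  fixes x :: "'h::chilbert_space"
  shows "c *\<^sub>C x = Re c *\<^sub>R x + Im c *\<^sub>R (\<i> *\<^sub>C x)"
proof -
  have "c = complex_of_real (Re c) + complex_of_real (Im c) * \<i>"
    using complex_eq mult.commute by metis
  then have "c *\<^sub>C x = complex_of_real (Re c) *\<^sub>C x + (complex_of_real (Im c) * \<i>) *\<^sub>C x"
    by (metis scaleC_add_left)
  then show ?thesis
    by (simp add: scaleC_of_real flip: scaleC_scaleC)
qed

lemma scaleC_scaleR: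
  fixes x :: "'h::chilbert_space"
  shows "c *\<^sub>C (r *\<^sub>R x) = r *\<^sub>R (c *\<^sub>C x)"
  by (metis mult.commute scaleC_of_real scaleC_scaleC)

lemma bounded_linear_scaleC: "bounded_linear (\<lambda>x::'h::chilbert_space. c *\<^sub>C x)"
proof (rule bounded_linear_intro[where K = "\<bar>Re c\<bar> + \<bar>Im c\<bar>"])
  fix x y :: 'h and r
  show "c *\<^sub>C (x + y) = c *\<^sub>C x + c *\<^sub>C y" by (rule scaleC_add_right)
  show "c *\<^sub>C (r *\<^sub>R x) = r *\<^sub>R (c *\<^sub>C x)" by (rule scaleC_scaleR)
  have "norm (\<i> *\<^sub>C x) = norm x" by (simp add: norm_eq_sqrt_inner inner_ii)
  then have "norm (c *\<^sub>C x) \<le> \<bar>Re c\<bar> * norm x + \<bar>Im c\<bar> * norm x"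
    by (subst scaleC_eq) (metis norm_scaleR norm_triangle_ineq)
  then show "norm (c *\<^sub>C x) \<le> norm x * (\<bar>Re c\<bar> + \<bar>Im c\<bar>)" by (simp add: algebra_simps)
qed

lemma scaleC_zero [simp]: "c *\<^sub>C (0 :: 'h::chilbert_space) = 0"
  using linear_0[OF bounded_linear.linear[OF bounded_linear_scaleC]] .

lemma scaleC_minus: "c *\<^sub>C (- x) = - (c *\<^sub>C (x :: 'h::chilbert_space))"
  using linear_neg[OF bounded_linear.linear[OF bounded_linear_scaleC]] .

lemma scaleC_diff: "c *\<^sub>C (x - y) = c *\<^sub>C x - c *\<^sub>C (y :: 'h::chilbert_space)"
  using linear_diff[OF bounded_linear.linear[OF bounded_linear_scaleC]] .

section \<open>The Hilbert space \<open>l\<^sup>2(G, H)\<close>\<close>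

typedef (overloaded) ('g, 'h::chilbert_space) l2 =
  "{f :: 'g \<Rightarrow> 'h. (\<lambda>g. (norm (f g))\<^sup>2) summable_on UNIV}"
  morphisms coord Abs_l2
  by (rule exI[where x = "\<lambda>_. 0"]) simp

setup_lifting type_definition_l2

lemma l2_add:
  fixes f h :: "'g \<Rightarrow> 'h::chilbert_space"
  assumes "(\<lambda>g. (norm (f g))\<^sup>2) summable_on UNIV" "(\<lambda>g. (norm (h g))\<^sup>2) summable_on UNIV"
  shows "(\<lambda>g. (norm (f g + h g))\<^sup>2) summable_on UNIV"
proof (rule summable_on_comparison_test)
  show "(\<lambda>g. 2 * (norm (f g))\<^sup>2 + 2 * (norm (h g))\<^sup>2) summable_on UNIV"
    using assms by (intro summable_on_add summable_on_cmult_right)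
  fix g
  have "(norm (f g + h g))\<^sup>2 \<le> (norm (f g) + norm (h g))\<^sup>2"
    by (intro power_mono norm_triangle_ineq) auto
  also have "\<dots> \<le> 2 * (norm (f g))\<^sup>2 + 2 * (norm (h g))\<^sup>2"
    using sum_squares_bound[of "norm (f g)" "norm (h g)"] by (simp add: power2_sum)
  finally show "(norm (f g + h g))\<^sup>2 \<le> 2 * (norm (f g))\<^sup>2 + 2 * (norm (h g))\<^sup>2" .
qed auto

lemma l2_scaleR:
  fixes f :: "'g \<Rightarrow> 'h::chilbert_space"
  assumes "(\<lambda>g. (norm (f g))\<^sup>2) summable_on UNIV"
  shows "(\<lambda>g. (norm (r *\<^sub>R f g))\<^sup>2) summable_on UNIV"
  using summable_on_cmult_right[OF assms, of "r\<^sup>2"] by (simp add: power_mult_distrib)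

lemma l2_scaleC:
  fixes f :: "'g \<Rightarrow> 'h::chilbert_space"
  assumes "(\<lambda>g. (norm (f g))\<^sup>2) summable_on UNIV"
  shows "(\<lambda>g. (norm (c *\<^sub>C f g))\<^sup>2) summable_on UNIV"
proof -
  have "(\<lambda>g. (norm (\<i> *\<^sub>C f g))\<^sup>2) = (\<lambda>g. (norm (f g))\<^sup>2)"
    by (simp add: norm_eq_sqrt_inner inner_ii)
  then have "(\<lambda>g. (norm (\<i> *\<^sub>C f g))\<^sup>2) summable_on UNIV" using assms by simp
  from l2_add[OF l2_scaleR[OF assms, of "Re c"] l2_scaleR[OF this, of "Im c"]]
  show ?thesis by (subst scaleC_eq)
qed

instantiation l2 :: (type, chilbert_space) real_vector
begin

lift_definition zero_l2 :: "('a, 'b) l2" is "\<lambda>_. 0" by simp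
lift_definition plus_l2 :: "('a, 'b) l2 \<Rightarrow> ('a, 'b) l2 \<Rightarrow> ('a, 'b) l2" is "\<lambda>f h g. f g + h g"
  by (rule l2_add)
lift_definition uminus_l2 :: "('a, 'b) l2 \<Rightarrow> ('a, 'b) l2" is "\<lambda>f g. - f g" by simp
lift_definition minus_l2 :: "('a, 'b) l2 \<Rightarrow> ('a, 'b) l2 \<Rightarrow> ('a, 'b) l2" is "\<lambda>f h g. f g - h g"
  using l2_add[of _ "\<lambda>g. - _ g"] by simp
lift_definition scaleR_l2 :: "real \<Rightarrow> ('a, 'b) l2 \<Rightarrow> ('a, 'b) l2" is "\<lambda>r f g. r *\<^sub>R f g"
  by (rule l2_scaleR)

instance
  by standard (transfer; simp add: algebra_simps fun_eq_iff)+

end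

instantiation l2 :: (type, chilbert_space) scaleC
begin

lift_definition scaleC_l2 :: "complex \<Rightarrow> ('a, 'b) l2 \<Rightarrow> ('a, 'b) l2" is "\<lambda>c f g. c *\<^sub>C f g"
  by (rule l2_scaleC)

instance ..

end

lemma l2_inner_summable:
  fixes f h :: "'g \<Rightarrow> 'h::chilbert_space"
  assumes "(\<lambda>g. (norm (f g))\<^sup>2) summable_on UNIV" "(\<lambda>g. (norm (h g))\<^sup>2) summable_on UNIV"
  shows "(\<lambda>g. inner (f g) (h g)) summable_on UNIV"
proof (rule abs_summable_summable, rule summable_on_comparison_test)
  show "(\<lambda>g. (norm (f g))\<^sup>2 + (norm (h g))\<^sup>2) summable_on UNIV"
    using assms by (intro summable_on_add)
  fix g
  have "\<bar>inner (f g) (h g)\<bar> \<le> norm (f g) * norm (h g)" by (rule Cauchy_Schwarz_ineq2)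
  also have "\<dots> \<le> (norm (f g))\<^sup>2 + (norm (h g))\<^sup>2"
    using sum_squares_bound[of "norm (f g)" "norm (h g)"]
      mult_nonneg_nonneg[OF norm_ge_zero[of "f g"] norm_ge_zero[of "h g"]] by linarith
  finally show "norm (inner (f g) (h g)) \<le> (norm (f g))\<^sup>2 + (norm (h g))\<^sup>2" by simp
qed auto

instantiation l2 :: (type, chilbert_space) real_inner
begin

definition inner_l2 :: "('a, 'b) l2 \<Rightarrow> ('a, 'b) l2 \<Rightarrow> real" where
  "inner_l2 x y = (\<Sum>\<^sub>\<infinity>g. inner (coord x g) (coord y g))"
definition norm_l2 :: "('a, 'b) l2 \<Rightarrow> real" where
  "norm_l2 x = sqrt (inner x x)"
definition dist_l2 :: "('a, 'b) l2 \<Rightarrow> ('a, 'b) l2 \<Rightarrow> real" where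
  "dist_l2 x y = norm (x - y)"
definition sgn_l2 :: "('a, 'b) l2 \<Rightarrow> ('a, 'b) l2" where
  "sgn_l2 x = inverse (norm x) *\<^sub>R x"
definition uniformity_l2 :: "(('a, 'b) l2 \<times> ('a, 'b) l2) filter" where
  "uniformity_l2 = (INF e\<in>{0<..}. principal {(x, y). dist x y < e})"
definition open_l2 :: "('a, 'b) l2 set \<Rightarrow> bool" where
  "open_l2 U = (\<forall>x\<in>U. eventually (\<lambda>(x', y). x' = x \<longrightarrow> y \<in> U) uniformity)"

instance
proof
  fix x y z :: "('a, 'b) l2" and r :: real
  have summ: "(\<lambda>g. inner (coord v g) (coord w g)) summable_on UNIV" for v w :: "('a, 'b) l2"
    by (rule l2_inner_summable) (use coord in auto)
  show "inner x y = inner y x" by (simp add: inner_l2_def inner_commute)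
  show "inner (x + y) z = inner x z + inner y z"
    by (simp add: inner_l2_def plus_l2.rep_eq inner_add_left infsum_add summ)
  show "inner (r *\<^sub>R x) y = r * inner x y"
    by (simp add: inner_l2_def scaleR_l2.rep_eq infsum_cmult_right')
  show "0 \<le> inner x x"
    unfolding inner_l2_def by (rule infsum_nonneg) simp
  show "inner x x = 0 \<longleftrightarrow> x = 0"
  proof
    assume "inner x x = 0"
    then have "inner (coord x g) (coord x g) = 0" for g
      unfolding inner_l2_def by (intro nonneg_infsum_le_0D[of "\<lambda>g. inner (coord x g) (coord x g)" UNIV])
        (use summ in auto)
    then show "x = 0" by (transfer) (auto simp: fun_eq_iff)
  qed (simp add: inner_l2_def zero_l2.rep_eq)
qed (rule norm_l2_def dist_l2_def sgn_l2_def uniformity_l2_def open_l2_def)+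

end

lemma l2_norm_sq: "(norm x)\<^sup>2 = (\<Sum>\<^sub>\<infinity>g. (norm (coord x g))\<^sup>2)"
  by (simp add: power2_norm_eq_inner inner_l2_def)

lemma l2_sum_le: "finite F \<Longrightarrow> (\<Sum>g\<in>F. (norm (coord x g))\<^sup>2) \<le> (norm x)\<^sup>2"
  unfolding l2_norm_sq by (rule finite_sum_le_infsum) (use coord in auto)

lemma l2_coord_le: "norm (coord x g) \<le> norm x"
  using l2_sum_le[of "{g}" x] by (simp add: power2_le_iff_abs_le)

instance l2 :: (type, chilbert_space) chilbert_space
proof
  fix X :: "nat \<Rightarrow> ('a, 'b) l2"
  assume X: "Cauchy X"
  have diff: "coord (x - y) g = coord x g - coord y g" for x y :: "('a, 'b) l2" and g
    by (simp add: minus_l2.rep_eq)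
  have "Cauchy (\<lambda>n. coord (X n) g)" for g
    using X unfolding Cauchy_def dist_norm
    by (metis diff l2_coord_le order_le_less_trans)
  then have "\<forall>g. \<exists>l. (\<lambda>n. coord (X n) g) \<longlonglongrightarrow> l"
    by (meson Cauchy_convergent convergent_def)
  then obtain f where f: "(\<lambda>n. coord (X n) g) \<longlonglongrightarrow> f g" for g
    by metis
  have bound: "\<exists>N. \<forall>n\<ge>N. \<forall>F. finite F \<longrightarrow> (\<Sum>g\<in>F. (norm (coord (X n) g - f g))\<^sup>2) \<le> e\<^sup>2"
    if "e > 0" for e :: real
  proof -
    obtain N where N: "norm (X n - X m) < e" if "n \<ge> N" "m \<ge> N" for n m
      using X \<open>e > 0\<close> unfolding Cauchy_def dist_norm by blast
    have "(\<Sum>g\<in>F. (norm (coord (X n) g - f g))\<^sup>2) \<le> e\<^sup>2" if "n \<ge> N" "finite F" for n F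
    proof (rule LIMSEQ_le_const2)
      show "(\<lambda>m. \<Sum>g\<in>F. (norm (coord (X n) g - coord (X m) g))\<^sup>2)
          \<longlonglongrightarrow> (\<Sum>g\<in>F. (norm (coord (X n) g - f g))\<^sup>2)"
        by (intro tendsto_intros f)
      have "(\<Sum>g\<in>F. (norm (coord (X n) g - coord (X m) g))\<^sup>2) \<le> e\<^sup>2" if "m \<ge> N" for m
      proof -
        have "(\<Sum>g\<in>F. (norm (coord (X n - X m) g))\<^sup>2) \<le> (norm (X n - X m))\<^sup>2"
          using \<open>finite F\<close> by (rule l2_sum_le)
        also have "\<dots> \<le> e\<^sup>2"
          using N[OF \<open>n \<ge> N\<close> \<open>m \<ge> N\<close>] by (intro power_mono) auto
        finally show ?thesis by (simp add: diff)
      qed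
      then show "\<exists>N. \<forall>m\<ge>N. (\<Sum>g\<in>F. (norm (coord (X n) g - coord (X m) g))\<^sup>2) \<le> e\<^sup>2"
        by blast
    qed
    then show ?thesis by blast
  qed
  have summ: "(\<lambda>g. (norm (coord (X n) g - f g))\<^sup>2) summable_on UNIV"
    if "\<forall>F. finite F \<longrightarrow> (\<Sum>g\<in>F. (norm (coord (X n) g - f g))\<^sup>2) \<le> e\<^sup>2" for n and e :: real
    using that by (intro nonneg_bdd_above_summable_on) (auto simp: bdd_above_def)
  obtain n where "\<forall>F. finite F \<longrightarrow> (\<Sum>g\<in>F. (norm (coord (X n) g - f g))\<^sup>2) \<le> 1\<^sup>2"
    using bound[of 1] by fastforce
  from l2_add[OF l2_scaleR[OF summ[OF this], of "-1"], of "coord (X n)"]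
  have "(\<lambda>g. (norm (f g))\<^sup>2) summable_on UNIV"
    using coord by auto
  then obtain x where x: "coord x = f"
    using Abs_l2_inverse by blast
  have "X \<longlonglongrightarrow> x"
  proof (rule metric_LIMSEQ_I)
    fix e :: real
    assume "e > 0"
    then obtain N where N: "\<And>n F. n \<ge> N \<Longrightarrow> finite F \<Longrightarrow>
        (\<Sum>g\<in>F. (norm (coord (X n) g - f g))\<^sup>2) \<le> (e / 2)\<^sup>2"
      using bound[of "e / 2"] by auto
    have "dist (X n) x < e" if "n \<ge> N" for n
    proof -
      have "(norm (X n - x))\<^sup>2 \<le> (e / 2)\<^sup>2"
        unfolding l2_norm_sq diff x using N[OF that] summ[of n "e/2"]
        by (intro infsum_le_finite_sums) auto
      then have "norm (X n - x) \<le> e / 2"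
        using \<open>e > 0\<close> by (simp add: power2_le_iff_abs_le)
      then show ?thesis using \<open>e > 0\<close> by (simp add: dist_norm)
    qed
    then show "\<exists>N. \<forall>n\<ge>N. dist (X n) x < e" by blast
  qed
  then show "convergent X" by (rule convergentI)
next
  fix x y :: "('a, 'b) l2"
  show "inner (\<i> *\<^sub>C x) (\<i> *\<^sub>C y) = inner x y"
    by (simp add: inner_l2_def scaleC_l2.rep_eq inner_ii)
qed (transfer; simp add: fun_eq_iff scaleC_add_right scaleC_add_left scaleC_scaleC scaleC_of_real)+

section \<open>Bounded operators\<close>

typedef (overloaded) 'h bop =
  "{T :: 'h::chilbert_space \<Rightarrow> 'h. bounded_linear T \<and> (\<forall>c x. T (c *\<^sub>C x) = c *\<^sub>C T x)}"
  morphisms app Abs_bop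
  by (rule exI[where x = "\<lambda>_. 0"]) simp

setup_lifting type_definition_bop

instantiation bop :: (chilbert_space) "{ring, monoid_mult, scaleC}"
begin

lift_definition zero_bop :: "'a bop" is "\<lambda>_. 0"
  by simp
lift_definition one_bop :: "'a bop" is "\<lambda>x. x" by (simp add: bounded_linear_ident)
lift_definition plus_bop :: "'a bop \<Rightarrow> 'a bop \<Rightarrow> 'a bop" is "\<lambda>S T x. S x + T x"
  by (auto simp: bounded_linear_add scaleC_add_right)
lift_definition uminus_bop :: "'a bop \<Rightarrow> 'a bop" is "\<lambda>T x. - T x"
  by (auto simp: bounded_linear_minus scaleC_minus)
lift_definition minus_bop :: "'a bop \<Rightarrow> 'a bop \<Rightarrow> 'a bop" is "\<lambda>S T x. S x - T x"
  by (auto simp: bounded_linear_sub scaleC_diff)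
lift_definition times_bop :: "'a bop \<Rightarrow> 'a bop \<Rightarrow> 'a bop" is "\<lambda>S T x. S (T x)"
  by (auto simp: bounded_linear_compose)
lift_definition scaleC_bop :: "complex \<Rightarrow> 'a bop \<Rightarrow> 'a bop" is "\<lambda>c T x. c *\<^sub>C T x"
  by (auto simp: scaleC_scaleC mult.commute intro: bounded_linear_compose[OF bounded_linear_scaleC])

instance
proof
  fix S T U :: "'a bop"
  have lin: "app U (x + y) = app U x + app U y" for x y
    using app[of U] by (auto intro: linear_add bounded_linear.linear)
  show "U * (S + T) = U * S + U * T"
    by (rule app_inject[THEN iffD1]) (simp add: plus_bop.rep_eq times_bop.rep_eq lin)
qed (transfer; simp add: fun_eq_iff algebra_simps)+

end

text \<open>The operators given below by definite description (adjoint, tensor product of operators, and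
  the operators generating a crossed product) exist and are unique; for \<open>cp_embed \<beta> b\<close> this requires
  \<open>\<beta> g b\<close> to be bounded in \<open>g\<close>, as is the case for an action by automorphisms and \<open>b\<close> in the
  algebra acted upon.\<close>

definition adj :: "'h::chilbert_space bop \<Rightarrow> 'h bop" where
  "adj T = (THE S. \<forall>x y. cinner (app S x) y = cinner x (app T y))"

definition pos :: "'h::chilbert_space bop \<Rightarrow> bool" where
  "pos T \<longleftrightarrow> (\<forall>x. cinner x (app T x) \<in> complex_of_real ` {0..})"

definition unitary :: "'h::chilbert_space bop \<Rightarrow> bool" where
  "unitary U \<longleftrightarrow> adj U * U = 1 \<and> U * adj U = 1"

definition projection :: "'h::chilbert_space bop \<Rightarrow> bool" where
  "projection p \<longleftrightarrow> p * p = p \<and> adj p = p"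

section \<open>Von Neumann algebras\<close>

definition commutant :: "'h::chilbert_space bop set \<Rightarrow> 'h bop set" where
  "commutant S = {T. \<forall>x\<in>S. T * x = x * T}"

definition vN_algebra :: "'h::chilbert_space bop set \<Rightarrow> bool" where
  "vN_algebra N \<longleftrightarrow> adj ` N \<subseteq> N \<and> commutant (commutant N) = N"

definition vN_generated :: "'h::chilbert_space bop set \<Rightarrow> 'h bop set" where
  "vN_generated S = commutant (commutant (S \<union> adj ` S))"

definition normal_functionals :: "('h::chilbert_space bop \<Rightarrow> complex) set" where
  "normal_functionals = {\<lambda>T. \<Sum>n. cinner (\<xi> n) (app T (\<eta> n)) | \<xi> \<eta> :: nat \<Rightarrow> 'h.
     summable (\<lambda>n. (norm (\<xi> n))\<^sup>2) \<and> summable (\<lambda>n. (norm (\<eta> n))\<^sup>2)}"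

definition sigma_weak :: "'h::chilbert_space bop topology" where
  "sigma_weak = topology_generated_by {\<omega> -` U | \<omega> U. \<omega> \<in> normal_functionals \<and> open U}"

definition normal_map ::
    "'h::chilbert_space bop set \<Rightarrow> 'k::chilbert_space bop set \<Rightarrow> ('h bop \<Rightarrow> 'k bop) \<Rightarrow> bool" where
  "normal_map N L f \<longleftrightarrow> continuous_map (subtopology sigma_weak N) (subtopology sigma_weak L) f"

definition star_hom ::
    "'h::chilbert_space bop set \<Rightarrow> 'k::chilbert_space bop set \<Rightarrow> ('h bop \<Rightarrow> 'k bop) \<Rightarrow> bool" where
  "star_hom N L f \<longleftrightarrow> f \<in> N \<rightarrow> L \<and> f 1 = 1 \<and>
     (\<forall>x\<in>N. \<forall>y\<in>N. f (x + y) = f x + f y \<and> f (x * y) = f x * f y) \<and>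
     (\<forall>x\<in>N. \<forall>c. f (c *\<^sub>C x) = c *\<^sub>C f x) \<and> (\<forall>x\<in>N. f (adj x) = adj (f x))"

definition star_iso ::
    "'h::chilbert_space bop set \<Rightarrow> 'k::chilbert_space bop set \<Rightarrow> ('h bop \<Rightarrow> 'k bop) \<Rightarrow> bool" where
  "star_iso N L f \<longleftrightarrow> star_hom N L f \<and> bij_betw f N L"

text \<open>\<open>M\<close> is of type III if every nonzero projection of \<open>M\<close> is infinite, that is, equivalent in
  \<open>M\<close> to a proper subprojection.\<close>

definition type_III_factor :: "'h::chilbert_space bop set \<Rightarrow> bool" where
  "type_III_factor M \<longleftrightarrow> vN_algebra M \<and> (1 :: 'h bop) \<noteq> 0 \<and>
     M \<inter> commutant M = {c *\<^sub>C 1 | c. True} \<and>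
     (\<forall>p\<in>M. projection p \<and> p \<noteq> 0 \<longrightarrow>
        (\<exists>v\<in>M. adj v * v = p \<and> p * (v * adj v) = v * adj v \<and> v * adj v \<noteq> p))"

definition faithful_normal_state :: "'h::chilbert_space bop set \<Rightarrow> ('h bop \<Rightarrow> complex) \<Rightarrow> bool" where
  "faithful_normal_state M \<phi> \<longleftrightarrow>
     continuous_map (subtopology sigma_weak M) euclidean \<phi> \<and> \<phi> 1 = 1 \<and>
     (\<forall>x\<in>M. \<forall>y\<in>M. \<phi> (x + y) = \<phi> x + \<phi> y) \<and> (\<forall>x\<in>M. \<forall>c. \<phi> (c *\<^sub>C x) = c * \<phi> x) \<and>
     (\<forall>x\<in>M. pos x \<longrightarrow> \<phi> x \<in> complex_of_real ` {0..}) \<and>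
     (\<forall>x\<in>M. pos x \<and> \<phi> x = 0 \<longrightarrow> x = 0)"

definition fn_cond_exp ::
    "'h::chilbert_space bop set \<Rightarrow> 'h bop set \<Rightarrow> ('h bop \<Rightarrow> 'h bop) \<Rightarrow> bool" where
  "fn_cond_exp N L E \<longleftrightarrow> L \<subseteq> N \<and> normal_map N L E \<and> (\<forall>a\<in>L. E a = a) \<and>
     (\<forall>x\<in>N. \<forall>y\<in>N. E (x + y) = E x + E y) \<and> (\<forall>x\<in>N. \<forall>c. E (c *\<^sub>C x) = c *\<^sub>C E x) \<and>
     (\<forall>x\<in>N. pos x \<longrightarrow> pos (E x)) \<and>
     (\<forall>x\<in>N. \<forall>a\<in>L. \<forall>b\<in>L. E (a * x * b) = a * E x * b) \<and>
     (\<forall>x\<in>N. pos x \<and> E x = 0 \<longrightarrow> x = 0)"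

section \<open>Endomorphisms\<close>

text \<open>Endomorphisms are normalised to be \<^const>\<open>undefined\<close> outside \<open>M\<close>, so that equality of
  functions is equality of endomorphisms of \<open>M\<close>.\<close>

type_synonym 'h endo = "'h bop \<Rightarrow> 'h bop"

definition End_vN :: "'h::chilbert_space bop set \<Rightarrow> 'h endo set" where
  "End_vN M = {\<rho> \<in> extensional M. star_hom M M \<rho> \<and> normal_map M M \<rho>}"

abbreviation id_endo :: "'h::chilbert_space bop set \<Rightarrow> 'h endo" where
  "id_endo M \<equiv> restrict id M"

definition intertwiners :: "'h::chilbert_space bop set \<Rightarrow> 'h endo \<Rightarrow> 'h endo \<Rightarrow> 'h bop set" where
  "intertwiners M \<rho> \<sigma> = {T \<in> M. \<forall>x\<in>M. T * \<rho> x = \<sigma> x * T}"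

definition unitarily_equiv :: "'h::chilbert_space bop set \<Rightarrow> 'h endo \<Rightarrow> 'h endo \<Rightarrow> bool" where
  "unitarily_equiv M \<rho> \<sigma> \<longleftrightarrow> (\<exists>U \<in> intertwiners M \<rho> \<sigma>. unitary U)"

definition irreducible_endo :: "'h::chilbert_space bop set \<Rightarrow> 'h endo \<Rightarrow> bool" where
  "irreducible_endo M \<rho> \<longleftrightarrow> intertwiners M \<rho> \<rho> = {c *\<^sub>C 1 | c. True}"

text \<open>Index values of \<open>\<rho>(M) \<subseteq> M\<close>: \<open>M\<close> being an infinite factor, the index of a faithful normal
  conditional expectation \<open>\<epsilon>\<close> onto \<open>\<rho>(M)\<close> is the inverse of the best constant \<open>c\<close> in the
  Pimsner-Popa bound \<open>\<epsilon>(x) \<ge> c x\<close> for positive \<open>x\<close>. The infimum of the set below is therefore the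
  minimal index, whose square root is the dimension.\<close>

definition index_bounds :: "'h::chilbert_space bop set \<Rightarrow> 'h endo \<Rightarrow> real set" where
  "index_bounds M \<rho> = {inverse c | c \<epsilon>. 0 < c \<and> fn_cond_exp M (\<rho> ` M) \<epsilon> \<and>
     (\<forall>x\<in>M. pos x \<longrightarrow> pos (\<epsilon> x - complex_of_real c *\<^sub>C x))}"

definition End_fin :: "'h::chilbert_space bop set \<Rightarrow> 'h endo set" where
  "End_fin M = {\<rho> \<in> End_vN M. index_bounds M \<rho> \<noteq> {}}"

definition dimension :: "'h::chilbert_space bop set \<Rightarrow> 'h endo \<Rightarrow> real" where
  "dimension M \<rho> = sqrt (Inf (index_bounds M \<rho>))"

definition conjugate_solutions ::
    "'h::chilbert_space bop set \<Rightarrow> ('h endo \<Rightarrow> 'h endo) \<Rightarrow> ('h endo \<Rightarrow> 'h bop) \<Rightarrow> ('h endo \<Rightarrow> 'h bop) \<Rightarrow> bool" where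
  "conjugate_solutions M cj R R' \<longleftrightarrow> (\<forall>\<rho>\<in>End_fin M. cj \<rho> \<in> End_fin M \<and>
     R \<rho> \<in> intertwiners M (id_endo M) (compose M (cj \<rho>) \<rho>) \<and>
     R' \<rho> \<in> intertwiners M (id_endo M) (compose M \<rho> (cj \<rho>)) \<and>
     adj (R \<rho>) * R \<rho> = complex_of_real (dimension M \<rho>) *\<^sub>C 1 \<and>
     adj (R' \<rho>) * R' \<rho> = complex_of_real (dimension M \<rho>) *\<^sub>C 1 \<and>
     adj (R \<rho>) * cj \<rho> (R' \<rho>) = 1 \<and> adj (R' \<rho>) * \<rho> (R \<rho>) = 1)"

section \<open>Graded categories of endomorphisms\<close>

text \<open>A full subcategory of endomorphisms is given by its set of objects. Closure under subobjects
  means that every nonzero projection in an endomorphism algebra \<open>(\<rho>, \<rho>)\<close> splits in the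
  subcategory.\<close>

definition closed_subcategory :: "'h::chilbert_space bop set \<Rightarrow> 'h endo set \<Rightarrow> bool" where
  "closed_subcategory M D \<longleftrightarrow> D \<subseteq> End_fin M \<and>
     (\<forall>\<rho>\<in>D. \<forall>\<sigma>\<in>End_vN M. unitarily_equiv M \<rho> \<sigma> \<longrightarrow> \<sigma> \<in> D) \<and>
     (\<forall>\<rho>\<in>D. \<forall>\<sigma>\<in>D. \<exists>\<tau>\<in>D. \<exists>S\<in>intertwiners M \<rho> \<tau>. \<exists>T\<in>intertwiners M \<sigma> \<tau>.
        adj S * S = 1 \<and> adj T * T = 1 \<and> S * adj S + T * adj T = 1) \<and>
     (\<forall>\<rho>\<in>D. \<forall>p\<in>intertwiners M \<rho> \<rho>. projection p \<and> p \<noteq> 0 \<longrightarrow>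
        (\<exists>\<sigma>\<in>D. \<exists>S\<in>intertwiners M \<sigma> \<rho>. adj S * S = 1 \<and> S * adj S = p))"

definition rigid_tensor_category ::
    "'h::chilbert_space bop set \<Rightarrow> ('h endo \<Rightarrow> 'h endo) \<Rightarrow> 'h endo set \<Rightarrow> bool" where
  "rigid_tensor_category M cj C \<longleftrightarrow> closed_subcategory M C \<and> id_endo M \<in> C \<and>
     (\<forall>\<rho>\<in>C. \<forall>\<sigma>\<in>C. compose M \<rho> \<sigma> \<in> C) \<and> (\<forall>\<rho>\<in>C. cj \<rho> \<in> C)"

definition irr_representatives ::
    "'h::chilbert_space bop set \<Rightarrow> 'h endo set \<Rightarrow> 'h endo set \<Rightarrow> bool" where
  "irr_representatives M C I \<longleftrightarrow> I \<subseteq> {\<rho> \<in> C. irreducible_endo M \<rho>} \<and> id_endo M \<in> I \<and>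
     (\<forall>\<rho>\<in>C. irreducible_endo M \<rho> \<longrightarrow> (\<exists>!\<sigma>. \<sigma> \<in> I \<and> unitarily_equiv M \<rho> \<sigma>))"

text \<open>The grading group is written additively, its identity element being \<open>0\<close>; the class
  \<^class>\<open>group_add\<close> does not assume commutativity.\<close>

definition graded_category ::
    "'h::chilbert_space bop set \<Rightarrow> ('h endo \<Rightarrow> 'h endo) \<Rightarrow> 'h endo set \<Rightarrow> ('g::group_add \<Rightarrow> 'h endo set) \<Rightarrow> bool" where
  "graded_category M cj C Cg \<longleftrightarrow>
     (\<forall>g. closed_subcategory M (Cg g) \<and> Cg g \<subseteq> C \<and> Cg g \<noteq> {}) \<and>
     (\<forall>\<rho>\<in>C. irreducible_endo M \<rho> \<longrightarrow> (\<exists>!g. \<rho> \<in> Cg g)) \<and>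
     (\<forall>g h. \<forall>\<rho>\<in>Cg g. \<forall>\<sigma>\<in>Cg h. compose M \<rho> \<sigma> \<in> Cg (g + h)) \<and>
     (\<forall>g. \<forall>\<rho>\<in>Cg g. cj \<rho> \<in> Cg (- g))"

section \<open>Opposite algebras and tensor products\<close>

text \<open>\<open>P\<close> is a realisation of the opposite algebra of \<open>M\<close> as a von Neumann algebra, \<open>opp\<close> being
  the canonical anti-isomorphism (the identity of the underlying vector spaces).\<close>

definition opposite_vN ::
    "'h::chilbert_space bop set \<Rightarrow> 'p::chilbert_space bop set \<Rightarrow> ('h bop \<Rightarrow> 'p bop) \<Rightarrow> bool" where
  "opposite_vN M P opp \<longleftrightarrow> vN_algebra P \<and> bij_betw opp M P \<and>
     (\<forall>x\<in>M. \<forall>y\<in>M. opp (x + y) = opp x + opp y \<and> opp (x * y) = opp y * opp x) \<and>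
     (\<forall>x\<in>M. \<forall>c. opp (c *\<^sub>C x) = c *\<^sub>C opp x) \<and> (\<forall>x\<in>M. opp (adj x) = adj (opp x))"

definition opp_conj :: "('h::chilbert_space bop \<Rightarrow> 'p::chilbert_space bop) \<Rightarrow> 'h bop \<Rightarrow> 'p bop" where
  "opp_conj opp x = opp (adj x)"

definition opp_endo ::
    "'h::chilbert_space bop set \<Rightarrow> 'p::chilbert_space bop set \<Rightarrow> ('h bop \<Rightarrow> 'p bop) \<Rightarrow> 'h endo \<Rightarrow> 'p endo" where
  "opp_endo M P opp \<pi> = (\<lambda>y\<in>P. opp_conj opp (\<pi> (inv_into M (opp_conj opp) y)))"

text \<open>The Hilbert space tensor product is determined up to a unique unitary by the following two
  properties of the map sending a pair of vectors to their elementary tensor; they imply that the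
  map is bilinear over the complex numbers, so the real span is the complex span.\<close>

definition hilbert_tensor ::
    "('h::chilbert_space \<Rightarrow> 'p::chilbert_space \<Rightarrow> 't::chilbert_space) \<Rightarrow> bool" where
  "hilbert_tensor t \<longleftrightarrow>
     (\<forall>x y x' y'. cinner (t x y) (t x' y') = cinner x x' * cinner y y') \<and>
     closure (span {t x y | x y. True}) = UNIV"

definition tensor_op ::
    "('h::chilbert_space \<Rightarrow> 'p::chilbert_space \<Rightarrow> 't::chilbert_space) \<Rightarrow> 'h bop \<Rightarrow> 'p bop \<Rightarrow> 't bop" where
  "tensor_op t S T = (THE U. \<forall>x y. app U (t x y) = t (app S x) (app T y))"

definition tensor_vN ::
    "('h::chilbert_space \<Rightarrow> 'p::chilbert_space \<Rightarrow> 't::chilbert_space) \<Rightarrow>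
     'h bop set \<Rightarrow> 'p bop set \<Rightarrow> 't bop set" where
  "tensor_vN t M P = vN_generated {tensor_op t x y | x y. x \<in> M \<and> y \<in> P}"

text \<open>\<open>\<theta>\<close> is the tensor product \<open>\<rho> \<otimes> \<sigma>\<close>, the unique normal endomorphism of the tensor product
  algebra extending \<open>x \<otimes> y \<mapsto> \<rho>(x) \<otimes> \<sigma>(y)\<close>.\<close>

definition is_tensor_endo ::
    "('h::chilbert_space \<Rightarrow> 'p::chilbert_space \<Rightarrow> 't::chilbert_space) \<Rightarrow>
     'h bop set \<Rightarrow> 'p bop set \<Rightarrow> 'h endo \<Rightarrow> 'p endo \<Rightarrow> 't endo \<Rightarrow> bool" where
  "is_tensor_endo t M P \<rho> \<sigma> \<theta> \<longleftrightarrow> \<theta> \<in> End_vN (tensor_vN t M P) \<and>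
     (\<forall>x\<in>M. \<forall>y\<in>P. \<theta> (tensor_op t x y) = tensor_op t (\<rho> x) (\<sigma> y))"

section \<open>Longo-Rehren inclusions\<close>

text \<open>\<open>B\<close> may act on another Hilbert space than the tensor product algebra; the inclusion is the
  normal unital embedding \<open>\<iota>\<close>.\<close>

definition longo_rehren ::
    "'h::chilbert_space bop set \<Rightarrow> ('h endo \<Rightarrow> 'h endo) \<Rightarrow> ('h endo \<Rightarrow> 'h bop) \<Rightarrow> 'h endo set \<Rightarrow> 'h endo set \<Rightarrow>
     'p::chilbert_space bop set \<Rightarrow> ('h bop \<Rightarrow> 'p bop) \<Rightarrow> ('h \<Rightarrow> 'p \<Rightarrow> 't::chilbert_space) \<Rightarrow>
     ('t bop \<Rightarrow> 'k::chilbert_space bop) \<Rightarrow> ('h endo \<Rightarrow> 'k bop) \<Rightarrow> 'k bop set \<Rightarrow> ('k bop \<Rightarrow> 'k bop) \<Rightarrow> bool" where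
  "longo_rehren M cj R C I P opp t \<iota> lam B E \<longleftrightarrow>
     star_hom (tensor_vN t M P) UNIV \<iota> \<and> inj_on \<iota> (tensor_vN t M P) \<and>
     normal_map (tensor_vN t M P) UNIV \<iota> \<and>
     B = vN_generated (\<iota> ` tensor_vN t M P \<union> lam ` C) \<and>
     (\<forall>\<pi>\<in>C. \<exists>\<theta>. is_tensor_endo t M P \<pi> (opp_endo M P opp \<pi>) \<theta> \<and>
        (\<forall>a\<in>tensor_vN t M P. lam \<pi> * \<iota> a = \<iota> (\<theta> a) * lam \<pi>)) \<and>
     (\<forall>\<pi>\<in>C. \<forall>\<rho>\<in>C. lam \<pi> * lam \<rho> = lam (compose M \<pi> \<rho>)) \<and>
     (\<forall>\<pi>\<in>C. adj (lam \<pi>) = adj (\<iota> (tensor_op t (R \<pi>) (opp_conj opp (R \<pi>)))) * lam (cj \<pi>)) \<and>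
     (\<forall>\<pi>\<in>C. \<forall>\<rho>\<in>C. \<forall>T\<in>intertwiners M \<pi> \<rho>.
        \<iota> (tensor_op t T 1) * lam \<pi> = \<iota> (tensor_op t 1 (opp_conj opp (adj T))) * lam \<rho>) \<and>
     fn_cond_exp B (\<iota> ` tensor_vN t M P) E \<and>
     (\<forall>\<pi>\<in>I. \<forall>a\<in>tensor_vN t M P. E (\<iota> a * lam \<pi>) = (if \<pi> = id_endo M then \<iota> a else 0))"

definition LR_component ::
    "'k::chilbert_space bop set \<Rightarrow> ('e \<Rightarrow> 'k bop) \<Rightarrow> 'e set \<Rightarrow> 'k bop set" where
  "LR_component A lam J = sigma_weak closure_of
     {\<Sum>\<pi>\<in>F. a \<pi> * lam \<pi> | F a. finite F \<and> F \<subseteq> J \<and> a ` F \<subseteq> A}"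

section \<open>Crossed products\<close>

text \<open>On \<open>l\<^sup>2(G, H)\<close>: \<open>(\<pi>(b) f)(g) = \<beta>\<^bsub>g\<^sup>-\<^sup>1\<^esub>(b) f(g)\<close> and \<open>(\<tau>(h) f)(g) = f(h\<^sup>-\<^sup>1 g)\<close>, so that
  \<open>\<tau>(h) \<pi>(b) \<tau>(h)\<^sup>* = \<pi>(\<beta>\<^sub>h(b))\<close>.\<close>

definition cp_embed ::
    "('g::group_add \<Rightarrow> 'k::chilbert_space bop \<Rightarrow> 'k bop) \<Rightarrow> 'k bop \<Rightarrow> ('g, 'k) l2 bop" where
  "cp_embed \<beta> b = (THE T. \<forall>f g. coord (app T f) g = app (\<beta> (- g) b) (coord f g))"

definition cp_translation :: "'g::group_add \<Rightarrow> ('g, 'k::chilbert_space) l2 bop" where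
  "cp_translation h = (THE T. \<forall>f g. coord (app T f) g = coord f (- h + g))"

definition crossed_product ::
    "'k::chilbert_space bop set \<Rightarrow> ('g::group_add \<Rightarrow> 'k bop \<Rightarrow> 'k bop) \<Rightarrow> ('g, 'k) l2 bop set" where
  "crossed_product N \<beta> = vN_generated (cp_embed \<beta> ` N \<union> range cp_translation)"

end

theory Submission
  imports Defs
begin

text \<open>The algebra \<open>B\<close> on \<open>K\<close> is generated by \<open>B\<^sub>0\<close> and the \<open>u\<^sub>g\<close>, and the crossed product by the
  corresponding operators on \<open>l\<^sup>2(G, K)\<close>. The two representations of these generators are
  quasi-equivalent, that is, the bounded intertwiners between \<open>K\<close> and \<open>l\<^sup>2(G, K)\<close>
  separate the vectors on both sides, and quasi-equivalent families generate isomorphic von Neumann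
  algebras.

  Intertwiners come from the conditional expectation. A vector functional of \<open>E\<close> has the form
  \<open>\<langle>v, E(x) v\<rangle> = \<langle>\<zeta>, x t \<zeta>\<rangle>\<close> on \<open>B\<close>, with \<open>\<zeta>\<close> in \<open>K \<otimes> l\<^sup>2\<close> and a positive contraction \<open>t\<close> commuting
  with \<open>B\<close>. Let \<open>Q\<close> be the projection onto the closed span of the vectors \<open>a \<lambda>\<^sub>\<pi> \<zeta>\<close> with \<open>\<pi>\<close> of degree \<open>0\<close>.
  Since \<open>E\<close> vanishes in nonzero degrees, \<open>Q t u\<^sub>g Q = 0\<close> for \<open>g \<noteq> 0\<close>, so a Bessel inequality shows
  that \<open>y \<mapsto> (t Q t u\<^sub>g\<^sup>* y)\<^sub>g\<close> is bounded; it is an intertwiner, and the faithfulness of \<open>E\<close> makes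
  these intertwiners separating.

  That \<open>E\<close> vanishes on \<open>a \<lambda>\<^sub>\<pi>\<close> for every, possibly reducible, \<open>\<pi>\<close> of nonzero degree rests on complete
  reducibility. By the Pimsner-Popa inequality a partition of unity in \<open>(\<rho>, \<rho>)\<close> has boundedly many
  members, so a maximal one exists, and its members are irreducible: if \<open>(\<sigma>, \<sigma>)\<close> has no nontrivial
  projection and \<open>S\<close> is a nonscalar positive element normalised to \<open>0 \<le> S \<le> 1\<close> with \<open>0\<close> in its
  spectrum, then \<open>(1 - S)\<^sup>n\<close> tends to \<open>0\<close> strongly, although the inequality bounds its expectation
  from below.\<close>

section \<open>Hilbert space preliminaries\<close>

text \<open>The expectation at hand maps \<open>B\<close> onto \<open>A\<close>, not onto the
  degree-zero algebra, so orthogonality of different degrees is available only after applying vector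
  functionals of \<open>E\<close>. Such a functional is a vector state of \<open>B\<close> on the
  amplified space for the vector \<open>t^(1/2) \<zeta>\<close>; keeping \<open>t\<close> avoids the
  square root, and the price is that the subspaces \<open>u_g Q\<close> are orthogonal for the form
  \<open><x, t y>\<close> rather than for the inner product. Hence the factors \<open>t\<close> in
  the intertwiner. The two operators play different roles: \<open>t\<close> commutes with all of
  \<open>B\<close>, while \<open>Q\<close> commutes only with degree 0, and it is \<open>Q\<close>
  that tells the translates by the \<open>u_g\<close> apart. A second obstacle is that
  \<open>u_g\<close> and the elements of the degree-zero algebra are only sigma-weak limits of
  finite sums, with no norm control on the approximants. Every statement about them is therefore a
  vanishing statement for normal functionals, which survives such limits; the grading is carried by
  annihilators and bicommutants, never by approximating nets.\<close>

lemma inner_scaleC_left: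
  fixes x y :: "'h::chilbert_space"
  shows "inner (c *\<^sub>C x) y = inner x (cnj c *\<^sub>C y)"
proof -
  have "\<i> *\<^sub>C \<i> *\<^sub>C y = - y"
    using scaleC_of_real[of "-1" y] by (simp add: scaleC_scaleC)
  then have "inner (\<i> *\<^sub>C x) y = - inner x (\<i> *\<^sub>C y)"
    using inner_ii[of x "\<i> *\<^sub>C y"] by simp
  then show ?thesis
    by (subst (1 2) scaleC_eq) (simp add: inner_simps)
qed

lemma inner_scaleC_right:
  fixes x y :: "'h::chilbert_space"
  shows "inner x (c *\<^sub>C y) = inner (cnj c *\<^sub>C x) y"
  by (simp add: inner_scaleC_left)

lemma scaleC_one [simp]: "1 *\<^sub>C (x::'h::chilbert_space) = x"
  using scaleC_of_real[of 1 x] by simp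

lemma scaleC_zero_left [simp]: "0 *\<^sub>C (x::'h::chilbert_space) = 0"
  using scaleC_of_real[of 0 x] by simp

lemma scaleC_minus_one [simp]: "(- 1) *\<^sub>C (x::'h::chilbert_space) = - x"
  using scaleC_of_real[of "-1" x] by simp

lemma scaleC_minus_left: "(- c) *\<^sub>C (x::'h::chilbert_space) = - (c *\<^sub>C x)"
  using scaleC_scaleC[of "- 1" c x] by simp

lemma norm_scaleC: "norm (c *\<^sub>C (x::'h::chilbert_space)) = cmod c * norm x"
proof -
  have "(norm (c *\<^sub>C x))\<^sup>2 = inner x ((cnj c * c) *\<^sub>C x)"
    by (simp add: power2_norm_eq_inner inner_scaleC_left scaleC_scaleC)
  also have "cnj c * c = complex_of_real ((cmod c)\<^sup>2)"
    by (metis complex_norm_square mult.commute)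
  also have "inner x (complex_of_real ((cmod c)\<^sup>2) *\<^sub>C x) = (cmod c * norm x)\<^sup>2"
    unfolding scaleC_of_real by (simp add: power2_norm_eq_inner power_mult_distrib)
  finally show ?thesis by (simp add: power2_eq_iff_nonneg)
qed

lemma cinner_eq_iff:
  fixes x y x' y' :: "'h::chilbert_space" 
  shows "cinner x y = cinner x' y' \<longleftrightarrow> inner x y = inner x' y' \<and> inner (\<i> *\<^sub>C x) y = inner (\<i> *\<^sub>C x') y'"
  by (simp add: cinner_def)

lemma Re_cinner: "Re (cinner x y) = inner x y"
  by (simp add: cinner_def)

section \<open>Projection theorem, Riesz representation and adjoints\<close>

lemma eq_by_inner:
  fixes x y :: "'a::real_inner"
  assumes "\<And>z. inner x z = inner y z"
  shows "x = y"
  by (metis assms vector_eq_rdot)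

text \<open>A minimising sequence for the distance is Cauchy by the parallelogram identity, and
  minimality along lines in \<open>S\<close> gives orthogonality. The real inner product suffices:
  for a complex subspace, real orthogonality already implies complex orthogonality.\<close>

lemma orthogonal_decomposition:
  fixes S :: "'a::{real_inner,complete_space} set"
  assumes S: "subspace S" "closed S"
  shows "\<exists>y\<in>S. \<forall>z\<in>S. inner (x - y) z = 0"
proof -
  define D where "D = (\<lambda>y. (norm (x - y))\<^sup>2) ` S"
  have bdd: "bdd_below D" unfolding D_def by (intro bdd_belowI2[where m = 0]) simp
  have ne: "D \<noteq> {}" using S(1) subspace_0 by (auto simp: D_def)
  define d where "d = Inf D"
  have low: "d \<le> (norm (x - y))\<^sup>2" if "y \<in> S" for y
    unfolding d_def by (rule cInf_lower[OF _ bdd]) (use that in \<open>auto simp: D_def\<close>)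
  have "\<exists>y\<in>S. (norm (x - y))\<^sup>2 < d + inverse (real (Suc n))" for n
    using cInf_lessD[OF ne, of "d + inverse (real (Suc n))"] by (auto simp: d_def D_def)
  then obtain y where yS: "\<And>n. y n \<in> S"
    and y: "\<And>n. (norm (x - y n))\<^sup>2 < d + inverse (real (Suc n))"
    by metis
  have par: "(norm (v - w))\<^sup>2 \<le> 2 * (norm (x - v))\<^sup>2 + 2 * (norm (x - w))\<^sup>2 - 4 * d"
    if "v \<in> S" "w \<in> S" for v w
  proof -
    have "(1/2) *\<^sub>R (v + w) \<in> S" using S(1) that by (simp add: subspace_add subspace_scale)
    note low[OF this]
    moreover have "(norm (v - w))\<^sup>2 = 2 * (norm (x - v))\<^sup>2 + 2 * (norm (x - w))\<^sup>2
        - 4 * (norm (x - (1/2) *\<^sub>R (v + w)))\<^sup>2"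
      unfolding power2_norm_eq_inner
      by (simp add: inner_simps algebra_simps inner_commute)
    ultimately show ?thesis by linarith
  qed
  have "Cauchy y"
  proof (rule metric_CauchyI)
    fix e :: real assume "e > 0"
    obtain N where N: "inverse (real (Suc N)) < e\<^sup>2 / 4"
      using reals_Archimedean[of "e\<^sup>2 / 4"] \<open>e > 0\<close> by auto
    have "dist (y m) (y n) < e" if "m \<ge> N" "n \<ge> N" for m n
    proof -
      have inv: "inverse (real (Suc k)) \<le> inverse (real (Suc N))" if "k \<ge> N" for k
        using that by (simp add: le_imp_inverse_le)
      have "(norm (y m - y n))\<^sup>2 < e\<^sup>2"
        using par[OF yS yS, of m n] y[of m] y[of n] N that(1,2)[THEN inv] by linarith
      then show ?thesis using \<open>e > 0\<close> by (simp add: dist_norm power_less_imp_less_base)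
    qed
    then show "\<exists>N. \<forall>m\<ge>N. \<forall>n\<ge>N. dist (y m) (y n) < e" by blast
  qed
  then obtain l where l: "y \<longlonglongrightarrow> l" using Cauchy_convergent convergent_def by blast
  have lS: "l \<in> S" using S(2) yS l closed_sequentially by blast
  have "(\<lambda>n. (norm (x - y n))\<^sup>2) \<longlonglongrightarrow> (norm (x - l))\<^sup>2" by (intro tendsto_intros l)
  moreover have "(\<lambda>n. d + inverse (real (Suc n))) \<longlonglongrightarrow> d + 0"
    by (intro tendsto_intros LIMSEQ_inverse_real_of_nat)
  ultimately have ld: "(norm (x - l))\<^sup>2 \<le> d"
    using y by (intro LIMSEQ_le[of _ _ "\<lambda>n. d + inverse (real (Suc n))"]) (auto intro!: exI[of _ 0] less_imp_le)
  have "inner (x - l) z = 0" if "z \<in> S" for z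
  proof (rule ccontr)
    assume nz: "inner (x - l) z \<noteq> 0"
    then have z0: "inner z z > 0" by (auto simp: inner_gt_zero_iff)
    \<comment> \<open>The minimum point of the squared distance from \<open>x\<close> to
      \<open>l + s *\<^sub>R z\<close> as a quadratic function of \<open>s\<close>.\<close>
    define s where "s = inner (x - l) z / inner z z"
    have "l + s *\<^sub>R z \<in> S" using S(1) lS that by (simp add: subspace_add subspace_scale)
    from low[OF this] ld have "(norm (x - l))\<^sup>2 \<le> (norm (x - (l + s *\<^sub>R z)))\<^sup>2"
      by linarith
    also have "x - (l + s *\<^sub>R z) = (x - l) - s *\<^sub>R z" by simp
    also have "(norm ((x - l) - s *\<^sub>R z))\<^sup>2 = (norm (x - l))\<^sup>2 - 2 * s * inner (x - l) z + s\<^sup>2 * inner z z"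
      unfolding power2_norm_eq_inner
      by (simp add: inner_diff inner_commute algebra_simps power2_eq_square)
    also have "\<dots> = (norm (x - l))\<^sup>2 - (inner (x - l) z)\<^sup>2 / inner z z"
      using z0 by (simp add: s_def power2_eq_square field_simps)
    finally show False using nz z0 by (simp add: field_simps)
  qed
  then show ?thesis using lS by blast
qed

text \<open>The functional is a multiple of the inner product with a vector orthogonal to its
  kernel. Real functionals are enough for adjoints, which the real inner product determines.\<close>

lemma riesz_representation:
  fixes \<phi> :: "'a::{real_inner,complete_space} \<Rightarrow> real"
  assumes "bounded_linear \<phi>"
  shows "\<exists>z. \<forall>x. \<phi> x = inner z x"
proof (cases "\<forall>x. \<phi> x = 0")
  case True
  then show ?thesis by (auto intro!: exI[of _ 0])
next
  case False
  interpret bounded_linear \<phi> by fact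
  obtain x where x: "\<phi> x \<noteq> 0" using False by blast
  have sub: "subspace {v. \<phi> v = 0}" by (auto simp: subspace_def zero add scale)
  have cl: "closed {v. \<phi> v = 0}"
    by (intro closed_Collect_eq continuous_on continuous_on_id continuous_intros)
  obtain y where y: "\<phi> y = 0" "\<And>z. \<phi> z = 0 \<Longrightarrow> inner (x - y) z = 0"
    using orthogonal_decomposition[OF sub cl, of x] by blast
  define w where "w = x - y"
  have w: "\<phi> w = \<phi> x" "w \<noteq> 0" using x y by (auto simp: w_def diff)
  have "\<phi> v = inner ((\<phi> w / inner w w) *\<^sub>R w) v" for v
  proof -
    have "inner w (v - (\<phi> v / \<phi> w) *\<^sub>R w) = 0"
      unfolding w_def by (rule y(2)) (use w x in \<open>simp add: diff scale w_def[symmetric]\<close>)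
    then have "inner w v = \<phi> v / \<phi> w * inner w w" by (simp add: inner_diff_right)
    then show ?thesis using w x by (simp add: field_simps)
  qed
  then show ?thesis by blast
qed

text \<open>Intertwiners act between two different Hilbert spaces, whereas the type
  \<open>bop\<close> describes operators on a single one.\<close>

definition bounded_clinear :: "('h::chilbert_space \<Rightarrow> 'k::chilbert_space) \<Rightarrow> bool" where
  "bounded_clinear f \<longleftrightarrow> bounded_linear f \<and> (\<forall>c x. f (c *\<^sub>C x) = c *\<^sub>C f x)"

lemma bounded_clinear_compose:
  "bounded_clinear f \<Longrightarrow> bounded_clinear g \<Longrightarrow> bounded_clinear (\<lambda>x. f (g x))"
  by (auto simp: bounded_clinear_def bounded_linear_compose)

lemma bounded_clinear_app: "bounded_clinear (app T)"
  using app[of T] by (simp add: bounded_clinear_def)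

lemma bounded_clinear_add: "bounded_clinear f \<Longrightarrow> f (x + y) = f x + f y"
  by (simp add: bounded_clinear_def linear_simps)

lemma bounded_clinear_diff: "bounded_clinear f \<Longrightarrow> f (x - y) = f x - f y"
  by (simp add: bounded_clinear_def linear_simps)

lemma bounded_clinear_zero: "bounded_clinear f \<Longrightarrow> f 0 = 0"
  by (simp add: bounded_clinear_def linear_simps)

lemma bounded_clinear_scaleC: "bounded_clinear f \<Longrightarrow> f (c *\<^sub>C x) = c *\<^sub>C f x"
  by (simp add: bounded_clinear_def)

lemma bounded_clinear_sum: "bounded_clinear f \<Longrightarrow> f (\<Sum>i\<in>F. h i) = (\<Sum>i\<in>F. f (h i))"
  unfolding bounded_clinear_def by (intro linear_sum) (auto intro: bounded_linear.linear)

text \<open>For complex linear maps the identity for the real inner product implies the one for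
  \<open>cinner\<close>, since \<open>\<i>\<close> can be moved through \<open>V\<close>.\<close>

definition adjoint_pair :: "('h::chilbert_space \<Rightarrow> 'k::chilbert_space) \<Rightarrow> ('k \<Rightarrow> 'h) \<Rightarrow> bool" where
  "adjoint_pair V W \<longleftrightarrow> bounded_clinear V \<and> bounded_clinear W \<and>
     (\<forall>x y. inner (V x) y = inner x (W y))"

lemma adjoint_pair_commute: "adjoint_pair V W \<longleftrightarrow> adjoint_pair W V"
  unfolding adjoint_pair_def by (metis inner_commute)

lemma adjoint_exists:
  fixes V :: "'h::chilbert_space \<Rightarrow> 'k::chilbert_space"
  assumes V: "bounded_clinear V"
  shows "\<exists>W. adjoint_pair V W"
proof -
  have bl: "bounded_linear V" using V by (simp add: bounded_clinear_def)
  have "\<exists>z. \<forall>x. inner y (V x) = inner z x" for y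
    by (rule riesz_representation)
      (rule bounded_linear_compose[OF bounded_linear_inner_right bl])
  then obtain W where W: "\<And>x y. inner y (V x) = inner (W y) x" by metis
  obtain K where K: "\<And>x. norm (V x) \<le> norm x * K" "K > 0"
    using bl bounded_linear.pos_bounded by blast
  have "bounded_linear W"
  proof (rule bounded_linear_intro[where K = K])
    fix x y r
    show "W (x + y) = W x + W y"
      by (rule eq_by_inner) (simp add: inner_add_left flip: W)
    show "W (r *\<^sub>R x) = r *\<^sub>R W x"
      by (rule eq_by_inner) (simp flip: W)
    have "(norm (W x))\<^sup>2 = inner x (V (W x))" by (simp add: W power2_norm_eq_inner)
    also have "\<dots> \<le> norm x * (norm (W x) * K)"
      by (metis K(1) norm_cauchy_schwarz mult_left_mono norm_ge_zero order_trans)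
    finally have "norm (W x) * norm (W x) \<le> norm (W x) * (norm x * K)"
      by (simp add: power2_eq_square mult_ac)
    then show "norm (W x) \<le> norm x * K"
      using K(2) by (cases "norm (W x) = 0") (auto simp: mult_le_cancel_left)
  qed
  moreover have "W (c *\<^sub>C x) = c *\<^sub>C W x" for c x
    by (rule eq_by_inner)
      (simp add: inner_scaleC_left bounded_clinear_scaleC[OF V] flip: W)
  ultimately show ?thesis using V W
    by (auto simp: adjoint_pair_def bounded_clinear_def inner_commute intro!: exI[of _ W])
qed

section \<open>Calculus of bounded operators\<close>

lemma bop_eqI: "(\<And>x. app S x = app T x) \<Longrightarrow> S = T"
  by (metis app_inject ext)

lemma bop_obtain:
  assumes "bounded_clinear f"
  obtains T where "app T = f"
  using assms Abs_bop_inverse[of f] by (auto simp: bounded_clinear_def)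

lemmas app_simps [simp] = zero_bop.rep_eq one_bop.rep_eq plus_bop.rep_eq uminus_bop.rep_eq
  minus_bop.rep_eq times_bop.rep_eq scaleC_bop.rep_eq

lemma bounded_linear_app: "bounded_linear (app T)"
  using app[of T] by simp

lemmas app_add [simp] = bounded_clinear_add[OF bounded_clinear_app]
lemmas app_diff [simp] = bounded_clinear_diff[OF bounded_clinear_app]
lemmas app_zero_vec [simp] = bounded_clinear_zero[OF bounded_clinear_app]
lemmas app_scaleC [simp] = bounded_clinear_scaleC[OF bounded_clinear_app]
lemmas app_sum_vec = bounded_clinear_sum[OF bounded_clinear_app]

lemma app_scaleR [simp]: "app T (r *\<^sub>R x) = r *\<^sub>R app T x"
  by (metis app_scaleC scaleC_of_real)

lemma app_sum: "app (\<Sum>i\<in>F. T i) x = (\<Sum>i\<in>F. app (T i) x)"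
  by (induction F rule: infinite_finite_induct) auto

text \<open>Discharges the definite description in \<open>adj\<close>: the Riesz adjoint satisfies
  it, and the real part of the condition already forces uniqueness.\<close>

lemma adjoint_pair_adj: "adjoint_pair (app T) (app (adj T))"
proof -
  obtain W where "adjoint_pair (app T) W" using adjoint_exists[OF bounded_clinear_app] by blast
  then have ap: "adjoint_pair W (app T)" by (rule adjoint_pair_commute[THEN iffD1])
  then obtain S where S: "app S = W" using bop_obtain unfolding adjoint_pair_def by blast
  have "adj T = S" unfolding adj_def
  proof (rule the_equality)
    show "\<forall>x y. cinner (app S x) y = cinner x (app T y)"
      using ap by (simp add: cinner_eq_iff adjoint_pair_def S flip: bounded_clinear_scaleC)
    fix S' assume S': "\<forall>x y. cinner (app S' x) y = cinner x (app T y)"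
    show "S' = S"
    proof (rule bop_eqI, rule eq_by_inner)
      fix x y show "inner (app S' x) y = inner (app S x) y"
        using S' ap unfolding cinner_eq_iff by (simp add: S adjoint_pair_def)
    qed
  qed
  then show ?thesis using ap S by (auto intro: adjoint_pair_commute[THEN iffD1])
qed

lemma inner_adj_left: "inner (app (adj T) x) y = inner x (app T y)"
  using adjoint_pair_adj[of T] by (metis adjoint_pair_def inner_commute)

lemma inner_adj_right: "inner x (app (adj T) y) = inner (app T x) y"
  by (metis inner_adj_left inner_commute)

lemma adj_eqI:
  assumes "\<And>x y. inner (app S x) y = inner x (app T y)"
  shows "adj T = S"
  by (rule bop_eqI, rule eq_by_inner) (simp add: inner_adj_left assms)

lemma adj_adj [simp]: "adj (adj T) = T"
  by (rule adj_eqI) (simp add: inner_adj_right)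

lemma adj_mult [simp]: "adj (S * T) = adj T * adj S"
  by (rule adj_eqI) (simp add: inner_adj_left)

lemma adj_add [simp]: "adj (S + T) = adj S + adj T"
  by (rule adj_eqI) (simp add: inner_adj_left inner_simps)

lemma adj_diff [simp]: "adj (S - T) = adj S - adj T"
  by (rule adj_eqI) (simp add: inner_adj_left inner_simps)

lemma adj_one [simp]: "adj 1 = 1"
  by (rule adj_eqI) simp

lemma adj_zero [simp]: "adj 0 = 0"
  by (rule adj_eqI) simp

lemma adj_scaleC [simp]: "adj (c *\<^sub>C T) = cnj c *\<^sub>C adj T"
  by (rule adj_eqI) (simp add: inner_scaleC_left inner_adj_left)

lemma scaleC_bop_mult_left [simp]: "(c *\<^sub>C S) * T = c *\<^sub>C (S * (T::'h::chilbert_space bop))"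
  by (rule bop_eqI) simp

lemma scaleC_bop_mult_right [simp]: "S * (c *\<^sub>C T) = c *\<^sub>C (S * (T::'h::chilbert_space bop))"
  by (rule bop_eqI) simp

lemma bop_bounded:
  obtains C where "C > 0" "\<And>x. norm (app T x) \<le> C * norm x"
  using bounded_linear.pos_bounded[OF bounded_linear_app, of T] by (metis mult.commute)

lemma adj_mult_self_eq_0:
  assumes "adj T * T = 0"
  shows "T = 0"
proof (rule bop_eqI)
  fix x
  have "inner (app T x) (app T x) = inner x (app (adj T * T) x)" by (simp add: inner_adj_right)
  then show "app T x = app 0 x" using assms by simp
qed

lemma scaleC_ii_ii [simp]: "\<i> *\<^sub>C \<i> *\<^sub>C x = - (x::'h::chilbert_space)"
  using scaleC_of_real[of "-1" x] by (simp add: scaleC_scaleC)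

lemma pos_iff: "pos T \<longleftrightarrow> adj T = T \<and> (\<forall>x. 0 \<le> inner x (app T x))"
proof
  assume T: "pos T"
  have "\<exists>r\<ge>0. cinner x (app T x) = complex_of_real r" for x
    using T unfolding pos_def by auto
  then have re: "0 \<le> inner x (app T x)" and im: "inner (\<i> *\<^sub>C x) (app T x) = 0" for x
    unfolding cinner_def by (force simp: complex_eq_iff)+
  \<comment> \<open>In a complex space a real-valued quadratic form is symmetric: polarise the
    vanishing imaginary part, then replace \<open>x\<close> by
    \<open>\<i> *\<^sub>C x\<close>.\<close>
  have sym: "inner (\<i> *\<^sub>C x) (app T y) + inner (\<i> *\<^sub>C y) (app T x) = 0" for x y
    using im[of "x + y"] im[of x] im[of y] by (simp add: scaleC_add_right inner_simps)
  have "inner (app T y) x = inner y (app T x)" for x y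
    using sym[of "\<i> *\<^sub>C x" y] by (simp add: inner_ii inner_commute)
  then show "adj T = T \<and> (\<forall>x. 0 \<le> inner x (app T x))" using re by (auto intro: adj_eqI)
next
  assume T: "adj T = T \<and> (\<forall>x. 0 \<le> inner x (app T x))"
  have im: "inner (\<i> *\<^sub>C x) (app T x) = 0" for x
  proof -
    have "inner (\<i> *\<^sub>C x) (app T x) = inner (app T (\<i> *\<^sub>C x)) x"
      using inner_adj_left[of T "\<i> *\<^sub>C x" x] T by simp
    also have "\<dots> = inner (\<i> *\<^sub>C \<i> *\<^sub>C app T x) (\<i> *\<^sub>C x)" by (simp only: app_scaleC inner_ii)
    also have "\<dots> = - inner (\<i> *\<^sub>C x) (app T x)" by (simp add: inner_commute)
    finally show ?thesis by simp
  qed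
  have "cinner x (app T x) = complex_of_real (inner x (app T x))" for x
    by (simp add: cinner_def im complex_eq_iff)
  then show "pos T" using T unfolding pos_def by (metis atLeast_iff image_eqI)
qed

lemma pos_adj_mult: "pos (adj T * T)"
  by (simp add: pos_iff inner_adj_right)

lemma projection_pos: "projection p \<Longrightarrow> pos p"
  using pos_adj_mult[of p] by (simp add: projection_def)

section \<open>Commutants\<close>

lemma commutantI: "(\<And>x. x \<in> S \<Longrightarrow> T * x = x * T) \<Longrightarrow> T \<in> commutant S"
  by (simp add: commutant_def)

lemma commutantD: "T \<in> commutant S \<Longrightarrow> x \<in> S \<Longrightarrow> T * x = x * T"
  by (simp add: commutant_def)

lemma commutant_antimono: "S \<subseteq> T \<Longrightarrow> commutant T \<subseteq> commutant S"
  by (auto simp: commutant_def)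

lemma commutant_commutant_extensive: "S \<subseteq> commutant (commutant S)"
  by (auto simp: commutant_def)

lemma commutant_triple [simp]: "commutant (commutant (commutant S)) = commutant S"
  by (meson commutant_antimono commutant_commutant_extensive subset_antisym)

lemma bicommutant_mono: "S \<subseteq> T \<Longrightarrow> commutant (commutant S) \<subseteq> commutant (commutant T)"
  by (intro commutant_antimono)

lemma bicommutant_least:
  "S \<subseteq> commutant (commutant T) \<Longrightarrow> commutant (commutant S) \<subseteq> commutant (commutant T)"
  using bicommutant_mono commutant_triple by metis

lemma commutant_mult: "S \<in> commutant X \<Longrightarrow> T \<in> commutant X \<Longrightarrow> S * T \<in> commutant X"
  by (simp add: commutant_def) (metis mult.assoc)

lemma commutant_add: "S \<in> commutant X \<Longrightarrow> T \<in> commutant X \<Longrightarrow> S + T \<in> commutant X"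
  by (simp add: commutant_def distrib_left distrib_right)

lemma commutant_diff: "S \<in> commutant X \<Longrightarrow> T \<in> commutant X \<Longrightarrow> S - T \<in> commutant X"
  by (simp add: commutant_def left_diff_distrib right_diff_distrib)

lemma commutant_scaleC: "S \<in> commutant X \<Longrightarrow> c *\<^sub>C S \<in> commutant X"
  by (simp add: commutant_def)

lemma commutant_one: "1 \<in> commutant X"
  by (simp add: commutant_def)

lemma commutant_zero: "0 \<in> commutant X"
  by (simp add: commutant_def)

lemma commutant_sum: "(\<And>i. i \<in> F \<Longrightarrow> S i \<in> commutant X) \<Longrightarrow> (\<Sum>i\<in>F. S i) \<in> commutant X"
  by (induction F rule: infinite_finite_induct) (auto intro: commutant_add commutant_zero)

lemma commutant_adj:
  assumes "adj ` X \<subseteq> X" "T \<in> commutant X"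
  shows "adj T \<in> commutant X"
proof (rule commutantI)
  fix x assume "x \<in> X"
  then have "T * adj x = adj x * T" using assms by (auto intro: commutantD)
  from arg_cong[OF this, of adj] show "adj T * x = x * adj T" by simp
qed

lemma commutant_adj_image: "adj ` X \<subseteq> X \<Longrightarrow> adj ` commutant X \<subseteq> commutant X"
  using commutant_adj by blast

lemma vN_generated_base: "S \<subseteq> vN_generated S"
  unfolding vN_generated_def using commutant_commutant_extensive by blast

lemma vN_generated_adj: "T \<in> vN_generated S \<Longrightarrow> adj T \<in> vN_generated S"
  unfolding vN_generated_def by (intro commutant_adj commutant_adj_image) auto

lemma vN_algebra_vN_generated: "vN_algebra (vN_generated S)"
  unfolding vN_algebra_def using vN_generated_adj by (auto simp: vN_generated_def)

lemma vN_algebra_bicommutant: "vN_algebra N \<Longrightarrow> N = commutant (commutant N)"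
  by (simp add: vN_algebra_def)

lemma
  assumes "vN_algebra N"
  shows vN_mult: "x \<in> N \<Longrightarrow> y \<in> N \<Longrightarrow> x * y \<in> N"
    and vN_add: "x \<in> N \<Longrightarrow> y \<in> N \<Longrightarrow> x + y \<in> N"
    and vN_diff: "x \<in> N \<Longrightarrow> y \<in> N \<Longrightarrow> x - y \<in> N"
    and vN_scaleC: "x \<in> N \<Longrightarrow> c *\<^sub>C x \<in> N"
    and vN_one: "1 \<in> N"
    and vN_zero: "0 \<in> N"
    and vN_adj: "x \<in> N \<Longrightarrow> adj x \<in> N"
    and vN_sum: "(\<And>i. i \<in> F \<Longrightarrow> f i \<in> N) \<Longrightarrow> (\<Sum>i\<in>F. f i) \<in> N"
proof -
  note eq = vN_algebra_bicommutant[OF assms]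
  show "x \<in> N \<Longrightarrow> y \<in> N \<Longrightarrow> x * y \<in> N" using eq commutant_mult by metis
  show "x \<in> N \<Longrightarrow> y \<in> N \<Longrightarrow> x + y \<in> N" using eq commutant_add by metis
  show "x \<in> N \<Longrightarrow> y \<in> N \<Longrightarrow> x - y \<in> N" using eq commutant_diff by metis
  show "x \<in> N \<Longrightarrow> c *\<^sub>C x \<in> N" using eq commutant_scaleC by metis
  show "1 \<in> N" using eq commutant_one by metis
  show "0 \<in> N" using eq commutant_zero by metis
  show "x \<in> N \<Longrightarrow> adj x \<in> N" using assms by (auto simp: vN_algebra_def)
  show "(\<And>i. i \<in> F \<Longrightarrow> f i \<in> N) \<Longrightarrow> (\<Sum>i\<in>F. f i) \<in> N" using eq commutant_sum by metis
qed

section \<open>Closed subspaces and extension of operators\<close>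

lemma subspace_closure:
  fixes S :: "'a::real_normed_vector set"
  assumes "subspace S"
  shows "subspace (closure S)"
proof (rule subspaceI)
  show "0 \<in> closure S" using assms closure_subset subspace_0 by blast
  fix x y assume "x \<in> closure S" "y \<in> closure S"
  then obtain u v where "\<And>n. u n \<in> S" "u \<longlonglongrightarrow> x" "\<And>n. v n \<in> S" "v \<longlonglongrightarrow> y"
    by (metis closure_sequential)
  then show "x + y \<in> closure S"
    unfolding closure_sequential using assms
    by (intro exI[of _ "\<lambda>n. u n + v n"]) (auto intro: tendsto_add subspace_add)
next
  fix c x assume "x \<in> closure S"
  then obtain u where "\<And>n. u n \<in> S" "u \<longlonglongrightarrow> x" by (metis closure_sequential)
  then show "c *\<^sub>R x \<in> closure S"
    unfolding closure_sequential using assms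
    by (intro exI[of _ "\<lambda>n. c *\<^sub>R u n"]) (auto intro: tendsto_scaleR subspace_scale)
qed

definition closed_csubspace :: "'h::chilbert_space set \<Rightarrow> bool" where
  "closed_csubspace S \<longleftrightarrow> subspace S \<and> closed S \<and> (\<forall>c. \<forall>x\<in>S. c *\<^sub>C x \<in> S)"

text \<open>\<open>span\<close> is the real span, so complex multiples are adjoined first; the
  result is the closed complex span.\<close>

definition cspan_closure :: "'h::chilbert_space set \<Rightarrow> 'h set" where
  "cspan_closure X = closure (span {c *\<^sub>C x | c x. x \<in> X})"

lemma closed_csubspace_cspan_closure: "closed_csubspace (cspan_closure X)"
proof -
  define Y where "Y = {c *\<^sub>C x | c x. x \<in> X}"
  have Y: "d *\<^sub>C y \<in> span Y" if "y \<in> span Y" for d y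
    using that
  proof (induction rule: span_induct_alt)
    case base
    then show ?case by (simp add: span_zero)
  next
    case (step r v w)
    have "d *\<^sub>C v \<in> Y" using step(1) unfolding Y_def mem_Collect_eq by (metis scaleC_scaleC)
    then show ?case using step by (simp add: scaleC_add_right scaleC_scaleR span_add span_mul span_base)
  qed
  have "d *\<^sub>C y \<in> closure (span Y)" if "y \<in> closure (span Y)" for d y
  proof -
    have "(\<lambda>x. d *\<^sub>C x) ` closure (span Y) \<subseteq> closure ((\<lambda>x. d *\<^sub>C x) ` span Y)"
      by (rule closure_bounded_linear_image_subset[OF bounded_linear_scaleC])
    also have "\<dots> \<subseteq> closure (span Y)" using Y by (intro closure_mono) auto
    finally show ?thesis using that by auto
  qed
  then show ?thesis unfolding closed_csubspace_def cspan_closure_def Y_def[symmetric]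
    by (auto simp: subspace_closure)
qed

lemma cspan_closure_superset: "X \<subseteq> cspan_closure X"
proof
  fix x assume "x \<in> X"
  then have "1 *\<^sub>C x \<in> span {c *\<^sub>C x | c x. x \<in> X}" by (intro span_base) blast
  then have "x \<in> span {c *\<^sub>C x | c x. x \<in> X}" by simp
  then show "x \<in> cspan_closure X"
    unfolding cspan_closure_def using closure_subset by blast
qed

lemma cspan_closure_minimal:
  assumes "X \<subseteq> S" "closed_csubspace S"
  shows "cspan_closure X \<subseteq> S"
  using assms unfolding cspan_closure_def closed_csubspace_def
  by (intro closure_minimal span_minimal) auto

lemma closed_csubspace_vimage:
  assumes "bounded_clinear f" "closed_csubspace S"
  shows "closed_csubspace (f -` S)"
  unfolding closed_csubspace_def
proof (intro conjI)
  show "subspace (f -` S)"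
    using assms unfolding bounded_clinear_def closed_csubspace_def
    by (intro linear_subspace_vimage bounded_linear.linear) auto
  show "closed (f -` S)"
    using assms unfolding bounded_clinear_def closed_csubspace_def
    by (intro continuous_closed_vimage) (auto intro: linear_continuous_at)
qed (use assms in \<open>auto simp: bounded_clinear_def closed_csubspace_def\<close>)

lemma cspan_closure_image:
  assumes f: "bounded_clinear f" and sub: "\<And>x. x \<in> X \<Longrightarrow> f x \<in> cspan_closure Y"
    and "x \<in> cspan_closure X"
  shows "f x \<in> cspan_closure Y"
  using cspan_closure_minimal[of X "f -` cspan_closure Y"]
    closed_csubspace_vimage[OF f closed_csubspace_cspan_closure] sub assms(3) by blast

text \<open>Real orthogonality to both \<open>y\<close> and \<open>\<i> *\<^sub>C y\<close> is
  complex orthogonality to \<open>y\<close>, which is stable under complex scalars.\<close>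

lemma closed_csubspace_orthogonal: "closed_csubspace {x. inner x y = 0 \<and> inner x (\<i> *\<^sub>C y) = 0}"
proof -
  have "closed {x. inner x z = 0}" for z :: 'a
    by (intro closed_Collect_eq continuous_intros)
  then have cl: "closed {x. inner x y = 0 \<and> inner x (\<i> *\<^sub>C y) = 0}"
    by (intro closed_Collect_conj)
  have "inner (c *\<^sub>C x) y = 0 \<and> inner (c *\<^sub>C x) (\<i> *\<^sub>C y) = 0"
    if x: "inner x y = 0" "inner x (\<i> *\<^sub>C y) = 0" for x c
  proof -
    have "inner x (d *\<^sub>C y) = 0" for d
      using x by (subst scaleC_eq) (simp add: inner_simps)
    then show ?thesis by (simp add: inner_scaleC_left scaleC_scaleC)
  qed
  then show ?thesis using cl by (auto simp: closed_csubspace_def subspace_def inner_simps)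
qed

lemma orthogonal_cspan_closure:
  assumes "\<And>x c. x \<in> X \<Longrightarrow> inner (c *\<^sub>C x) y = 0" and "z \<in> cspan_closure X"
  shows "inner z y = 0"
proof -
  have "inner x (\<i> *\<^sub>C y) = 0" if "x \<in> X" for x
    using assms(1)[OF that] by (simp add: inner_scaleC_right)
  then have "X \<subseteq> {x. inner x y = 0 \<and> inner x (\<i> *\<^sub>C y) = 0}"
    using assms(1)[where c = 1] by auto
  from cspan_closure_minimal[OF this closed_csubspace_orthogonal] show ?thesis
    using assms(2) by auto
qed

lemma cspan_closure_UNIV:
  assumes "\<And>y. (\<And>x c. x \<in> X \<Longrightarrow> inner (c *\<^sub>C x) y = 0) \<Longrightarrow> y = 0"
  shows "cspan_closure X = UNIV"
proof -
  have "v \<in> cspan_closure X" for v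
  proof -
    obtain y where y: "y \<in> cspan_closure X" "\<And>z. z \<in> cspan_closure X \<Longrightarrow> inner (v - y) z = 0"
      using orthogonal_decomposition[of "cspan_closure X" v] closed_csubspace_cspan_closure
      unfolding closed_csubspace_def by metis
    have "v - y = 0"
    proof (rule assms)
      fix x c assume "x \<in> X"
      then have "c *\<^sub>C x \<in> cspan_closure X"
        using cspan_closure_superset closed_csubspace_cspan_closure
        unfolding closed_csubspace_def by blast
      from y(2)[OF this] show "inner (c *\<^sub>C x) (v - y) = 0" by (simp add: inner_commute)
    qed
    then show ?thesis using y by simp
  qed
  then show ?thesis by blast
qed

lemma projection_onto:
  assumes S: "closed_csubspace S"
  obtains p where "projection p" "range (app p) = S" "\<And>x. x \<in> S \<Longrightarrow> app p x = x"
proof -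
  have sub: "subspace S" and cl: "closed S" and sc: "\<And>c x. x \<in> S \<Longrightarrow> c *\<^sub>C x \<in> S"
    using S by (auto simp: closed_csubspace_def)
  obtain P where PS: "\<And>x. P x \<in> S" and P: "\<And>x z. z \<in> S \<Longrightarrow> inner (x - P x) z = 0"
    using orthogonal_decomposition[OF sub cl] by metis
  \<comment> \<open>\<open>P\<close> is chosen pointwise; its additivity and homogeneity are
    instances of this uniqueness.\<close>
  have uniq: "P x = y" if "y \<in> S" "\<And>z. z \<in> S \<Longrightarrow> inner (x - y) z = 0" for x y
  proof -
    have "P x - y \<in> S" using that PS sub by (simp add: subspace_diff)
    from that(2)[OF this] P[OF this, of x] have "inner (P x - y) (P x - y) = 0"
      by (simp add: inner_simps)
    then show ?thesis by simp
  qed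
  have add: "P (x + y) = P x + P y" for x y
    using P[of _ x] P[of _ y] PS sub
    by (intro uniq) (auto simp: subspace_add inner_simps)
  have scR: "P (r *\<^sub>R x) = r *\<^sub>R P x" for x r
    using P[of _ x] PS sub
    by (intro uniq) (auto simp: subspace_scale inner_simps simp flip: scaleR_diff_right)
  have scC: "P (c *\<^sub>C x) = c *\<^sub>C P x" for x c
    using P[of "cnj c *\<^sub>C _" x] PS sc
    by (intro uniq) (auto simp: inner_scaleC_left simp flip: scaleC_diff)
  have "norm (P x) \<le> norm x" for x
  proof -
    have "(norm x)\<^sup>2 = (norm (x - P x))\<^sup>2 + (norm (P x))\<^sup>2"
      using P[OF PS[of x], of x] by (simp add: power2_norm_eq_inner inner_simps inner_commute)
    then have "(norm (P x))\<^sup>2 \<le> (norm x)\<^sup>2" by simp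
    then show ?thesis by (simp add: power2_le_iff_abs_le)
  qed
  then have "bounded_clinear P" unfolding bounded_clinear_def
    by (auto intro!: bounded_linear_intro[where K = 1] simp: add scR scC)
  then obtain p where p: "app p = P" by (rule bop_obtain)
  have id: "P x = x" if "x \<in> S" for x by (rule uniq) (use that in auto)
  have "adj p = p"
  proof (rule adj_eqI)
    fix x y show "inner (app p x) y = inner x (app p y)"
      using P[OF PS[of x], of y] P[OF PS[of y], of x] by (simp add: p inner_simps inner_commute)
  qed
  moreover have "p * p = p" by (rule bop_eqI) (simp add: p id PS)
  ultimately have "projection p" by (simp add: projection_def)
  moreover have "range (app p) = S" unfolding p using PS id by (metis image_iff subsetI subset_antisym UNIV_I)
  ultimately show ?thesis using that id p by auto
qed

text \<open>Invariance gives \<open>p * T * p = T * p\<close> and the same for \<open>adj T\<close>;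
  the adjoint of the second identity is \<open>p * T * p = p * T\<close>.\<close>

lemma projection_commute:
  assumes p: "projection p" "range (app p) = S" "\<And>x. x \<in> S \<Longrightarrow> app p x = x"
    and T: "\<And>x. x \<in> S \<Longrightarrow> app T x \<in> S" "\<And>x. x \<in> S \<Longrightarrow> app (adj T) x \<in> S"
  shows "p * T = T * p"
proof -
  have mem: "app p x \<in> S" for x using p(2) by blast
  have "p * T * p = T * p" "p * adj T * p = adj T * p"
    by (rule bop_eqI, simp add: p(3) T mem)+
  from this(1) arg_cong[OF this(2), of adj] p(1) show ?thesis
    by (simp add: projection_def mult.assoc)
qed

text \<open>The set \<open>G\<close> is the graph of a densely defined bounded operator.\<close>

lemma bounded_extension:
  fixes G :: "('h::chilbert_space \<times> 'k::chilbert_space) set"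
  assumes add: "\<And>a b a' b'. (a, b) \<in> G \<Longrightarrow> (a', b') \<in> G \<Longrightarrow> (a + a', b + b') \<in> G"
    and scale: "\<And>a b c. (a, b) \<in> G \<Longrightarrow> (c *\<^sub>C a, c *\<^sub>C b) \<in> G"
    and bound: "\<And>a b. (a, b) \<in> G \<Longrightarrow> norm b \<le> C * norm a"
    and dense: "closure (fst ` G) = UNIV"
  shows "\<exists>f. bounded_clinear f \<and> (\<forall>a b. (a, b) \<in> G \<longrightarrow> f a = b) \<and> (\<forall>x. norm (f x) \<le> C * norm x)"
proof -
  have lims: "\<exists>b. \<exists>p. (\<forall>n. p n \<in> G) \<and> (\<lambda>n. fst (p n)) \<longlonglongrightarrow> a \<and> (\<lambda>n. snd (p n)) \<longlonglongrightarrow> b" for a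
  proof -
    have "a \<in> closure (fst ` G)" using dense by simp
    then obtain q where q: "\<And>n. q n \<in> fst ` G" "q \<longlonglongrightarrow> a"
      by (auto simp: closure_sequential)
    then have "\<forall>n. \<exists>p. p \<in> G \<and> fst p = q n" by (metis imageE)
    then obtain p where p: "\<And>n. p n \<in> G" "\<And>n. fst (p n) = q n" by metis
    have "Cauchy (\<lambda>n. snd (p n))"
    proof (rule metric_CauchyI)
      fix e :: real assume "e > 0"
      then obtain N where N: "\<And>m n. m \<ge> N \<Longrightarrow> n \<ge> N \<Longrightarrow> dist (q m) (q n) < e / (\<bar>C\<bar> + 1)"
        using LIMSEQ_imp_Cauchy[OF q(2)] unfolding Cauchy_def
        by (metis abs_ge_zero divide_pos_pos add_nonneg_pos zero_less_one)
      have "dist (snd (p m)) (snd (p n)) < e" if "m \<ge> N" "n \<ge> N" for m n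
      proof -
        have "(q k, snd (p k)) \<in> G" for k using p by (metis prod.collapse)
        with add[of "fst (p m)" "snd (p m)" "- fst (p n)" "- snd (p n)"]
          scale[of "fst (p n)" "snd (p n)" "-1"]
        have "(fst (p m) - fst (p n), snd (p m) - snd (p n)) \<in> G" using p by simp
        from bound[OF this] have "dist (snd (p m)) (snd (p n)) \<le> C * dist (q m) (q n)"
          by (simp add: dist_norm p)
        also have "\<dots> \<le> (\<bar>C\<bar> + 1) * dist (q m) (q n)" by (intro mult_right_mono) auto
        also have "\<dots> < e" using N[OF that] by (simp add: field_simps add_nonneg_pos)
        finally show ?thesis .
      qed
      then show "\<exists>N. \<forall>m\<ge>N. \<forall>n\<ge>N. dist (snd (p m)) (snd (p n)) < e" by blast
    qed
    then obtain b where "(\<lambda>n. snd (p n)) \<longlonglongrightarrow> b" by (auto simp: Cauchy_convergent_iff convergent_def)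
    then show ?thesis using p q(2) by (intro exI[of _ b] exI[of _ p]) simp
  qed
  define R where "R = (\<lambda>a b. \<exists>p. (\<forall>n. p n \<in> G) \<and> (\<lambda>n. fst (p n)) \<longlonglongrightarrow> a \<and> (\<lambda>n. snd (p n)) \<longlonglongrightarrow> b)"
  have Rbound: "norm b \<le> C * norm a" if ab: "R a b" for a b
  proof -
    obtain p where p: "\<And>n. p n \<in> G" "(\<lambda>n. fst (p n)) \<longlonglongrightarrow> a" "(\<lambda>n. snd (p n)) \<longlonglongrightarrow> b"
      using ab unfolding R_def by meson
    show ?thesis
      by (rule LIMSEQ_le[OF tendsto_norm[OF p(3)] tendsto_mult_left[OF tendsto_norm[OF p(2)]]])
        (use p(1) bound in \<open>auto intro!: exI[of _ 0] simp: prod.collapse\<close>)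
  qed
  have Radd: "R (a + a') (b + b')" if ab: "R a b" "R a' b'" for a b a' b'
  proof -
    obtain p where p: "\<And>n. p n \<in> G" "(\<lambda>n. fst (p n)) \<longlonglongrightarrow> a" "(\<lambda>n. snd (p n)) \<longlonglongrightarrow> b"
      using ab(1) unfolding R_def by meson
    obtain p' where "\<And>n. p' n \<in> G" "(\<lambda>n. fst (p' n)) \<longlonglongrightarrow> a'" "(\<lambda>n. snd (p' n)) \<longlonglongrightarrow> b'"
      using ab(2) unfolding R_def by meson
    with p show ?thesis unfolding R_def
      by (intro exI[of _ "\<lambda>n. (fst (p n) + fst (p' n), snd (p n) + snd (p' n))"])
        (auto intro!: tendsto_intros add)
  qed
  have Rscale: "R (c *\<^sub>C a) (c *\<^sub>C b)" if ab: "R a b" for a b c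
  proof -
    obtain p where "\<And>n. p n \<in> G" "(\<lambda>n. fst (p n)) \<longlonglongrightarrow> a" "(\<lambda>n. snd (p n)) \<longlonglongrightarrow> b"
      using ab unfolding R_def by meson
    then show ?thesis unfolding R_def
      by (intro exI[of _ "\<lambda>n. (c *\<^sub>C fst (p n), c *\<^sub>C snd (p n))"])
        (auto intro!: scale bounded_linear.tendsto[OF bounded_linear_scaleC])
  qed
  have Runiq: "b = b'" if "R a b" "R a b'" for a b b'
    using Rbound[OF Radd[OF that(1) Rscale[OF that(2), of "-1"]]] by simp
  obtain f where f: "\<And>a. R a (f a)" using lims unfolding R_def by metis
  have RG: "R a b" if "(a, b) \<in> G" for a b
    unfolding R_def using that by (auto intro!: exI[of _ "\<lambda>_. (a, b)"])
  have fadd: "f (x + y) = f x + f y" for x y using Runiq Radd f by blast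
  have fscale: "f (c *\<^sub>C x) = c *\<^sub>C f x" for c x using Runiq Rscale f by blast
  have "bounded_clinear f" unfolding bounded_clinear_def
  proof (intro conjI allI fscale bounded_linear_intro[where K = C] fadd)
    fix x r
    show "f (r *\<^sub>R x) = r *\<^sub>R f x" using fscale[of "complex_of_real r" x] by (simp only: scaleC_of_real)
    show "norm (f x) \<le> norm x * C" using Rbound[OF f, of x] by (simp add: mult.commute)
  qed
  then show ?thesis using RG f Runiq Rbound by blast
qed

section \<open>Quasi-equivalent families of operators\<close>

text \<open>Doubling repeatedly yields \<open>(s 1 / N) ^ (2 ^ k) \<le> s (2 ^ k) / N \<le> (K / N)
  * c ^ (2 ^ k)\<close>, and taking roots of order \<open>2 ^ k\<close> makes the uncontrolled
  constant \<open>K\<close> disappear.\<close>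

lemma dyadic_power_bound:
  fixes s :: "nat \<Rightarrow> real"
  assumes s: "\<And>m. 0 \<le> s m" and N: "0 \<le> N" and c: "0 < c"
    and double: "\<And>m. (s m)\<^sup>2 \<le> s (2 * m) * N" and bound: "\<And>m. s m \<le> K * c ^ m"
  shows "s 1 \<le> c * N"
proof (cases "N = 0")
  case True
  then show ?thesis using double[of 1] by simp
next
  case False
  then have N: "N > 0" using N by simp
  have it: "(s 1 / N) ^ (2 ^ k) \<le> s (2 ^ k) / N" for k
  proof (induction k)
    case (Suc k)
    have "(s 1 / N) ^ (2 ^ Suc k) = ((s 1 / N) ^ (2 ^ k))\<^sup>2"
      by (simp add: power_mult[symmetric] mult.commute)
    also have "\<dots> \<le> (s (2 ^ k) / N)\<^sup>2"
      using Suc s N by (intro power_mono) auto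
    also have "\<dots> \<le> s (2 ^ Suc k) / N"
      using double[of "2 ^ k"] N by (simp add: power_divide divide_simps power2_eq_square mult_ac)
    finally show ?case .
  qed simp
  show ?thesis
  proof (rule ccontr)
    assume "\<not> s 1 \<le> c * N"
    then have r: "1 < s 1 / N / c" using N c by (simp add: field_simps)
    obtain n where n: "K / N < (s 1 / N / c) ^ n" using real_arch_pow[OF r] by blast
    have "(s 1 / N / c) ^ n \<le> (s 1 / N / c) ^ (2 ^ n)"
      using r by (intro power_increasing) (auto intro: less_imp_le less_exp)
    also have "\<dots> = (s 1 / N) ^ (2 ^ n) / c ^ (2 ^ n)" by (rule power_divide)
    also have "\<dots> \<le> (s (2 ^ n) / N) / c ^ (2 ^ n)"
      using it c by (intro divide_right_mono) auto
    also have "\<dots> \<le> (K * c ^ (2 ^ n) / N) / c ^ (2 ^ n)"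
      using bound N c by (intro divide_right_mono) auto
    also have "\<dots> = K / N" using c by simp
    finally show False using n by simp
  qed
qed

lemma closed_csubspace_eq: "closed_csubspace {x. app S x = app T x}"
proof -
  have "closed_csubspace {0}" by (simp add: closed_csubspace_def subspace_def)
  from closed_csubspace_vimage[OF bounded_clinear_app[of "S - T"] this]
  show ?thesis by (simp add: vimage_def)
qed

lemma bop_eq_on_dense:
  assumes "cspan_closure X = UNIV" "\<And>x. x \<in> X \<Longrightarrow> app S x = app T x"
  shows "S = T"
  using cspan_closure_minimal[of X "{x. app S x = app T x}"] closed_csubspace_eq assms
  by (intro bop_eqI) blast

text \<open>The norm bound comes from iterating the Cauchy-Schwarz inequality
  \<open>\<parallel>\<Sum>V\<^sub>i a h\<^sub>i\<parallel>\<^sup>2 \<le> \<parallel>\<Sum>V\<^sub>i a\<^sup>2 h\<^sub>i\<parallel> \<parallel>\<Sum>V\<^sub>i h\<^sub>i\<parallel>\<close> with \<open>a = x\<^sup>* x\<close>.\<close>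

lemma intertwining_extension:
  fixes VV :: "(('h::chilbert_space \<Rightarrow> 'k::chilbert_space) \<times> ('k \<Rightarrow> 'h)) set"
  assumes pairs: "\<And>V W. (V, W) \<in> VV \<Longrightarrow> adjoint_pair V W"
    and comm: "\<And>V W V' W' h. (V, W) \<in> VV \<Longrightarrow> (V', W') \<in> VV \<Longrightarrow>
      app x (W (V' h)) = W (V' (app x h))"
    and dense: "cspan_closure {V h | V W h. (V, W) \<in> VV} = UNIV"
  shows "\<exists>y. \<forall>V W h. (V, W) \<in> VV \<longrightarrow> app y (V h) = V (app x h)"
proof -
  \<comment> \<open>Lists are formal sums. A vector can be written in many ways as a sum of vectors
    \<open>V h\<close>, so the operator is first described on expressions; that it depends only on
    the vector comes out of the norm bound.\<close>
  define val where "val = (\<lambda>T (xs :: ((('h \<Rightarrow> 'k) \<times> ('k \<Rightarrow> 'h)) \<times> 'h) list). \<Sum>(p, h)\<leftarrow>xs. fst p (app T h))"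
  define good where "good = (\<lambda>xs :: ((('h \<Rightarrow> 'k) \<times> ('k \<Rightarrow> 'h)) \<times> 'h) list. fst ` set xs \<subseteq> VV)"
  have val_Nil: "val T [] = 0" and val_Cons: "val T ((p, h) # xs) = fst p (app T h) + val T xs"
    and val_append: "val T (xs @ ys) = val T xs + val T ys" for T p h xs ys
    by (auto simp: val_def)
  have comm_adj: "app (adj x) (W (V' h)) = W (V' (app (adj x) h))"
    if "(V, W) \<in> VV" "(V', W') \<in> VV" for V W V' W' h
  proof (rule eq_by_inner)
    fix k
    have ap: "inner (V u) v = inner u (W v)" "inner (V' u) v = inner u (W' v)" for u v
      using pairs that by (auto simp: adjoint_pair_def)
    have "inner (app (adj x) (W (V' h))) k = inner (V (app x k)) (V' h)"
      using ap(1)[of "app x k" "V' h"] by (simp add: inner_adj_left inner_commute[of _ "app x k"])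
    also have "\<dots> = inner (W' (V (app x k))) h" using ap(2) by (metis inner_commute)
    also have "\<dots> = inner (app x (W' (V k))) h" using comm[OF that(2,1)] by simp
    also have "\<dots> = inner (V k) (V' (app (adj x) h))"
      using ap(2) by (metis inner_adj_right inner_commute)
    also have "\<dots> = inner (W (V' (app (adj x) h))) k"
      using ap(1) by (metis inner_commute)
    finally show "inner (app (adj x) (W (V' h))) k = inner (W (V' (app (adj x) h))) k" .
  qed
  define ok where "ok = (\<lambda>T. \<forall>V W V' W' h. (V, W) \<in> VV \<longrightarrow> (V', W') \<in> VV \<longrightarrow>
      app T (W (V' h)) = W (V' (app T h)))"
  have ok_x: "ok x" "ok (adj x)" "ok 1" using comm comm_adj by (auto simp: ok_def)
  have ok_mult: "ok S \<Longrightarrow> ok T \<Longrightarrow> ok (S * T)" for S T by (simp add: ok_def)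
  \<comment> \<open>The inner product of \<open>V h\<close> and \<open>V' h'\<close> equals that of
    \<open>h\<close> and \<open>W (V' h')\<close>, and \<open>T\<close> passes through
    \<open>W V'\<close>; so \<open>T\<close> crosses from one side to the other as its
    adjoint.\<close>
  have move: "inner (val S xs) (val (T * T') ys) = inner (val (adj T * S) xs) (val T' ys)"
    if T: "ok T" and g: "good xs" "good ys" for S T T' xs ys
  proof -
    have one: "inner (fst p (app S h)) (fst p' (app (T * T') h')) =
        inner (fst p (app (adj T * S) h)) (fst p' (app T' h'))"
      if "p \<in> VV" "p' \<in> VV" for p p' h h'
    proof -
      obtain V W V' W' where p: "p = (V, W)" "p' = (V', W')" by fastforce
      have "app T (W (V' z)) = W (V' (app T z))" for z
        using T that unfolding p ok_def by blast
      then have "inner (V (app S h)) (V' (app (T * T') h')) = inner (app S h) (app T (W (V' (app T' h'))))"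
        using pairs that by (simp add: p adjoint_pair_def)
      also have "\<dots> = inner (V (app (adj T * S) h)) (V' (app T' h'))"
        using pairs that by (simp add: p adjoint_pair_def inner_adj_left)
      finally show ?thesis by (simp add: p)
    qed
    have "inner (fst p (app S h)) (val (T * T') ys) = inner (fst p (app (adj T * S) h)) (val T' ys)"
      if "p \<in> VV" for p h
      using g(2)
    proof (induction ys)
      case (Cons z ys)
      then show ?case using one[OF that, of "fst z" h "snd z"]
        by (cases z) (simp add: val_Cons good_def inner_add_right)
    qed (simp add: val_Nil)
    with g(1) show ?thesis
    proof (induction xs)
      case (Cons z xs)
      then show ?case by (cases z) (simp add: val_Cons good_def inner_add_left)
    qed (simp add: val_Nil)
  qed
  define a where "a = adj x * x"
  have aa: "adj (a ^ m) = a ^ m" for m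
    by (induction m) (simp_all add: a_def power_commutes mult.assoc)
  have ok_a: "ok (a ^ m)" for m
    by (induction m) (use ok_x ok_mult in \<open>auto simp: a_def\<close>)
  obtain c where c: "c > 0" "\<And>h. norm (app a h) \<le> c * norm h" using bop_bounded by blast
  have am: "norm (app (a ^ m) h) \<le> c ^ m * norm h" for m h
  proof (induction m)
    case (Suc m)
    have "norm (app (a ^ Suc m) h) \<le> c * (c ^ m * norm h)"
      using order_trans[OF c(2) mult_left_mono[OF Suc]] c(1) by simp
    then show ?case by (simp add: mult.assoc)
  qed simp
  have bound: "norm (val x xs) \<le> sqrt c * norm (val 1 xs)" if g: "good xs" for xs
  proof -
    \<comment> \<open>This \<open>K\<close> depends on the list and is useless as an operator bound.
      Only the growth rate \<open>c ^ m\<close> counts, because the doubling inequality removes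
      \<open>K\<close>.\<close>
    have "\<exists>K. \<forall>m. norm (val (a ^ m) xs) \<le> K * c ^ m" using g
    proof (induction xs)
      case (Cons z xs)
      then obtain K where K: "norm (val (a ^ m) xs) \<le> K * c ^ m" for m
        by (auto simp: good_def)
      obtain p h where z: "z = (p, h)" by fastforce
      have "bounded_linear (fst p)"
        using pairs[of "fst p" "snd p"] Cons.prems z by (simp add: good_def adjoint_pair_def bounded_clinear_def)
      then obtain D where D: "D > 0" "\<And>v. norm (fst p v) \<le> norm v * D"
        using bounded_linear.pos_bounded by blast
      have "norm (val (a ^ m) (z # xs)) \<le> (K + norm h * D) * c ^ m" for m
      proof -
        have "norm (fst p (app (a ^ m) h)) \<le> (c ^ m * norm h) * D"
          using D am by (meson mult_right_mono less_imp_le order_trans)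
        with K[of m] show ?thesis unfolding z val_Cons
          by (intro order_trans[OF norm_triangle_ineq]) (simp add: algebra_simps)
      qed
      then show ?case by blast
    qed (auto simp: val_Nil intro!: exI[of _ 0])
    then obtain K where K: "\<And>m. norm (val (a ^ m) xs) \<le> K * c ^ m" by blast
    have double: "(norm (val (a ^ m) xs))\<^sup>2 \<le> norm (val (a ^ (2 * m)) xs) * norm (val 1 xs)" for m
    proof -
      have "(norm (val (a ^ m) xs))\<^sup>2 = inner (val (a ^ (2 * m)) xs) (val 1 xs)"
        using move[OF ok_a[of m] g g, of "a ^ m" 1]
        by (simp add: aa power2_norm_eq_inner mult_2 flip: power_add)
      then show ?thesis by (simp add: norm_cauchy_schwarz)
    qed
    have "norm (val (a ^ 1) xs) \<le> c * norm (val 1 xs)"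
      by (rule dyadic_power_bound[where s = "\<lambda>m. norm (val (a ^ m) xs)", OF _ _ c(1) double K]) auto
    moreover have "(norm (val x xs))\<^sup>2 \<le> norm (val a xs) * norm (val 1 xs)"
      using move[OF ok_x(1) g g, of x 1] by (simp add: power2_norm_eq_inner a_def norm_cauchy_schwarz)
    ultimately have "(norm (val x xs))\<^sup>2 \<le> (c * norm (val 1 xs)) * norm (val 1 xs)"
      by (simp, meson mult_right_mono norm_ge_zero order_trans)
    also have "\<dots> = (sqrt c * norm (val 1 xs))\<^sup>2"
      using c(1) by (simp add: power2_eq_square)
    finally show ?thesis using c(1) by (simp add: power2_le_iff_abs_le)
  qed
  define G where "G = {(val 1 xs, val x xs) | xs. good xs}"
  have scale: "\<exists>ys. good ys \<and> (\<forall>T. val T ys = d *\<^sub>C val T xs)" if "good xs" for d xs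
    using that
  proof (induction xs)
    case (Cons z xs)
    then obtain ys where ys: "good ys" "\<And>T. val T ys = d *\<^sub>C val T xs" by (auto simp: good_def)
    obtain p h where z: "z = (p, h)" by fastforce
    have "bounded_clinear (fst p)"
      using pairs[of "fst p" "snd p"] Cons.prems z by (simp add: good_def adjoint_pair_def)
    then have "val T ((p, d *\<^sub>C h) # ys) = d *\<^sub>C val T (z # xs)" for T
      by (simp add: z val_Cons ys scaleC_add_right bounded_clinear_scaleC)
    moreover have "good ((p, d *\<^sub>C h) # ys)" using ys Cons.prems by (auto simp: good_def z)
    ultimately show ?case by blast
  qed (auto simp: val_Nil good_def intro!: exI[of _ "[]"])
  have "\<exists>f. bounded_clinear f \<and> (\<forall>u v. (u, v) \<in> G \<longrightarrow> f u = v) \<and> (\<forall>v. norm (f v) \<le> sqrt c * norm v)"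
  proof (rule bounded_extension)
    fix u v u' v' assume "(u, v) \<in> G" "(u', v') \<in> G"
    then obtain xs ys where "good xs" "good ys" "u = val 1 xs" "v = val x xs"
      "u' = val 1 ys" "v' = val x ys" by (auto simp: G_def)
    then have "good (xs @ ys)" "(u + u', v + v') = (val 1 (xs @ ys), val x (xs @ ys))"
      by (auto simp: good_def image_Un val_append)
    then show "(u + u', v + v') \<in> G" unfolding G_def by blast
  next
    fix u v d assume "(u, v) \<in> G"
    then show "(d *\<^sub>C u, d *\<^sub>C v) \<in> G" unfolding G_def using scale[of _ d]
      by (auto, metis)
  next
    fix u v assume "(u, v) \<in> G"
    then show "norm v \<le> sqrt c * norm u" using bound by (auto simp: G_def)
  next
    have mem: "val 1 xs \<in> fst ` G" if "good xs" for xs using that by (force simp: G_def)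
    have "subspace (fst ` G)"
    proof (rule subspaceI)
      show "0 \<in> fst ` G" using mem[of "[]"] by (simp add: good_def val_Nil)
      show "u + v \<in> fst ` G" if uv: "u \<in> fst ` G" "v \<in> fst ` G" for u v
      proof -
        obtain xs ys where "good xs" "good ys" "u = val 1 xs" "v = val 1 ys"
          using uv by (auto simp: G_def)
        then show ?thesis using mem[of "xs @ ys"] by (simp add: good_def image_Un val_append)
      qed
      show "r *\<^sub>R u \<in> fst ` G" if uv: "u \<in> fst ` G" for r u
      proof -
        obtain xs where "good xs" "u = val 1 xs" using uv by (auto simp: G_def)
        then show ?thesis using mem scale[of xs "complex_of_real r"] by (metis scaleC_of_real)
      qed
    qed
    moreover have "{d *\<^sub>C v | d v. v \<in> {V h | V W h. (V, W) \<in> VV}} \<subseteq> fst ` G"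
    proof clarify
      fix d V W h assume VW: "(V, W) \<in> VV"
      then have "good [((V, W), d *\<^sub>C h)]" by (simp add: good_def)
      from mem[OF this] show "d *\<^sub>C V h \<in> fst ` G"
        using pairs[OF VW] by (simp add: val_Nil val_Cons adjoint_pair_def bounded_clinear_scaleC)
    qed
    ultimately have "span {d *\<^sub>C v | d v. v \<in> {V h | V W h. (V, W) \<in> VV}} \<subseteq> fst ` G"
      by (intro span_minimal)
    then show "closure (fst ` G) = UNIV"
      using dense closure_mono unfolding cspan_closure_def by blast
  qed
  then obtain f where f: "bounded_clinear f" "\<And>u v. (u, v) \<in> G \<Longrightarrow> f u = v" by blast
  then obtain y where y: "app y = f" using bop_obtain by blast
  have "app y (V h) = V (app x h)" if "(V, W) \<in> VV" for V W h
  proof -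
    have "(val 1 [((V, W), h)], val x [((V, W), h)]) \<in> G"
      unfolding G_def using that by (auto simp: good_def)
    from f(2)[OF this] show ?thesis by (simp add: y val_Nil val_Cons)
  qed
  then show ?thesis by blast
qed

text \<open>The adjoint is recorded with each intertwiner and the adjoint operators are intertwined
  too, so exchanging the components of a pair exchanges the two families.\<close>

definition intertwining_pairs ::
    "'i set \<Rightarrow> ('i \<Rightarrow> 'h::chilbert_space bop) \<Rightarrow> ('i \<Rightarrow> 'k::chilbert_space bop) \<Rightarrow>
      (('h \<Rightarrow> 'k) \<times> ('k \<Rightarrow> 'h)) set" where
  "intertwining_pairs J a b = {(V, W). adjoint_pair V W \<and>
     (\<forall>i\<in>J. \<forall>h. V (app (a i) h) = app (b i) (V h) \<and> V (app (adj (a i)) h) = app (adj (b i)) (V h))}"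

definition separating :: "(('h::chilbert_space \<Rightarrow> 'k::chilbert_space) \<times> ('k \<Rightarrow> 'h)) set \<Rightarrow> bool" where
  "separating VV \<longleftrightarrow> (\<forall>h. (\<forall>V W. (V, W) \<in> VV \<longrightarrow> V h = 0) \<longrightarrow> h = 0)"

lemma adjoint_intertwines:
  assumes "adjoint_pair V W" "\<And>h. V (app S h) = app T (V h)"
  shows "W (app (adj T) k) = app (adj S) (W k)"
  by (rule eq_by_inner, use assms in \<open>simp add: adjoint_pair_def\<close>)
    (metis assms(2) inner_adj_left inner_commute)

lemma intertwining_pairs_swap:
  assumes "(V, W) \<in> intertwining_pairs J a b"
  shows "(W, V) \<in> intertwining_pairs J b a"
proof -
  have VW: "adjoint_pair V W"
    and i: "\<And>i h. i \<in> J \<Longrightarrow> V (app (a i) h) = app (b i) (V h)"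
      "\<And>i h. i \<in> J \<Longrightarrow> V (app (adj (a i)) h) = app (adj (b i)) (V h)"
    using assms by (auto simp: intertwining_pairs_def)
  have "W (app (b i) k) = app (a i) (W k)" if "i \<in> J" for i k
    using adjoint_intertwines[OF VW i(2)[OF that]] by simp
  moreover have "W (app (adj (b i)) k) = app (adj (a i)) (W k)" if "i \<in> J" for i k
    using adjoint_intertwines[OF VW i(1)[OF that]] by simp
  ultimately show ?thesis
    using VW by (simp add: intertwining_pairs_def adjoint_pair_commute[THEN iffD1])
qed

text \<open>\<open>W V'\<close> commutes with the generators and their adjoints, hence lies in the
  commutant of the algebra they generate.\<close>

lemma intertwining_pairs_commute:
  assumes "(V, W) \<in> intertwining_pairs J a b" "(V', W') \<in> intertwining_pairs J a b"
    and x: "x \<in> vN_generated (a ` J)"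
  shows "app x (W (V' h)) = W (V' (app x h))"
proof -
  note sw = intertwining_pairs_swap[OF assms(1)]
  have "bounded_clinear (\<lambda>h. W (V' h))"
    by (rule bounded_clinear_compose)
      (use assms in \<open>auto simp: intertwining_pairs_def adjoint_pair_def\<close>)
  then obtain c where c: "app c = (\<lambda>h. W (V' h))" by (rule bop_obtain)
  have "c \<in> commutant (a ` J \<union> adj ` a ` J)"
    using sw assms(2) by (intro commutantI bop_eqI) (auto simp: c intertwining_pairs_def)
  then have "x * c = c * x" using x by (simp add: vN_generated_def commutantD)
  from arg_cong[OF this, of "\<lambda>T. app T h"] show ?thesis by (simp add: c)
qed

text \<open>A vector orthogonal to all ranges is killed by all the adjoints, which are the
  intertwiners in the opposite direction.\<close>

lemma intertwining_pairs_dense: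
  assumes sep: "separating (intertwining_pairs J b a)"
  shows "cspan_closure {V h | V W h. (V, W) \<in> intertwining_pairs J a b} = UNIV"
proof (rule cspan_closure_UNIV)
  fix y assume y: "\<And>x c. x \<in> {V h | V W h. (V, W) \<in> intertwining_pairs J a b} \<Longrightarrow> inner (c *\<^sub>C x) y = 0"
  have "W y = 0" if "(W, V) \<in> intertwining_pairs J b a" for V W
  proof -
    have VW: "(V, W) \<in> intertwining_pairs J a b" using that by (rule intertwining_pairs_swap)
    then have "inner (1 *\<^sub>C V (W y)) y = 0" by (intro y) blast
    then show "W y = 0" using VW by (simp add: intertwining_pairs_def adjoint_pair_def)
  qed
  then show "y = 0" using sep unfolding separating_def by blast
qed

lemma intertwining_transfer:
  assumes sep: "separating (intertwining_pairs J b a)"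
    and x: "x \<in> vN_generated (a ` J)"
  shows "\<exists>y\<in>vN_generated (b ` J). \<forall>V W h. (V, W) \<in> intertwining_pairs J a b \<longrightarrow> app y (V h) = V (app x h)"
proof -
  note dense = intertwining_pairs_dense[OF sep]
  have "\<exists>y. \<forall>V W h. (V, W) \<in> intertwining_pairs J a b \<longrightarrow> app y (V h) = V (app x h)"
    by (rule intertwining_extension[where VV = "intertwining_pairs J a b", OF _ _ dense])
      (auto simp: intertwining_pairs_def intertwining_pairs_commute[OF _ _ x])
  then obtain y where y: "\<And>V W h. (V, W) \<in> intertwining_pairs J a b \<Longrightarrow> app y (V h) = V (app x h)"
    by blast
  \<comment> \<open>For \<open>c\<close> in the commutant, \<open>c V\<close> is again an
    intertwiner; the defining relation of \<open>y\<close> for \<open>V\<close> and for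
    \<open>c V\<close> gives commutation on the dense set of vectors \<open>V h\<close>.\<close>
  have "y * c = c * y" if c: "c \<in> commutant (b ` J \<union> adj ` b ` J)" for c
  proof (rule bop_eq_on_dense[OF dense])
    fix k assume "k \<in> {V h | V W h. (V, W) \<in> intertwining_pairs J a b}"
    then obtain V W h where VW: "(V, W) \<in> intertwining_pairs J a b" and k: "k = V h" by blast
    have "bounded_clinear V" "bounded_clinear W"
      using VW by (auto simp: intertwining_pairs_def adjoint_pair_def)
    then have "bounded_clinear (\<lambda>h. app c (V h))" "bounded_clinear (\<lambda>k. W (app (adj c) k))"
      by (simp_all add: bounded_clinear_compose[OF bounded_clinear_app]
          bounded_clinear_compose[OF _ bounded_clinear_app])
    moreover have "inner (app c (V h)) k = inner h (W (app (adj c) k))" for h k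
      using VW by (simp add: intertwining_pairs_def adjoint_pair_def flip: inner_adj_right)
    moreover have cb: "app c (app z v) = app z (app c v)" if "z \<in> b ` J \<union> adj ` b ` J" for z v
      using arg_cong[OF commutantD[OF c that], of "\<lambda>T. app T v"] by simp
    ultimately have cV: "(\<lambda>h. app c (V h), \<lambda>k. W (app (adj c) k)) \<in> intertwining_pairs J a b"
      using VW by (auto simp: intertwining_pairs_def adjoint_pair_def intro!: cb)
    show "app (y * c) k = app (c * y) k" using y[OF cV] y[OF VW] by (simp add: k)
  qed
  then have "y \<in> vN_generated (b ` J)" by (auto simp: vN_generated_def intro!: commutantI)
  then show ?thesis using y by blast
qed

text \<open>Separation in the target makes the ranges of intertwiners dense there, so
  \<open>\<Theta> x\<close> is determined by \<open>\<Theta>(x) V = V x\<close>. Separation in the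
  source gives injectivity and produces preimages. Normality is automatic for a star isomorphism of
  von Neumann algebras.\<close>

theorem quasi_equivalence:
  fixes a :: "'i \<Rightarrow> 'h::chilbert_space bop" and b :: "'i \<Rightarrow> 'k::chilbert_space bop"
  assumes sep: "separating (intertwining_pairs J a b)" "separating (intertwining_pairs J b a)"
  shows "\<exists>\<Theta>. star_iso (vN_generated (a ` J)) (vN_generated (b ` J)) \<Theta> \<and> (\<forall>i\<in>J. \<Theta> (a i) = b i)"
proof -
  let ?A = "vN_generated (a ` J)" and ?B = "vN_generated (b ` J)" and ?I = "intertwining_pairs J a b"
  note dense = intertwining_pairs_dense[OF sep(2)]
  have uniq: "y = y'" if "\<And>V W h. (V, W) \<in> ?I \<Longrightarrow> app y (V h) = app y' (V h)" for y y'
    by (rule bop_eq_on_dense[OF dense]) (use that in auto)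
  obtain \<Theta> where \<Theta>B: "\<And>x. x \<in> ?A \<Longrightarrow> \<Theta> x \<in> ?B"
    and \<Theta>: "\<And>x V W h. x \<in> ?A \<Longrightarrow> (V, W) \<in> ?I \<Longrightarrow> app (\<Theta> x) (V h) = V (app x h)"
    using intertwining_transfer[where a = a and b = b, OF sep(2)] by metis
  have ex': "\<exists>x\<in>?A. \<forall>V W k. (V, W) \<in> ?I \<longrightarrow> app x (W k) = W (app y k)" if "y \<in> ?B" for y
    using intertwining_transfer[where a = b and b = a, OF sep(1) that] intertwining_pairs_swap by blast
  note A = vN_algebra_vN_generated[of "a ` J"]
  have I: "\<And>V W. (V, W) \<in> ?I \<Longrightarrow> adjoint_pair V W" by (simp add: intertwining_pairs_def)
  have clin: "bounded_clinear V" if "(V, W) \<in> ?I" for V W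
    using I[OF that] by (simp add: adjoint_pair_def)
  have mult: "\<Theta> (x * y) = \<Theta> x * \<Theta> y" and add: "\<Theta> (x + y) = \<Theta> x + \<Theta> y"
    if "x \<in> ?A" "y \<in> ?A" for x y
    by (rule uniq, simp add: \<Theta> that vN_mult[OF A] vN_add[OF A] bounded_clinear_add[OF clin])+
  have scale: "\<Theta> (c *\<^sub>C x) = c *\<^sub>C \<Theta> x" if "x \<in> ?A" for c x
    by (rule uniq, simp add: \<Theta> that vN_scaleC[OF A] bounded_clinear_scaleC[OF clin])
  have one: "\<Theta> 1 = 1" by (rule uniq, simp add: \<Theta> vN_one[OF A])
  \<comment> \<open>On the range of \<open>V\<close> the operator \<open>adj (\<Theta> x)\<close> is
    known only through inner products, so it is tested against all vectors \<open>V' h'\<close>,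
    where \<open>W V'\<close> commutes with \<open>x\<close>.\<close>
  have \<Theta>_adj: "\<Theta> (adj x) = adj (\<Theta> x)" if x: "x \<in> ?A" for x
  proof (rule uniq)
    fix V W h assume VW: "(V, W) \<in> ?I"
    let ?d = "app (\<Theta> (adj x)) (V h) - app (adj (\<Theta> x)) (V h)"
    have "inner (c *\<^sub>C v) ?d = 0" if v: "v \<in> {V h | V W h. (V, W) \<in> ?I}" for c v
    proof -
      obtain V' W' h' where VW': "(V', W') \<in> ?I" and v: "v = V' h'" using v by blast
      let ?h = "c *\<^sub>C h'"
      have "inner (app (\<Theta> (adj x)) (V h)) (V' ?h) = inner (V (app (adj x) h)) (V' ?h)"
        using \<Theta>[OF vN_adj[OF A x] VW] by simp
      also have "\<dots> = inner h (app x (W (V' ?h)))"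
        using I[OF VW] by (simp add: adjoint_pair_def inner_adj_left)
      also have "\<dots> = inner h (W (V' (app x ?h)))"
        by (simp only: intertwining_pairs_commute[OF VW VW' x])
      also have "\<dots> = inner (app (adj (\<Theta> x)) (V h)) (V' ?h)"
        using I[OF VW] \<Theta>[OF x VW', of ?h] by (simp add: adjoint_pair_def inner_adj_left)
      finally show ?thesis
        by (simp add: v inner_diff_right inner_commute flip: bounded_clinear_scaleC[OF clin[OF VW']])
    qed
    from orthogonal_cspan_closure[where X = "{V h | V W h. (V, W) \<in> ?I}" and z = ?d, OF this] have "inner ?d ?d = 0" unfolding dense by simp
    then have "?d = 0" by simp
    then show "app (\<Theta> (adj x)) (V h) = app (adj (\<Theta> x)) (V h)" by simp
  qed
  have adjW: "app x (W k) = W (app (\<Theta> x) k)" if x: "x \<in> ?A" and VW: "(V, W) \<in> ?I" for x V W k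
    using adjoint_intertwines[OF I[OF VW], of "adj x" "adj (\<Theta> x)" k] \<Theta>[OF vN_adj[OF A x] VW] \<Theta>_adj[OF x]
    by simp
  have inj: "inj_on \<Theta> ?A"
  proof (rule inj_onI)
    fix x y assume xy: "x \<in> ?A" "y \<in> ?A" "\<Theta> x = \<Theta> y"
    show "x = y"
    proof (rule bop_eqI)
      fix h
      have "V (app x h - app y h) = 0" if VW: "(V, W) \<in> ?I" for V W
          using \<Theta>[OF xy(1) VW] \<Theta>[OF xy(2) VW] xy(3) by (simp add: bounded_clinear_diff[OF clin[OF VW]] flip: \<Theta>)
      then have "app x h - app y h = 0" using sep(1) unfolding separating_def by blast
      then show "app x h = app y h" by simp
    qed
  qed
  have surj: "\<exists>x\<in>?A. \<Theta> x = y" if y: "y \<in> ?B" for y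
  proof -
    obtain x where x: "x \<in> ?A" and xW: "\<And>V W k. (V, W) \<in> ?I \<Longrightarrow> app x (W k) = W (app y k)"
      using ex'[OF y] by blast
    have "\<Theta> x = y"
    proof (rule bop_eqI)
      fix k
      have "W (app (\<Theta> x) k - app y k) = 0" if WV: "(W, V) \<in> intertwining_pairs J b a" for V W
      proof -
        note VW = intertwining_pairs_swap[OF WV]
        then have "bounded_clinear W" using I by (simp add: adjoint_pair_def)
        then show "W (app (\<Theta> x) k - app y k) = 0"
          using xW[OF VW] adjW[OF x VW] by (simp add: bounded_clinear_diff)
      qed
      then have "app (\<Theta> x) k - app y k = 0" using sep(2) unfolding separating_def by blast
      then show "app (\<Theta> x) k = app y k" by simp
    qed
    then show ?thesis using x by blast
  qed
  have "bij_betw \<Theta> ?A ?B" using inj surj \<Theta>B by (auto simp: bij_betw_def)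
  moreover have "star_hom ?A ?B \<Theta>"
    using \<Theta>B mult add scale one \<Theta>_adj by (auto simp: star_hom_def)
  moreover have "\<Theta> (a i) = b i" if "i \<in> J" for i
  proof (rule uniq)
    fix V W h assume VW: "(V, W) \<in> ?I"
    have "a i \<in> ?A" by (rule subsetD[OF vN_generated_base imageI[OF that]])
    from \<Theta>[OF this VW] have "app (\<Theta> (a i)) (V h) = V (app (a i) h)" .
    also have "\<dots> = app (b i) (V h)" using VW that unfolding intertwining_pairs_def by blast
    finally show "app (\<Theta> (a i)) (V h) = app (b i) (V h)" .
  qed
  ultimately show ?thesis unfolding star_iso_def by blast
qed

section \<open>Operators on \<open>l\<^sup>2(G, H)\<close>\<close>

lemma l2_eqI: "(\<And>g. coord x g = coord y g) \<Longrightarrow> x = y"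
  by (metis coord_inject ext)

lemmas coord_simps [simp] = zero_l2.rep_eq plus_l2.rep_eq uminus_l2.rep_eq minus_l2.rep_eq
  scaleR_l2.rep_eq scaleC_l2.rep_eq

lemma bounded_clinear_coord: "bounded_clinear (\<lambda>x. coord x g)"
  unfolding bounded_clinear_def
  by (auto intro!: bounded_linear_intro[where K = 1] l2_coord_le)

lemma has_sum_inner_l2: "((\<lambda>g. inner (coord x g) (coord y g)) has_sum inner x y) UNIV"
  unfolding inner_l2_def
  by (rule has_sum_infsum, rule l2_inner_summable) (use coord in auto)

lemma coord_exists:
  fixes f :: "'g \<Rightarrow> 'h::chilbert_space"
  assumes "(\<lambda>g. (norm (f g))\<^sup>2) summable_on UNIV"
  obtains x where "coord x = f"
  using assms Abs_l2_inverse by blast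

lemma l2_of_bounded_sums:
  fixes f :: "'g \<Rightarrow> 'h::chilbert_space"
  assumes "\<And>F. finite F \<Longrightarrow> (\<Sum>g\<in>F. (norm (f g))\<^sup>2) \<le> C"
  obtains x where "coord x = f" "(norm x)\<^sup>2 \<le> C"
proof -
  have s: "(\<lambda>g. (norm (f g))\<^sup>2) summable_on UNIV"
    using assms by (intro nonneg_bdd_above_summable_on) (auto simp: bdd_above_def)
  then obtain x where x: "coord x = f" by (rule coord_exists)
  moreover have "(norm x)\<^sup>2 \<le> C"
    unfolding l2_norm_sq x using s assms by (intro infsum_le_finite_sums) auto
  ultimately show ?thesis using that by blast
qed

lemma l2_map_exists:
  fixes F :: "'g \<Rightarrow> 'h::chilbert_space \<Rightarrow> 'k::chilbert_space"
  assumes F: "\<And>g. bounded_clinear (F g)"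
    and bound: "\<And>x A. finite A \<Longrightarrow> (\<Sum>g\<in>A. (norm (F g x))\<^sup>2) \<le> (C * norm x)\<^sup>2"
  obtains W :: "'h \<Rightarrow> ('g, 'k) l2" where "bounded_clinear W" "\<And>x g. coord (W x) g = F g x"
proof -
  have "\<exists>w. coord w = (\<lambda>g. F g x) \<and> norm w \<le> \<bar>C\<bar> * norm x" for x
  proof -
    obtain w where w: "coord w = (\<lambda>g. F g x)" "(norm w)\<^sup>2 \<le> (C * norm x)\<^sup>2"
      using l2_of_bounded_sums[of "\<lambda>g. F g x", OF bound] by blast
    then have "norm w \<le> \<bar>C * norm x\<bar>" using abs_le_square_iff[of "norm w" "C * norm x"] by simp
    then show ?thesis using w by (auto simp: abs_mult)
  qed
  then obtain W where W: "\<And>x. coord (W x) = (\<lambda>g. F g x)" "\<And>x. norm (W x) \<le> \<bar>C\<bar> * norm x"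
    by metis
  have sR: "F g (r *\<^sub>R x) = r *\<^sub>R F g x" for g r x
    using bounded_clinear_scaleC[OF F, of g "complex_of_real r" x] by (simp only: scaleC_of_real)
  have "bounded_clinear W" unfolding bounded_clinear_def
    by (intro conjI allI bounded_linear_intro[where K = "\<bar>C\<bar>"] l2_eqI)
      (simp_all add: W bounded_clinear_add[OF F] bounded_clinear_scaleC[OF F] sR mult.commute)
  then show ?thesis using that W by metis
qed

text \<open>Operators on the sum space are defined by descriptions of their coordinates; one bounded
  map with the right coordinates makes such a description denote it.\<close>

lemma coord_op_unique:
  assumes "bounded_clinear F" 
  shows "app (THE T. \<forall>f g. coord (app T f) g = coord (F f) g) = F"
proof -
  obtain T where T: "app T = F" using assms by (rule bop_obtain)
  have "(THE T. \<forall>f g. coord (app T f) g = coord (F f) g) = T"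
    by (rule the_equality) (auto simp: T intro!: bop_eqI l2_eqI)
  then show ?thesis using T by simp
qed

lemma diag_exists:
  fixes d :: "'g \<Rightarrow> 'h::chilbert_space bop"
  assumes "\<And>g x. norm (app (d g) x) \<le> C * norm x"
  obtains D :: "('g, 'h) l2 \<Rightarrow> ('g, 'h) l2"
  where "bounded_clinear D" "\<And>f g. coord (D f) g = app (d g) (coord f g)"
proof (rule l2_map_exists[where F = "\<lambda>g (f :: ('g, 'h) l2). app (d g) (coord f g)" and C = C])
  show "bounded_clinear (\<lambda>f. app (d g) (coord f g))" for g
    by (rule bounded_clinear_compose[OF bounded_clinear_app bounded_clinear_coord])
  fix f :: "('g, 'h) l2" and A :: "'g set" assume "finite A"
  have "(\<Sum>g\<in>A. (norm (app (d g) (coord f g)))\<^sup>2) \<le> (\<Sum>g\<in>A. C\<^sup>2 * (norm (coord f g))\<^sup>2)"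
    using assms by (intro sum_mono) (metis norm_ge_zero power_mono power_mult_distrib)
  also have "\<dots> \<le> C\<^sup>2 * (norm f)\<^sup>2"
    unfolding sum_distrib_left[symmetric] by (intro mult_left_mono l2_sum_le \<open>finite A\<close>) simp
  finally show "(\<Sum>g\<in>A. (norm (app (d g) (coord f g)))\<^sup>2) \<le> (C * norm f)\<^sup>2"
    by (simp add: power_mult_distrib)
qed (rule that)

lemma coord_cp_embed:
  assumes "\<And>g x. norm (app (\<beta> g b) x) \<le> C * norm x"
  shows "coord (app (cp_embed \<beta> b) f) g = app (\<beta> (- g) b) (coord f g)"
proof -
  obtain D where D: "bounded_clinear D" "\<And>f g. coord (D f) g = app (\<beta> (- g) b) (coord f g)"
    using diag_exists[of "\<lambda>g. \<beta> (- g) b", OF assms] by blast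
  show ?thesis using coord_op_unique[OF D(1)] by (simp add: cp_embed_def D(2))
qed

lemma coord_adj_cp_embed:
  assumes b: "\<And>g x. norm (app (\<beta> g b) x) \<le> C * norm x"
    and ba: "\<And>g x. norm (app (adj (\<beta> g b)) x) \<le> C * norm x"
  shows "coord (app (adj (cp_embed \<beta> b)) f) g = app (adj (\<beta> (- g) b)) (coord f g)"
proof -
  obtain D where D: "bounded_clinear D" "\<And>f g. coord (D f) g = app (adj (\<beta> (- g) b)) (coord f g)"
    using diag_exists[of "\<lambda>g. adj (\<beta> (- g) b)", OF ba] by blast
  obtain T where T: "app T = D" using D(1) by (rule bop_obtain)
  have "adj (cp_embed \<beta> b) = T"
  proof (rule adj_eqI)
    fix f h show "inner (app T f) h = inner f (app (cp_embed \<beta> b) h)"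
      unfolding T inner_l2_def D(2) coord_cp_embed[where \<beta> = \<beta> and b = b, OF b] by (simp add: inner_adj_left)
  qed
  then show ?thesis using D T by simp
qed

lemma coord_cp_translation:
  fixes f :: "('g::group_add, 'b::chilbert_space) l2"
  shows "coord (app (cp_translation h) f) g = coord f (- h + g)"
proof -
  obtain D :: "('g, 'b) l2 \<Rightarrow> ('g, 'b) l2"
    where D: "bounded_clinear D" "\<And>f g. coord (D f) g = coord f (- h + g)"
  proof (rule l2_map_exists[where F = "\<lambda>g (f :: ('g, 'b) l2). coord f (- h + g)" and C = 1])
    show "bounded_clinear (\<lambda>f :: ('g, 'b) l2. coord f (- h + g))" for g
      by (rule bounded_clinear_coord)
    fix f :: "('g, 'b) l2" and A :: "'g set" assume A: "finite A"
    have inj: "inj_on (\<lambda>g. - h + g) A" by (auto simp: inj_on_def)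
    have "(\<Sum>g\<in>A. (norm (coord f (- h + g)))\<^sup>2) = (\<Sum>g\<in>(\<lambda>g. - h + g) ` A. (norm (coord f g))\<^sup>2)"
      by (simp add: sum.reindex[OF inj])
    also have "\<dots> \<le> (norm f)\<^sup>2" using A by (intro l2_sum_le) simp
    finally show "(\<Sum>g\<in>A. (norm (coord f (- h + g)))\<^sup>2) \<le> (1 * norm f)\<^sup>2" by simp
  qed (rule that)
  show ?thesis using coord_op_unique[OF D(1)] by (simp add: cp_translation_def D(2))
qed

lemma adj_cp_translation:
  "adj (cp_translation h) = (cp_translation (- h) :: ('g::group_add, 'b::chilbert_space) l2 bop)"
proof (rule adj_eqI)
  fix f k :: "('g, 'b) l2"
  have bij: "bij_betw (\<lambda>g. - h + g) UNIV (UNIV :: 'g set)"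
    by (rule bij_betwI[where g = "\<lambda>g. h + g"]) (auto simp: add.assoc[symmetric])
  have "inner f (app (cp_translation h) k) = (\<Sum>\<^sub>\<infinity>g. inner (coord f (h + (- h + g))) (coord k (- h + g)))"
    by (simp add: inner_l2_def coord_cp_translation add.assoc[symmetric])
  also have "\<dots> = (\<Sum>\<^sub>\<infinity>g. inner (coord f (h + g)) (coord k g))"
    by (rule infsum_reindex_bij_betw[OF bij])
  also have "\<dots> = inner (app (cp_translation (- h)) f) k"
    by (simp add: inner_l2_def coord_cp_translation)
  finally show "inner (app (cp_translation (- h)) f) k = inner f (app (cp_translation h) k)" ..
qed

section \<open>Vectors supported at one point, and amplifications\<close>

lift_definition single_l2 :: "'g \<Rightarrow> 'h::chilbert_space \<Rightarrow> ('g, 'h) l2"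
  is "\<lambda>n h m. if m = n then h else 0"
proof -
  fix n :: 'g and h :: 'h
  have "(\<lambda>m. (norm (if m = n then h else 0))\<^sup>2) summable_on {n}" by simp
  also have "?this \<longleftrightarrow> (\<lambda>m. (norm (if m = n then h else 0))\<^sup>2) summable_on UNIV"
    by (intro summable_on_cong_neutral) auto
  finally show "(\<lambda>m. (norm (if m = n then h else 0))\<^sup>2) summable_on UNIV" .
qed

lemma inner_single_l2: "inner (single_l2 n h) x = inner h (coord x n)"
proof -
  have "inner (single_l2 n h) x = (\<Sum>\<^sub>\<infinity>g\<in>{n}. inner (coord (single_l2 n h) g) (coord x g))"
    unfolding inner_l2_def by (intro infsum_cong_neutral) (auto simp: single_l2.rep_eq)
  then show ?thesis by (simp add: single_l2.rep_eq)
qed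

lemma bounded_clinear_single_l2:
  "bounded_clinear (single_l2 n :: 'h::chilbert_space \<Rightarrow> ('g, 'h) l2)"
proof -
  have "norm (single_l2 n h :: ('g, 'h) l2) = norm h" for h :: 'h
    by (simp add: norm_eq_sqrt_inner inner_single_l2 single_l2.rep_eq)
  then show ?thesis
    unfolding bounded_clinear_def
    by (intro conjI allI bounded_linear_intro[where K = 1] l2_eqI) (simp_all add: single_l2.rep_eq)
qed

lemma l2_zero_by_singles:
  assumes "\<And>n h. inner (single_l2 n h) x = 0"
  shows "x = 0"
proof (rule l2_eqI)
  fix n show "coord x n = coord 0 n"
    using assms[of n "coord x n"] by (simp add: inner_single_l2)
qed

text \<open>The operator \<open>T\<close> tensor 1 on the tensor product of the space with
  \<open>l2\<close>. With countable index set it turns every normal functional into a single vector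
  functional \<open><\<xi>, amplify T \<eta>>\<close>.\<close>

definition amplify :: "'h::chilbert_space bop \<Rightarrow> ('n, 'h) l2 bop" where
  "amplify T = (THE S. \<forall>f n. coord (app S f) n = app T (coord f n))"

lemma coord_amplify [simp]: "coord (app (amplify T) f) n = app T (coord f n)"
proof -
  obtain C where C: "\<And>x. norm (app T x) \<le> C * norm x" using bop_bounded by metis
  obtain D :: "('b, 'a) l2 \<Rightarrow> ('b, 'a) l2"
    where D: "bounded_clinear D" "\<And>f g. coord (D f) g = app T (coord f g)"
    using diag_exists[of "\<lambda>_. T", OF C] by metis
  show ?thesis using coord_op_unique[OF D(1)] by (simp add: amplify_def D(2))
qed

lemma amplify_mult: "amplify (S * T) = amplify S * amplify T"
  by (rule bop_eqI, rule l2_eqI) simp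

lemma amplify_add: "amplify (S + T) = amplify S + amplify T"
  by (rule bop_eqI, rule l2_eqI) simp

lemma amplify_diff: "amplify (S - T) = amplify S - amplify T"
  by (rule bop_eqI, rule l2_eqI) simp

lemma amplify_scaleC: "amplify (c *\<^sub>C T) = c *\<^sub>C amplify T"
  by (rule bop_eqI, rule l2_eqI) simp

lemma amplify_one: "amplify 1 = 1"
  by (rule bop_eqI, rule l2_eqI) simp

lemma amplify_zero: "amplify 0 = 0"
  by (rule bop_eqI, rule l2_eqI) simp

lemma amplify_adj: "amplify (adj T) = adj (amplify T)"
  by (rule adj_eqI[symmetric]) (simp add: inner_l2_def inner_adj_left)

lemma amplify_single_l2: "app (amplify T) (single_l2 n h) = single_l2 n (app T h)"
  by (rule l2_eqI) (simp add: single_l2.rep_eq)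

section \<open>Normal functionals\<close>

lemma sums_inner_l2: "(\<lambda>n::nat. inner (coord x n) (coord y n)) sums inner x y"
  by (rule has_sum_imp_sums[OF has_sum_inner_l2])

lemma sums_cinner_l2: "(\<lambda>n::nat. cinner (coord x n) (coord y n)) sums cinner x y"
  unfolding sums_complex_iff cinner_def
  using sums_inner_l2[of x y] sums_inner_l2[of "\<i> *\<^sub>C x" y] by simp

lemma normal_functional_amplify:
  fixes \<xi> \<eta> :: "(nat, 'h::chilbert_space) l2"
  shows "(\<lambda>T. cinner \<xi> (app (amplify T) \<eta>)) \<in> normal_functionals"
proof -
  have s: "summable (\<lambda>n. (norm (coord x n))\<^sup>2)" for x :: "(nat, 'h) l2"
    using coord[of x] by (simp add: summable_on_UNIV_nonneg_real_iff)
  have "cinner \<xi> (app (amplify T) \<eta>) = (\<Sum>n. cinner (coord \<xi> n) (app T (coord \<eta> n)))" for T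
    using sums_unique[OF sums_cinner_l2[of \<xi> "app (amplify T) \<eta>"]] by simp
  then show ?thesis unfolding normal_functionals_def using s by blast
qed

lemma normal_functionalE:
  assumes "\<omega> \<in> normal_functionals"
  obtains \<xi> \<eta> :: "(nat, 'h::chilbert_space) l2" where "\<omega> = (\<lambda>T. cinner \<xi> (app (amplify T) \<eta>))"
proof -
  obtain x y where \<omega>: "\<omega> = (\<lambda>T. \<Sum>n. cinner (x n) (app T (y n)))"
    and s: "summable (\<lambda>n. (norm (x n))\<^sup>2)" "summable (\<lambda>n. (norm (y n))\<^sup>2)"
    using assms unfolding normal_functionals_def by blast
  have s': "(\<lambda>n. (norm (x n))\<^sup>2) summable_on UNIV" "(\<lambda>n. (norm (y n))\<^sup>2) summable_on UNIV"
    using s by (simp_all add: summable_on_UNIV_nonneg_real_iff)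
  obtain \<xi> where c1: "coord \<xi> = x" using s'(1) by (rule coord_exists)
  obtain \<eta> where c2: "coord \<eta> = y" using s'(2) by (rule coord_exists)
  note c = c1 c2
  have "cinner \<xi> (app (amplify T) \<eta>) = \<omega> T" for T
    using sums_unique[OF sums_cinner_l2[of \<xi> "app (amplify T) \<eta>"]] by (simp add: \<omega> c)
  then show ?thesis using that by (metis ext)
qed

text \<open>Even and odd positions realise the direct sum of two copies of the amplified space
  inside one copy, so sums of vector functionals of amplified operators are again of this
  form.\<close>

lemma interleave_l2:
  fixes x y :: "(nat, 'h::chilbert_space) l2"
  obtains z where "coord z = (\<lambda>n. if even n then coord x (n div 2) else coord y ((n - 1) div 2))"
proof -
  have s: "(\<lambda>n. inner (coord v n) (coord v n)) sums inner v v" for v :: "(nat, 'h) l2"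
    by (rule sums_inner_l2)
  have "summable (\<lambda>n. (norm (if even n then coord x (n div 2) else coord y ((n - 1) div 2)))\<^sup>2)"
    using sums_if[OF s[of y] s[of x], THEN sums_summable]
    by (simp add: power2_norm_eq_inner if_distrib[of "\<lambda>u. inner u u"])
  then have "(\<lambda>n. (norm (if even n then coord x (n div 2) else coord y ((n - 1) div 2)))\<^sup>2) summable_on UNIV"
    by (subst summable_on_UNIV_nonneg_real_iff) auto
  then show ?thesis by (rule coord_exists) (rule that)
qed

lemma amplify_functional_add:
  fixes \<xi> \<eta> \<xi>' \<eta>' :: "(nat, 'h::chilbert_space) l2"
  obtains \<zeta> \<kappa> :: "(nat, 'h) l2" where
    "\<And>T. inner \<zeta> (app (amplify T) \<kappa>) = inner \<xi> (app (amplify T) \<eta>) + inner \<xi>' (app (amplify T) \<eta>')"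
proof -
  obtain \<zeta> where \<zeta>: "coord \<zeta> = (\<lambda>n. if even n then coord \<xi>' (n div 2) else coord \<xi> ((n - 1) div 2))"
    by (rule interleave_l2)
  obtain \<kappa> where \<kappa>: "coord \<kappa> = (\<lambda>n. if even n then coord \<eta>' (n div 2) else coord \<eta> ((n - 1) div 2))"
    by (rule interleave_l2)
  have "inner \<zeta> (app (amplify T) \<kappa>) = inner \<xi> (app (amplify T) \<eta>) + inner \<xi>' (app (amplify T) \<eta>')" for T
  proof -
    have "(\<lambda>n. inner (coord \<zeta> n) (coord (app (amplify T) \<kappa>) n)) =
      (\<lambda>n. if even n then inner (coord \<xi>' (n div 2)) (coord (app (amplify T) \<eta>') (n div 2))
        else inner (coord \<xi> ((n - 1) div 2)) (coord (app (amplify T) \<eta>) ((n - 1) div 2)))"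
      by (auto simp: \<zeta> \<kappa>)
    then show ?thesis
      using sums_unique2[OF sums_inner_l2[of \<zeta> "app (amplify T) \<kappa>"]]
        sums_if[OF sums_inner_l2[of \<xi> "app (amplify T) \<eta>"] sums_inner_l2[of \<xi>' "app (amplify T) \<eta>'"]]
      by metis
  qed
  then show ?thesis using that by blast
qed

lemma amplify_functional_sum:
  fixes \<xi> \<eta> :: "'i \<Rightarrow> (nat, 'h::chilbert_space) l2"
  assumes "finite F"
  shows "\<exists>\<zeta> \<kappa> :: (nat, 'h) l2. \<forall>T. inner \<zeta> (app (amplify T) \<kappa>) = (\<Sum>i\<in>F. c i * inner (\<xi> i) (app (amplify T) (\<eta> i)))"
  using assms
proof (induction F)
  case empty
  show ?case by (auto intro!: exI[of _ 0])
next
  case (insert i F)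
  then obtain \<zeta> \<kappa> :: "(nat, 'h) l2" where
    IH: "\<And>T. inner \<zeta> (app (amplify T) \<kappa>) = (\<Sum>i\<in>F. c i * inner (\<xi> i) (app (amplify T) (\<eta> i)))"
    by blast
  obtain \<zeta>' \<kappa>' :: "(nat, 'h) l2" where
    "\<And>T. inner \<zeta>' (app (amplify T) \<kappa>') = inner (c i *\<^sub>R \<xi> i) (app (amplify T) (\<eta> i)) + inner \<zeta> (app (amplify T) \<kappa>)"
    by (rule amplify_functional_add[where \<xi> = "c i *\<^sub>R \<xi> i" and \<eta> = "\<eta> i" and \<xi>' = \<zeta> and \<eta>' = \<kappa>]) auto
  then show ?case using insert IH by auto
qed

lemma vector_functional:
  "\<exists>\<xi> \<eta> :: (nat, 'h::chilbert_space) l2. \<forall>T. inner \<xi> (app (amplify T) \<eta>) = inner x (app T y)"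
  by (rule exI[of _ "single_l2 0 x"], rule exI[of _ "single_l2 0 y"])
    (simp add: inner_single_l2 single_l2.rep_eq)

text \<open>By Hahn-Banach this is the \<open>\<sigma>\<close>-weak closure of the real linear span of \<open>R\<close>; working with the
  annihilator instead of the closure makes Hahn-Banach unnecessary.\<close>

definition normal_hull :: "'h::chilbert_space bop set \<Rightarrow> 'h bop set" where
  "normal_hull R = {x. \<forall>\<xi> \<eta> :: (nat, 'h) l2.
     (\<forall>r\<in>R. inner \<xi> (app (amplify r) \<eta>) = 0) \<longrightarrow> inner \<xi> (app (amplify x) \<eta>) = 0}"

lemma normal_hull_superset: "R \<subseteq> normal_hull R"
  by (auto simp: normal_hull_def)

section \<open>Annihilators, the sigma-weak topology and its continuous functionals\<close>

lemma openin_sigma_weak: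
  "\<omega> \<in> normal_functionals \<Longrightarrow> open U \<Longrightarrow> openin sigma_weak (\<omega> -` U)"
  unfolding sigma_weak_def by (rule topology_generated_by_Basis) blast

lemma topspace_sigma_weak [simp]: "topspace sigma_weak = (UNIV :: 'h::chilbert_space bop set)"
proof -
  have "openin sigma_weak ((\<lambda>T :: 'h bop. cinner 0 (app (amplify T) (0 :: (nat, 'h) l2))) -` UNIV)"
    by (intro openin_sigma_weak normal_functional_amplify) simp
  then show ?thesis using openin_subset by fastforce
qed

text \<open>A common kernel of normal functionals is sigma-weakly closed: where one of them is
  nonzero, it is nonzero on a neighbourhood.\<close>

lemma sigma_weak_closure_subset:
  fixes R S :: "'h::chilbert_space bop set"
  assumes "\<And>s. s \<in> S \<Longrightarrow> s \<in> normal_hull R"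
  shows "sigma_weak closure_of S \<subseteq> normal_hull R"
proof
  fix x assume x: "x \<in> sigma_weak closure_of S"
  have "inner \<xi> (app (amplify x) \<eta>) = 0"
    if z: "\<forall>r\<in>R. inner \<xi> (app (amplify r) \<eta>) = 0" for \<xi> \<eta> :: "(nat, 'h) l2"
  proof (rule ccontr)
    assume nz: "inner \<xi> (app (amplify x) \<eta>) \<noteq> 0"
    let ?U = "(\<lambda>T. cinner \<xi> (app (amplify T) \<eta>)) -` {z. Re z \<noteq> 0}"
    have "open {z. Re z \<noteq> 0}" by (intro open_Collect_neq continuous_intros)
    then have 1: "openin sigma_weak ?U" by (intro openin_sigma_weak normal_functional_amplify)
    have 2: "x \<in> ?U" using nz by (simp add: Re_cinner)
    obtain s where "s \<in> S" "s \<in> ?U"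
      using x[unfolded in_closure_of, THEN conjunct2, THEN spec, THEN mp, OF conjI[OF 2 1]]
      by (elim exE conjE)
    then show False using assms z by (auto simp: Re_cinner normal_hull_def)
  qed
  then show "x \<in> normal_hull R" by (simp add: normal_hull_def)
qed

lemma normal_hull_add:
  "x \<in> normal_hull R \<Longrightarrow> y \<in> normal_hull R \<Longrightarrow> x + y \<in> normal_hull R"
  by (simp add: normal_hull_def amplify_add inner_add_right)

lemma normal_hull_zero: "0 \<in> normal_hull R"
  by (simp add: normal_hull_def amplify_zero)

lemma normal_hull_sum:
  "(\<And>i. i \<in> F \<Longrightarrow> f i \<in> normal_hull R) \<Longrightarrow> (\<Sum>i\<in>F. f i) \<in> normal_hull R"
  by (induction F rule: infinite_finite_induct) (auto intro: normal_hull_add normal_hull_zero)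

text \<open>Multiplication is separately continuous. With \<open>s\<close> fixed, a normal
  functional of \<open>s * T\<close> is one of \<open>T\<close>, so the second variable passes to
  its hull first, and then the first one does.\<close>

lemma normal_hull_mult:
  assumes ST: "\<And>s t. s \<in> S \<Longrightarrow> t \<in> T \<Longrightarrow> s * t \<in> normal_hull R"
    and x: "x \<in> normal_hull S" and y: "y \<in> normal_hull T"
  shows "x * y \<in> normal_hull R"
  unfolding normal_hull_def
proof safe
  fix \<xi> \<eta> :: "(nat, 'a) l2"
  assume z: "\<forall>r\<in>R. inner \<xi> (app (amplify r) \<eta>) = 0"
  have st: "inner \<xi> (app (amplify (s * t)) \<eta>) = 0" if "s \<in> S" "t \<in> T" for s t
    using ST[OF that] z unfolding normal_hull_def by blast
  have adj: "inner \<xi> (app (amplify (s * t)) \<eta>) = inner (app (amplify (adj s)) \<xi>) (app (amplify t) \<eta>)" for s t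
    by (simp add: amplify_mult amplify_adj inner_adj_left)
  have "inner \<xi> (app (amplify s) (app (amplify y) \<eta>)) = 0" if "s \<in> S" for s
  proof -
    have "\<forall>t\<in>T. inner (app (amplify (adj s)) \<xi>) (app (amplify t) \<eta>) = 0"
      using st[OF that] adj by simp
    then have "inner (app (amplify (adj s)) \<xi>) (app (amplify y) \<eta>) = 0"
      using y unfolding normal_hull_def by blast
    then show ?thesis by (simp add: amplify_adj inner_adj_left)
  qed
  then have "inner \<xi> (app (amplify x) (app (amplify y) \<eta>)) = 0"
    using x unfolding normal_hull_def by blast
  then show "inner \<xi> (app (amplify (x * y)) \<eta>) = 0" by (simp add: amplify_mult)
qed

text \<open>For fixed \<open>c\<close>, each matrix entry of \<open>x * c - c * x\<close> is a
  normal functional of \<open>x\<close>, and it vanishes on \<open>R\<close> if \<open>c\<close> is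
  in the commutant.\<close>

lemma normal_hull_subset_bicommutant: "normal_hull R \<subseteq> commutant (commutant R)"
proof (intro subsetI commutantI bop_eqI)
  fix x c k assume x: "x \<in> normal_hull R" and c: "c \<in> commutant R"
  have "inner h (app (x * c) k - app (c * x) k) = 0" for h
  proof -
    obtain \<xi> \<eta> \<xi>' \<eta>' :: "(nat, 'a) l2"
      where 1: "\<And>T. inner \<xi> (app (amplify T) \<eta>) = inner h (app T (app c k))"
        and 2: "\<And>T. inner \<xi>' (app (amplify T) \<eta>') = inner (- app (adj c) h) (app T k)"
      using vector_functional by metis
    obtain \<zeta> \<kappa> :: "(nat, 'a) l2" where 3: "\<And>T. inner \<zeta> (app (amplify T) \<kappa>) =
        inner \<xi> (app (amplify T) \<eta>) + inner \<xi>' (app (amplify T) \<eta>')"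
      by (rule amplify_functional_add[where \<xi> = \<xi> and \<eta> = \<eta> and \<xi>' = \<xi>' and \<eta>' = \<eta>']) auto
    have eq: "inner \<zeta> (app (amplify T) \<kappa>) = inner h (app (T * c) k - app (c * T) k)" for T
      by (simp add: 1 2 3 inner_diff_right inner_adj_left)
    have "\<forall>r\<in>R. inner \<zeta> (app (amplify r) \<kappa>) = 0"
      using c by (simp add: eq commutant_def)
    then have "inner \<zeta> (app (amplify x) \<kappa>) = 0" using x unfolding normal_hull_def by blast
    then show ?thesis by (simp only: eq)
  qed
  from this[of "app (x * c) k - app (c * x) k"] show "app (x * c) k = app (c * x) k" by simp
qed

lemma real_functional_combination:
  fixes \<phi> :: "'i \<Rightarrow> 'h::chilbert_space bop \<Rightarrow> real"
  assumes "finite F"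
    and N: "\<And>x y. x \<in> N \<Longrightarrow> y \<in> N \<Longrightarrow> x + y \<in> N" "\<And>r x. x \<in> N \<Longrightarrow> complex_of_real r *\<^sub>C x \<in> N"
    and \<phi>: "\<And>i x y. x \<in> N \<Longrightarrow> y \<in> N \<Longrightarrow> \<phi> i (x + y) = \<phi> i x + \<phi> i y"
      "\<And>i r x. x \<in> N \<Longrightarrow> \<phi> i (complex_of_real r *\<^sub>C x) = r * \<phi> i x"
    and f: "\<And>x y. x \<in> N \<Longrightarrow> y \<in> N \<Longrightarrow> f (x + y) = f x + f y"
      "\<And>r x. x \<in> N \<Longrightarrow> f (complex_of_real r *\<^sub>C x) = r * f x"
    and ker: "\<And>x. x \<in> N \<Longrightarrow> (\<And>i. i \<in> F \<Longrightarrow> \<phi> i x = 0) \<Longrightarrow> f x = 0"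
  shows "\<exists>c. \<forall>x\<in>N. f x = (\<Sum>i\<in>F. c i * \<phi> i x)"
  using assms(1) f ker
proof (induction F arbitrary: f)
  case empty
  then show ?case by auto
next
  case (insert i F)
  show ?case
  proof (cases "\<forall>x\<in>N. (\<forall>j\<in>F. \<phi> j x = 0) \<longrightarrow> \<phi> i x = 0")
    case True
    have "\<exists>c. \<forall>x\<in>N. f x = (\<Sum>j\<in>F. c j * \<phi> j x)"
      by (rule insert.IH[OF insert.prems(1,2)]) (use insert.prems(3) True in auto)
    then obtain c where c: "\<And>x. x \<in> N \<Longrightarrow> f x = (\<Sum>j\<in>F. c j * \<phi> j x)" by blast
    have "f x = (\<Sum>j\<in>insert i F. (c(i := 0)) j * \<phi> j x)" if "x \<in> N" for x
      using insert.hyps c[OF that] by (auto intro!: sum.cong)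
    then show ?thesis by blast
  next
    case False
    then obtain x1 where x1: "x1 \<in> N" "\<And>j. j \<in> F \<Longrightarrow> \<phi> j x1 = 0" "\<phi> i x1 \<noteq> 0" by blast
    \<comment> \<open>The dual vector: \<open>\<phi> i\<close> takes the value 1 on it and the
      remaining functionals vanish.\<close>
    define x0 where "x0 = complex_of_real (1 / \<phi> i x1) *\<^sub>C x1"
    have x0: "x0 \<in> N" "\<And>j. j \<in> F \<Longrightarrow> \<phi> j x0 = 0" "\<phi> i x0 = 1"
      unfolding x0_def using x1 N by (simp_all only: \<phi>) auto
    have "\<exists>c. \<forall>x\<in>N. f x - f x0 * \<phi> i x = (\<Sum>j\<in>F. c j * \<phi> j x)"
    proof (rule insert.IH)
      fix x assume x: "x \<in> N" "\<And>j. j \<in> F \<Longrightarrow> \<phi> j x = 0"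
      let ?y = "x + complex_of_real (- \<phi> i x) *\<^sub>C x0"
      have sN: "complex_of_real (- \<phi> i x) *\<^sub>C x0 \<in> N" by (rule N(2)[OF x0(1)])
      have "f ?y = 0"
      proof (rule insert.prems(3))
        show "?y \<in> N" by (rule N(1)[OF x(1) sN])
        fix j assume "j \<in> insert i F"
        then show "\<phi> j ?y = 0" unfolding \<phi>(1)[OF x(1) sN] \<phi>(2)[OF x0(1)] using x(2) x0 by auto
      qed
      then show "f x - f x0 * \<phi> i x = 0"
        unfolding insert.prems(1)[OF x(1) sN] insert.prems(2)[OF x0(1)] by simp
    next
      fix x y assume "x \<in> N" "y \<in> N"
      then show "f (x + y) - f x0 * \<phi> i (x + y) = f x - f x0 * \<phi> i x + (f y - f x0 * \<phi> i y)"
        by (simp add: insert.prems(1) \<phi>(1) algebra_simps)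
    next
      fix r x assume "x \<in> N"
      then show "f (complex_of_real r *\<^sub>C x) - f x0 * \<phi> i (complex_of_real r *\<^sub>C x) = r * (f x - f x0 * \<phi> i x)"
        by (simp add: insert.prems(2) \<phi>(2) algebra_simps)
    qed
    then obtain c where c: "\<And>x. x \<in> N \<Longrightarrow> f x - f x0 * \<phi> i x = (\<Sum>j\<in>F. c j * \<phi> j x)" by blast
    have "f x = (\<Sum>j\<in>insert i F. (c(i := f x0)) j * \<phi> j x)" if "x \<in> N" for x
    proof -
      have "(\<Sum>j\<in>F. (c(i := f x0)) j * \<phi> j x) = (\<Sum>j\<in>F. c j * \<phi> j x)"
        using insert.hyps by (intro sum.cong) auto
      then show ?thesis using insert.hyps c[OF that] by simp
    qed
    then show ?thesis by blast
  qed
qed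

text \<open>Neighbourhoods of 0 contain subspaces of finite codimension. This is read off the
  generation of the topology by subbasic sets: intersections unite the finite sets of functionals,
  and unions keep one of them.\<close>

lemma sigma_weak_zero_neighbourhood:
  fixes W :: "'h::chilbert_space bop set"
  assumes "openin sigma_weak W" "0 \<in> W"
  shows "\<exists>F :: ((nat, 'h) l2 \<times> (nat, 'h) l2) set. finite F \<and>
    (\<forall>T. (\<forall>(\<xi>, \<eta>)\<in>F. inner \<xi> (app (amplify T) \<eta>) = 0) \<longrightarrow> T \<in> W)"
proof -
  have "generate_topology_on {\<omega> -` U | \<omega> U. \<omega> \<in> (normal_functionals :: ('h bop \<Rightarrow> complex) set) \<and> open U} W"
    using assms(1) unfolding sigma_weak_def by (rule openin_topology_generated_by)
  then show ?thesis using assms(2)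
  proof (induction rule: generate_topology_on.induct)
    case Empty
    then show ?case by simp
  next
    case (Int a b)
    have "0 \<in> a" "0 \<in> b" using Int.prems by auto
    obtain F :: "((nat, 'h) l2 \<times> (nat, 'h) l2) set" where "finite F"
      "\<forall>T. (\<forall>(\<xi>, \<eta>)\<in>F. inner \<xi> (app (amplify T) \<eta>) = 0) \<longrightarrow> T \<in> a"
      using Int.IH(1)[OF \<open>0 \<in> a\<close>] by (elim exE conjE)
    moreover obtain F' :: "((nat, 'h) l2 \<times> (nat, 'h) l2) set" where "finite F'"
      "\<forall>T. (\<forall>(\<xi>, \<eta>)\<in>F'. inner \<xi> (app (amplify T) \<eta>) = 0) \<longrightarrow> T \<in> b"
      using Int.IH(2)[OF \<open>0 \<in> b\<close>] by (elim exE conjE)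
    ultimately show ?case by (intro exI[of _ "F \<union> F'"]) auto
  next
    case (UN K)
    then obtain k where "k \<in> K" "0 \<in> k" by blast
    from UN.IH[OF this] obtain F :: "((nat, 'h) l2 \<times> (nat, 'h) l2) set" where "finite F"
      "\<forall>T. (\<forall>(\<xi>, \<eta>)\<in>F. inner \<xi> (app (amplify T) \<eta>) = 0) \<longrightarrow> T \<in> k"
      by (elim exE conjE)
    with \<open>k \<in> K\<close> show ?case by (intro exI[of _ F]) auto
  next
    case (Basis s)
    then obtain \<omega> U where s: "s = \<omega> -` U" "\<omega> \<in> normal_functionals" by blast
    obtain \<xi> \<eta> :: "(nat, 'h) l2" where \<omega>: "\<omega> = (\<lambda>T. cinner \<xi> (app (amplify T) \<eta>))"
      using s(2) by (rule normal_functionalE)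
    have "T \<in> s" if "inner \<xi> (app (amplify T) \<eta>) = 0" "inner (\<i> *\<^sub>C \<xi>) (app (amplify T) \<eta>) = 0" for T
    proof -
      have "\<omega> T = \<omega> 0" by (simp add: \<omega> cinner_def that amplify_zero)
      then show ?thesis using Basis.prems s(1) by simp
    qed
    \<comment> \<open>Two pairs, because both the real and the imaginary part of the complex
      functional must vanish.\<close>
    then show ?case by (intro exI[of _ "{(\<xi>, \<eta>), (\<i> *\<^sub>C \<xi>, \<eta>)}"]) auto
  qed
qed

text \<open>A \<open>\<sigma>\<close>-weakly continuous functional on \<open>N\<close> vanishes on the common kernel of finitely many
  normal functionals, hence is a combination of them.\<close>

lemma normal_map_functional:
  fixes E :: "'h::chilbert_space bop \<Rightarrow> 'k::chilbert_space bop"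
  assumes E: "normal_map N L E"
    and N: "\<And>x y. x \<in> N \<Longrightarrow> y \<in> N \<Longrightarrow> x + y \<in> N" "\<And>c x. x \<in> N \<Longrightarrow> c *\<^sub>C x \<in> N"
    and lin: "\<And>x y. x \<in> N \<Longrightarrow> y \<in> N \<Longrightarrow> E (x + y) = E x + E y"
      "\<And>c x. x \<in> N \<Longrightarrow> E (c *\<^sub>C x) = c *\<^sub>C E x"
  shows "\<exists>\<xi> \<eta> :: (nat, 'h) l2. \<forall>x\<in>N. inner u (app (E x) v) = inner \<xi> (app (amplify x) \<eta>)"
proof (cases "N = {}")
  case False
  define f where "f = (\<lambda>x. inner u (app (E x) v))"
  have f_add: "f (x + y) = f x + f y" if "x \<in> N" "y \<in> N" for x y
    using lin that by (simp add: f_def inner_add_right)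
  have f_scale: "f (complex_of_real r *\<^sub>C x) = r * f x" if "x \<in> N" for x r
    unfolding f_def lin(2)[OF that] scaleC_bop.rep_eq scaleC_of_real by simp
  have N0: "0 \<in> N" using False N(2)[of _ 0]
    by (metis ex_in_conv scaleC_zero_left bop_eqI scaleC_bop.rep_eq zero_bop.rep_eq)
  have f0: "f 0 = 0" using f_scale[OF N0, of 0] by (simp add: scaleC_bop_def[symmetric] ) 
       (metis f_add N0 add_cancel_right_right add_0)
  let ?w = "\<lambda>T. cinner (single_l2 0 u) (app (amplify T) (single_l2 (0::nat) v))"
  have w: "Re (?w T) = inner u (app T v)" for T
    by (simp add: Re_cinner inner_single_l2 single_l2.rep_eq)
  have "open {z. \<bar>Re z\<bar> < 1}" by (intro open_Collect_less continuous_intros)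
  then have "openin (subtopology sigma_weak L) (?w -` {z. \<bar>Re z\<bar> < 1} \<inter> L)"
    unfolding openin_subtopology
    using openin_sigma_weak[OF normal_functional_amplify] by blast
  then have "openin (subtopology sigma_weak N) {x \<in> topspace (subtopology sigma_weak N). E x \<in> ?w -` {z. \<bar>Re z\<bar> < 1} \<inter> L}"
    using E unfolding normal_map_def by (rule openin_continuous_map_preimage[rotated])
  then obtain W where W: "openin sigma_weak W"
    "{x \<in> N. E x \<in> ?w -` {z. \<bar>Re z\<bar> < 1} \<inter> L} = W \<inter> N"
    unfolding openin_subtopology by auto
  have EL: "E x \<in> L" if "x \<in> N" for x
    using E that unfolding normal_map_def by (auto simp: continuous_map_def)
  have WN: "x \<in> W \<longleftrightarrow> \<bar>f x\<bar> < 1" if "x \<in> N" for x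
    using W(2) that EL[OF that] by (auto simp: w f_def set_eq_iff)
  have "0 \<in> W" using WN[OF N0] f0 by simp
  then obtain F :: "((nat, 'h) l2 \<times> (nat, 'h) l2) set" where F: "finite F"
    "\<And>T. (\<forall>(\<xi>, \<eta>)\<in>F. inner \<xi> (app (amplify T) \<eta>) = 0) \<Longrightarrow> T \<in> W"
    using sigma_weak_zero_neighbourhood[OF W(1)] by blast
  have "\<exists>c. \<forall>x\<in>N. f x = (\<Sum>p\<in>F. c p * inner (fst p) (app (amplify x) (snd p)))"
  proof (rule real_functional_combination[OF F(1) N(1)])
    fix x assume x: "x \<in> N" "\<And>p. p \<in> F \<Longrightarrow> inner (fst p) (app (amplify x) (snd p)) = 0"
    \<comment> \<open>The common kernel is a subspace, so the whole line through \<open>x\<close>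
      stays in \<open>W\<close>, where \<open>f\<close> is bounded by 1; a linear function bounded
      on a line vanishes.\<close>
    have small: "\<bar>r * f x\<bar> < 1" for r
    proof -
      have "\<forall>(\<xi>, \<eta>)\<in>F. inner \<xi> (app (amplify (complex_of_real r *\<^sub>C x)) \<eta>) = 0"
        using x(2) unfolding amplify_scaleC scaleC_bop.rep_eq scaleC_of_real by fastforce
      then have "complex_of_real r *\<^sub>C x \<in> W" by (rule F(2))
      then show ?thesis using WN[OF N(2)[OF x(1)]] f_scale[OF x(1)] by simp
    qed
    show "f x = 0" using small[of "1 / f x"] by (cases "f x = 0") auto
  qed (auto simp: N f_add f_scale amplify_add inner_add_right amplify_scaleC scaleC_of_real)
  then obtain c where c: "\<And>x. x \<in> N \<Longrightarrow> f x = (\<Sum>p\<in>F. c p * inner (fst p) (app (amplify x) (snd p)))"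
    by blast
  obtain \<zeta> \<kappa> :: "(nat, 'h) l2" where "\<And>T. inner \<zeta> (app (amplify T) \<kappa>) =
      (\<Sum>p\<in>F. c p * inner (fst p) (app (amplify T) (snd p)))"
    using amplify_functional_sum[OF F(1), of c fst snd] by blast
  then show ?thesis using c unfolding f_def by (intro exI[of _ \<zeta>] exI[of _ \<kappa>]) simp
qed auto

section \<open>Positive normal functionals\<close>

lemma pos_Cauchy_Schwarz:
  assumes "pos T"
  shows "(inner x (app T y))\<^sup>2 \<le> inner x (app T x) * inner y (app T y)"
proof -
  have sa: "adj T = T" and nn: "\<And>x. 0 \<le> inner x (app T x)" using assms by (auto simp: pos_iff)
  have sym: "inner y (app T x) = inner x (app T y)"
    using inner_adj_left[of T y x] sa by (simp add: inner_commute)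
  let ?a = "inner x (app T x)" and ?b = "inner x (app T y)" and ?c = "inner y (app T y)"
  have q: "0 \<le> ?a + 2 * r * ?b + r\<^sup>2 * ?c" for r
    using nn[of "x + r *\<^sub>R y"] by (simp add: inner_simps sym power2_eq_square algebra_simps)
  show ?thesis
  proof (cases "?c = 0")
    case True
    have "?b = 0"
    proof (rule ccontr)
      assume "?b \<noteq> 0"
      \<comment> \<open>With \<open>?c = 0\<close> the expression is affine in \<open>r\<close>, and
        at this \<open>r\<close> it equals -1.\<close>
      then show False using q[of "- (?a + 1) / (2 * ?b)"] True by (simp add: field_simps)
    qed
    then show ?thesis using True by simp
  next
    case False
    then have "?c > 0" using nn[of y] by linarith
    moreover have "- (?b / ?c) * ?b * 2 + (?b / ?c)\<^sup>2 * ?c = - (?b\<^sup>2 / ?c)"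
      using False by (simp add: power2_eq_square field_simps)
    ultimately show ?thesis using q[of "- (?b / ?c)"] by (simp add: field_simps power2_eq_square)
  qed
qed

lemma pos_form_zero:
  assumes "pos T" "inner x (app T x) = 0"
  shows "app T x = 0"
  using pos_Cauchy_Schwarz[OF assms(1), of "app T x" x] assms(2) by simp

lemma closure_csubspace:
  assumes "subspace S" "\<And>c x. x \<in> S \<Longrightarrow> c *\<^sub>C x \<in> S"
  shows "cspan_closure S = closure S"
proof -
  have 1: "{c *\<^sub>C x | c x. x \<in> S} = S"
    using assms(2) by (auto, metis scaleC_one)
  have 2: "span S = S" using assms(1) by (intro antisym span_minimal span_superset) auto
  show ?thesis unfolding cspan_closure_def 1 2 ..
qed

text \<open>Polarisation writes the functional as \<open>\<omega>\<^bsub>\<zeta>\<^esub> - \<omega>\<^bsub>\<zeta>'\<^esub>\<close>. Positivity makes \<open>x \<zeta> \<mapsto> x \<zeta>'\<close> a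
  contraction \<open>r\<close>, and \<open>t = 1 - r\<^sup>* r\<close>.\<close>

lemma positive_normal_functional:
  fixes B :: "'k::chilbert_space bop set" and f :: "'k bop \<Rightarrow> real" and \<xi> \<eta> :: "(nat, 'k) l2"
  assumes B: "vN_algebra B"
    and f: "\<And>x. x \<in> B \<Longrightarrow> f x = inner \<xi> (app (amplify x) \<eta>)"
    and herm: "\<And>x. x \<in> B \<Longrightarrow> f (adj x) = f x"
    and nonneg: "\<And>x. x \<in> B \<Longrightarrow> 0 \<le> f (adj x * x)"
  shows "\<exists>(\<zeta> :: (nat, 'k) l2) t. pos t \<and> (\<forall>y. inner y (app t y) \<le> inner y y) \<and>
    t \<in> commutant (amplify ` B) \<and> (\<forall>x\<in>B. f x = inner \<zeta> (app (amplify x) (app t \<zeta>)))"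
proof -
  define \<zeta> where "\<zeta> = (1/2) *\<^sub>R (\<xi> + \<eta>)"
  define \<zeta>' where "\<zeta>' = (1/2) *\<^sub>R (\<xi> - \<eta>)"
  have f_eq: "f x = inner \<zeta> (app (amplify x) \<zeta>) - inner \<zeta>' (app (amplify x) \<zeta>')" if x: "x \<in> B" for x
  proof -
    \<comment> \<open>Polarisation produces both cross terms; hermitian symmetry of \<open>f\<close>
      makes them equal, so two diagonal terms suffice instead of four.\<close>
    have "inner \<eta> (app (amplify x) \<xi>) = inner \<xi> (app (amplify (adj x)) \<eta>)"
      by (simp add: amplify_adj inner_adj_right inner_commute)
    also have "\<dots> = inner \<xi> (app (amplify x) \<eta>)"
      using f[OF x] f[OF vN_adj[OF B x]] herm[OF x] by simp
    finally show ?thesis unfolding f[OF x] \<zeta>_def \<zeta>'_def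
      by (simp add: inner_add_left inner_add_right inner_diff_left inner_diff_right field_simps)
  qed
  \<comment> \<open>The orthogonal complement of the cyclic subspace of \<open>\<zeta>\<close>.
    Sending it to 0 makes the contraction densely defined without spoiling commutation with the
    amplified algebra, as \<open>Z\<close> is invariant.\<close>
  define Z where "Z = {z. \<forall>x\<in>B. inner (app (amplify x) \<zeta>) z = 0}"
  define G where "G = {(app (amplify x) \<zeta> + z, app (amplify x) \<zeta>') | x z. x \<in> B \<and> z \<in> Z}"
  have Z_add: "z + z' \<in> Z" if "z \<in> Z" "z' \<in> Z" for z z'
    using that by (simp add: Z_def inner_add_right)
  have Z_scale: "c *\<^sub>C z \<in> Z" if "z \<in> Z" for c z
    using that vN_scaleC[OF B, of _ "cnj c"] unfolding Z_def
    by (simp add: inner_scaleC_right) (metis amplify_scaleC scaleC_bop.rep_eq)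
  have Z_amp: "app (amplify y) z \<in> Z" if "z \<in> Z" "y \<in> B" for y z
  proof -
    have "inner (app (amplify x) \<zeta>) (app (amplify y) z) = inner (app (amplify (adj y * x)) \<zeta>) z" for x
      by (simp add: amplify_mult amplify_adj inner_adj_left)
    then show ?thesis using that vN_mult[OF B vN_adj[OF B]] by (simp add: Z_def)
  qed
  have Z0: "0 \<in> Z" by (simp add: Z_def)
  have G_memI: "(app (amplify x) \<zeta> + z, app (amplify x) \<zeta>') \<in> G" if "x \<in> B" "z \<in> Z" for x z
    using that by (auto simp: G_def)
  have G_add: "(a + a', b + b') \<in> G" if "(a, b) \<in> G" "(a', b') \<in> G" for a b a' b'
  proof -
    obtain x z x' z' where *: "x \<in> B" "z \<in> Z" "x' \<in> B" "z' \<in> Z" and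
      "a = app (amplify x) \<zeta> + z" "b = app (amplify x) \<zeta>'"
      "a' = app (amplify x') \<zeta> + z'" "b' = app (amplify x') \<zeta>'"
      using \<open>(a, b) \<in> G\<close> \<open>(a', b') \<in> G\<close> unfolding G_def by blast
    then show ?thesis
      using G_memI[OF vN_add[OF B *(1,3)] Z_add[OF *(2,4)]] by (simp add: amplify_add algebra_simps)
  qed
  have G_scale: "(c *\<^sub>C a, c *\<^sub>C b) \<in> G" if "(a, b) \<in> G" for a b c
  proof -
    obtain x z where *: "x \<in> B" "z \<in> Z" and "a = app (amplify x) \<zeta> + z" "b = app (amplify x) \<zeta>'"
      using \<open>(a, b) \<in> G\<close> unfolding G_def by blast
    then show ?thesis
      using G_memI[OF vN_scaleC[OF B *(1), of c] Z_scale[OF *(2), of c]]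
      by (simp add: amplify_scaleC scaleC_add_right)
  qed
  have G_bound: "norm b \<le> 1 * norm a" if "(a, b) \<in> G" for a b
  proof -
    obtain x z where *: "x \<in> B" "z \<in> Z" and ab: "a = app (amplify x) \<zeta> + z" "b = app (amplify x) \<zeta>'"
      using \<open>(a, b) \<in> G\<close> unfolding G_def by blast
    have "0 \<le> f (adj x * x)" by (rule nonneg[OF *(1)])
    also have "f (adj x * x) = (norm (app (amplify x) \<zeta>))\<^sup>2 - (norm b)\<^sup>2"
      unfolding f_eq[OF vN_mult[OF B vN_adj[OF B *(1)] *(1)]] ab
      by (simp add: amplify_mult amplify_adj inner_adj_right power2_norm_eq_inner)
    also have "(norm (app (amplify x) \<zeta>))\<^sup>2 \<le> (norm a)\<^sup>2"
      using * unfolding ab Z_def power2_norm_eq_inner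
      by (simp add: inner_add_left inner_add_right inner_commute)
    finally show ?thesis by (simp add: power2_le_iff_abs_le)
  qed
  have sub: "subspace (fst ` G)"
  proof (rule subspaceI)
    show "0 \<in> fst ` G" using G_memI[OF vN_zero[OF B] Z0] by (force simp: amplify_zero)
    show "x + y \<in> fst ` G" if "x \<in> fst ` G" "y \<in> fst ` G" for x y
      using that G_add by (auto simp: image_iff) (metis fst_conv)
    show "c *\<^sub>R x \<in> fst ` G" if "x \<in> fst ` G" for c x
      using that G_scale[of _ _ "complex_of_real c"] unfolding scaleC_of_real
      by (auto simp: image_iff) (metis fst_conv)
  qed
  have dense': "cspan_closure (fst ` G) = UNIV"
  proof (rule cspan_closure_UNIV)
    fix y assume y: "\<And>x c. x \<in> fst ` G \<Longrightarrow> inner (c *\<^sub>C x) y = 0"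
    have y1: "inner (app (amplify x) \<zeta> + z) y = 0" if "x \<in> B" "z \<in> Z" for x z
      using y[of _ 1, OF imageI[OF G_memI[OF that]]] by simp
    have "y \<in> Z" using y1[OF _ Z0] by (simp add: Z_def)
    then show "y = 0" using y1[OF vN_zero[OF B], of y] by (simp add: amplify_zero)
  qed
  have dense: "closure (fst ` G) = UNIV"
  proof -
    have "c *\<^sub>C x \<in> fst ` G" if "x \<in> fst ` G" for c x
      using that G_scale by (auto simp: image_iff) (metis fst_conv)
    then show ?thesis using closure_csubspace[OF sub] dense' by simp
  qed
  obtain f' where f': "bounded_clinear f'" "\<And>a b. (a, b) \<in> G \<Longrightarrow> f' a = b" "\<And>x. norm (f' x) \<le> 1 * norm x"
    using bounded_extension[OF G_add G_scale G_bound dense] by blast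
  obtain r where r: "app r = f'" using f'(1) by (rule bop_obtain)
  have rG: "app r (app (amplify x) \<zeta> + z) = app (amplify x) \<zeta>'" if "x \<in> B" "z \<in> Z" for x z
    using f'(2)[OF G_memI[OF that]] by (simp add: r)
  have r_comm: "r * amplify y = amplify y * r" if y: "y \<in> B" for y
  proof (rule bop_eq_on_dense[OF dense'])
    fix a assume "a \<in> fst ` G"
    then obtain x z where *: "x \<in> B" "z \<in> Z" and a: "a = app (amplify x) \<zeta> + z"
      unfolding G_def by auto
    show "app (r * amplify y) a = app (amplify y * r) a"
      using rG[OF *] rG[OF vN_mult[OF B y *(1)] Z_amp[OF *(2) y]] by (simp add: a amplify_mult)
  qed
  have r_adj_comm: "adj r * amplify y = amplify y * adj r" if y: "y \<in> B" for y
    using arg_cong[OF r_comm[OF vN_adj[OF B y]], of adj] by (simp add: amplify_adj)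
  have r\<zeta>: "app r \<zeta> = \<zeta>'" using rG[OF vN_one[OF B] Z0] by (simp add: amplify_one)
  define t where "t = 1 - adj r * r"
  have ty: "inner y (app t y) = inner y y - inner (app r y) (app r y)" for y
    by (simp add: t_def inner_diff_right inner_adj_right)
  have le: "inner (app r y) (app r y) \<le> inner y y" for y
    using f'(3)[of y] by (simp add: r norm_le)
  have "pos t" unfolding pos_iff using le by (auto simp: ty) (simp add: t_def)
  moreover have "\<forall>y. inner y (app t y) \<le> inner y y" by (simp add: ty)
  moreover have "t \<in> commutant (amplify ` B)"
  proof (rule commutantI)
    fix x :: "(nat, 'k) l2 bop" assume "x \<in> amplify ` B"
    then obtain y where y: "y \<in> B" "x = amplify y" by blast
    have "adj r * r * x = adj r * (r * amplify y)" by (simp only: mult.assoc y)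
    also have "\<dots> = (adj r * amplify y) * r" by (simp only: mult.assoc r_comm[OF y(1)])
    also have "\<dots> = x * (adj r * r)" by (simp only: mult.assoc r_adj_comm[OF y(1)] y(2))
    finally have "adj r * r * x = x * (adj r * r)" .
    then show "t * x = x * t" by (simp add: t_def left_diff_distrib right_diff_distrib)
  qed
  moreover have "f x = inner \<zeta> (app (amplify x) (app t \<zeta>))" if x: "x \<in> B" for x
  proof -
    have "inner \<zeta>' (app (amplify x) \<zeta>') = inner \<zeta> (app (adj r * amplify x) (app r \<zeta>))"
      by (simp add: inner_adj_right r\<zeta>)
    also have "\<dots> = inner \<zeta> (app (amplify x) (app (adj r * r) \<zeta>))"
      unfolding r_adj_comm[OF x] by simp
    finally show ?thesis unfolding f_eq[OF x] t_def by (simp add: inner_diff_right)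
  qed
  ultimately show ?thesis by blast
qed

lemma fn_cond_exp_functional:
  fixes B :: "'k::chilbert_space bop set"
  assumes B: "vN_algebra B" and E: "fn_cond_exp B A E"
  shows "\<exists>(\<zeta> :: (nat, 'k) l2) t. pos t \<and> (\<forall>y. inner y (app t y) \<le> inner y y) \<and>
    t \<in> commutant (amplify ` B) \<and> (\<forall>x\<in>B. inner v (app (E x) v) = inner \<zeta> (app (amplify x) (app t \<zeta>)))"
proof -
  have add: "E (x + y) = E x + E y" if "x \<in> B" "y \<in> B" for x y
    using E that by (simp add: fn_cond_exp_def)
  have scale: "E (c *\<^sub>C x) = c *\<^sub>C E x" if "x \<in> B" for c x
    using E that by (simp add: fn_cond_exp_def)
  have posE: "pos (E (adj x * x))" if "x \<in> B" for x
    using E vN_mult[OF B vN_adj[OF B that] that] pos_adj_mult[of x] unfolding fn_cond_exp_def by blast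
  have "normal_map B A E" using E by (simp add: fn_cond_exp_def)
  then obtain \<xi> \<eta> :: "(nat, 'k) l2" where
    rep: "\<And>x. x \<in> B \<Longrightarrow> inner v (app (E x) v) = inner \<xi> (app (amplify x) \<eta>)"
    using normal_map_functional[OF _ vN_add[OF B] vN_scaleC[OF B] add scale, of A v v] by blast
  have im: "inner v (app (E (\<i> *\<^sub>C (adj x * x))) v) = 0" if x: "x \<in> B" for x
  proof -
    have "cinner v (app (E (adj x * x)) v) \<in> complex_of_real ` {0..}"
      using posE[OF x] by (simp add: pos_def)
    then have "inner (\<i> *\<^sub>C v) (app (E (adj x * x)) v) = 0"
      by (auto simp: cinner_def complex_eq_iff)
    moreover have "(- \<i>) *\<^sub>C v = - (\<i> *\<^sub>C v)"
      using scaleC_scaleC[of "- 1" \<i> v] by simp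
    ultimately show ?thesis
      by (simp add: scale[OF vN_mult[OF B vN_adj[OF B x] x]] inner_scaleC_right)
  qed
  have herm: "inner v (app (E (adj x)) v) = inner v (app (E x) v)" if x: "x \<in> B" for x
  proof -
    \<comment> \<open>Multiplying \<open>adj ?y * ?y\<close> by \<open>\<i>\<close> gives
      \<open>\<i> - x + adj x + \<i> (adj x * x)\<close>. Terms that are \<open>\<i>\<close> times a
      positive element have zero real part, so what remains compares \<open>adj x\<close> with
      \<open>x\<close>.\<close>
    let ?y = "1 + \<i> *\<^sub>C x"
    have y: "?y \<in> B" by (intro vN_add[OF B] vN_one[OF B] vN_scaleC[OF B] x)
    have xx: "adj x * x \<in> B" by (intro vN_mult[OF B] vN_adj[OF B] x)
    have eq: "\<i> *\<^sub>C (adj ?y * ?y) = \<i> *\<^sub>C (adj 1 * 1) + ((- 1) *\<^sub>C x + (adj x + \<i> *\<^sub>C (adj x * x)))"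
      by (rule bop_eqI) (simp add: scaleC_add_right scaleC_scaleC)
    have "inner v (app (E (\<i> *\<^sub>C (adj 1 * 1))) v) = 0" by (rule im[OF vN_one[OF B]])
    moreover have "E (\<i> *\<^sub>C (adj ?y * ?y)) =
        E (\<i> *\<^sub>C (adj 1 * 1)) + ((- 1) *\<^sub>C E x + (E (adj x) + E (\<i> *\<^sub>C (adj x * x))))"
      unfolding eq
      by (simp only: add scale vN_add[OF B] vN_scaleC[OF B] vN_adj[OF B] vN_mult[OF B] vN_one[OF B] x)
    ultimately show ?thesis using im[OF y] im[OF x] by (simp add: inner_add_right inner_diff_right)
  qed
  have nonneg: "0 \<le> inner v (app (E (adj x * x)) v)" if "x \<in> B" for x
    using posE[OF that] by (simp add: pos_iff)
  show ?thesis
    by (rule positive_normal_functional[where f = "\<lambda>x. inner v (app (E x) v)", OF B])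
      (assumption | rule rep herm nonneg)+
qed

section \<open>Graded von Neumann algebras\<close>

text \<open>Here \<open>c\<close> is any operator on the amplified space, not an amplified one;
  matrix entries of its commutator with \<open>amplify x\<close> are still normal functionals of
  \<open>x\<close>. It is applied to the projection \<open>Q\<close>.\<close>

lemma commute_normal_hull:
  fixes c :: "(nat, 'k::chilbert_space) l2 bop"
  assumes c: "\<And>r. r \<in> R \<Longrightarrow> c * amplify r = amplify r * c" and x: "x \<in> normal_hull R"
  shows "c * amplify x = amplify x * c"
proof (rule bop_eqI)
  fix k
  have "inner h (app (c * amplify x) k - app (amplify x * c) k) = 0" for h
  proof -
    obtain \<zeta> \<kappa> :: "(nat, 'k) l2" where 1: "\<And>T. inner \<zeta> (app (amplify T) \<kappa>) =
        inner (app (adj c) h) (app (amplify T) k) + inner (- h) (app (amplify T) (app c k))"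
      by (rule amplify_functional_add[where \<xi> = "app (adj c) h" and \<eta> = k and \<xi>' = "- h" and \<eta>' = "app c k"]) auto
    have eq: "inner \<zeta> (app (amplify T) \<kappa>) = inner h (app (c * amplify T) k - app (amplify T * c) k)" for T
      by (simp add: 1 inner_diff_right inner_adj_left)
    have "\<forall>r\<in>R. inner \<zeta> (app (amplify r) \<kappa>) = 0" unfolding eq using c by simp
    then have "inner \<zeta> (app (amplify x) \<kappa>) = 0" using x unfolding normal_hull_def by blast
    then show ?thesis by (simp only: eq)
  qed
  from this[of "app (c * amplify x) k - app (amplify x * c) k"]
  show "app (c * amplify x) k = app (amplify x * c) k" by simp
qed

lemma annihilates_amplified:
  assumes "\<And>n k. app R (single_l2 n (app q k)) = 0"
  shows "R * amplify q = 0"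
proof -
  have "amplify (adj q) * adj R = 0"
  proof (rule bop_eqI, rule l2_zero_by_singles[THEN trans])
    fix v n h
    have "inner (single_l2 n h) (app (amplify (adj q) * adj R) v) = inner (app q h) (coord (app (adj R) v) n)"
      by (simp add: inner_single_l2 inner_adj_right)
    also have "\<dots> = inner (app R (single_l2 n (app q h))) v"
      by (simp add: inner_adj_right flip: inner_single_l2)
    finally show "inner (single_l2 n h) (app (amplify (adj q) * adj R) v) = 0" using assms by simp
  qed simp
  from arg_cong[OF this, of adj] show ?thesis by (simp add: amplify_adj)
qed

text \<open>The range is invariant under the commutant, so \<open>q\<close> is in the bicommutant.
  This replaces the vector \<open>k\<close> by an element of \<open>B\<close>, to which the faithful
  expectation applies.\<close>

lemma cyclic_projection:
  fixes B :: "'k::chilbert_space bop set"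
  assumes B: "vN_algebra B"
  obtains q where "q \<in> B" "projection q" "range (app q) = cspan_closure {app w k | w. w \<in> commutant B}"
    "app q k = k"
proof -
  let ?S = "cspan_closure {app w k | w. w \<in> commutant B}"
  obtain q where q: "projection q" "range (app q) = ?S" "\<And>x. x \<in> ?S \<Longrightarrow> app q x = x"
    by (rule projection_onto[OF closed_csubspace_cspan_closure[of "{app w k | w. w \<in> commutant B}"]]) (rule that)
  have Bc: "adj w \<in> commutant B" if "w \<in> commutant B" for w
    using that B by (intro commutant_adj) (auto simp: vN_algebra_def)
  have inv: "app w x \<in> ?S" if "w \<in> commutant B" "x \<in> ?S" for w x
  proof (rule cspan_closure_image[OF bounded_clinear_app _ that(2)])
    fix y assume "y \<in> {app w k | w. w \<in> commutant B}"
    then obtain w' where "w' \<in> commutant B" "y = app w' k" by blast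
    then have "app w y = app (w * w') k" "w * w' \<in> commutant B"
      using that(1) commutant_mult by auto
    then show "app w y \<in> ?S" by (intro subsetD[OF cspan_closure_superset]) blast
  qed
  have "q \<in> commutant (commutant B)"
    by (rule commutantI, rule projection_commute[OF q]) (use inv Bc in auto)
  then have "q \<in> B" using B by (simp add: vN_algebra_def)
  moreover have "app 1 k \<in> ?S" by (rule subsetD[OF cspan_closure_superset]) (use commutant_one in blast)
  then have "app q k = k" using q(3) by simp
  ultimately show ?thesis using that q by blast
qed

text \<open>The part of the Longo-Rehren structure on which the comparison with the crossed product
  rests. The sets \<open>gen g\<close> carry products and adjoints only; sums and limits enter
  through \<open>normal_hull\<close> and bicommutants.\<close>

locale graded_vN_algebra =
  fixes gen :: "'g::group_add \<Rightarrow> 'k::chilbert_space bop set"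
    and A B B0 :: "'k bop set" and E :: "'k bop \<Rightarrow> 'k bop"
    and u :: "'g \<Rightarrow> 'k bop" and \<beta> :: "'g \<Rightarrow> 'k bop \<Rightarrow> 'k bop"
  assumes gen_mult: "x \<in> gen g \<Longrightarrow> y \<in> gen h \<Longrightarrow> x * y \<in> gen (g + h)"
    and gen_adj: "x \<in> gen g \<Longrightarrow> adj x \<in> gen (- g)"
    and gen_one: "1 \<in> gen 0"
    and B_eq: "B = commutant (commutant (\<Union>g. gen g))"
    and E: "fn_cond_exp B A E"
    and E_gen: "g \<noteq> 0 \<Longrightarrow> x \<in> gen g \<Longrightarrow> E x = 0"
    and u_hull: "u g \<in> normal_hull (gen g)"
    and u_unitary: "unitary (u g)"
    and u_mult: "u g * u h = u (g + h)"
    and B0_hull: "B0 \<subseteq> normal_hull (gen 0)"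
    and gen_B0: "gen 0 \<subseteq> commutant (commutant B0)"
    and \<beta>: "b \<in> B0 \<Longrightarrow> \<beta> g b = u g * b * adj (u g)"
begin

lemma vN_B: "vN_algebra B"
proof -
  have "adj ` (\<Union>g. gen g) \<subseteq> (\<Union>g. gen g)" using gen_adj by blast
  then have "vN_generated (\<Union>g. gen g) = B" by (simp add: vN_generated_def B_eq Un_absorb2)
  then show ?thesis using vN_algebra_vN_generated by metis
qed

lemma gen_B: "gen g \<subseteq> B"
  unfolding B_eq using commutant_commutant_extensive[of "\<Union>g. gen g"] by blast

lemma hull_mult: "x \<in> normal_hull (gen g) \<Longrightarrow> y \<in> normal_hull (gen h) \<Longrightarrow> x * y \<in> normal_hull (gen (g + h))"
  by (rule normal_hull_mult[of "gen g" "gen h"]) (use gen_mult normal_hull_superset in blast)+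

lemma hull_B: "normal_hull (gen g) \<subseteq> B"
  using normal_hull_subset_bicommutant[of "gen g"] bicommutant_mono[of "gen g" "\<Union>g. gen g"]
  unfolding B_eq by blast

lemma u_zero: "u 0 = 1"
proof -
  have "adj (u 0) * (u 0 * u 0) = adj (u 0) * u 0" by (simp add: u_mult)
  then show ?thesis using u_unitary[of 0] by (simp add: unitary_def flip: mult.assoc)
qed

lemma adj_u: "adj (u g) = u (- g)"
proof -
  have "adj (u g) * (u g * u (- g)) = adj (u g)" by (simp add: u_mult u_zero)
  then show ?thesis using u_unitary[of g] by (simp add: unitary_def flip: mult.assoc)
qed

lemma \<beta>_hull: "b \<in> B0 \<Longrightarrow> \<beta> g b \<in> normal_hull (gen 0)"
  using hull_mult[OF hull_mult[OF u_hull[of g] subsetD[OF B0_hull]] u_hull[of "- g"], of b]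
  by (simp add: \<beta> adj_u)

text \<open>An element \<open>x\<close> of degree \<open>g\<close> factors as
  \<open>x * u (- g)\<close>, of degree 0, times \<open>u g\<close>.\<close>

lemma generated_eq: "vN_generated (B0 \<union> range u) = B"
proof -
  have "B0 \<union> range u \<subseteq> B" using B0_hull u_hull hull_B by blast
  then have "B0 \<union> range u \<union> adj ` (B0 \<union> range u) \<subseteq> B" using vN_adj[OF vN_B] by blast
  from bicommutant_mono[OF this] have 1: "vN_generated (B0 \<union> range u) \<subseteq> B"
    unfolding vN_generated_def using vN_algebra_bicommutant[OF vN_B] by simp
  let ?N = "vN_generated (B0 \<union> range u)"
  have N: "vN_algebra ?N" by (rule vN_algebra_vN_generated)
  have sub: "commutant (commutant B0) \<subseteq> ?N"
    unfolding vN_generated_def by (intro bicommutant_mono) blast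
  have "x \<in> ?N" if x: "x \<in> gen g" for x g
  proof -
    have "x * u (- g) \<in> normal_hull (gen 0)"
      using hull_mult[OF subsetD[OF normal_hull_superset x] u_hull[of "- g"]] by simp
    then have "x * u (- g) \<in> commutant (commutant (gen 0))" using normal_hull_subset_bicommutant by blast
    then have "x * u (- g) \<in> ?N" using bicommutant_least[OF gen_B0] sub by blast
    moreover have "u g \<in> ?N" using vN_generated_base[of "B0 \<union> range u"] by blast
    ultimately have "x * u (- g) * u g \<in> ?N" by (rule vN_mult[OF N])
    then show ?thesis by (simp add: mult.assoc u_mult u_zero)
  qed
  then have "B \<subseteq> ?N"
    unfolding B_eq using bicommutant_mono[of "\<Union>g. gen g" ?N] vN_algebra_bicommutant[OF N] by blast
  then show ?thesis using 1 by blast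
qed

text \<open>In \<open>dilates v \<zeta> t Q\<close> the operator \<open>t\<close> commutes with \<open>B\<close>, the functional \<open>\<langle>v, E(x) v\<rangle>\<close> equals
  \<open>\<langle>\<zeta>, x t \<zeta>\<rangle>\<close>, and \<open>Q\<close> projects onto the closed span of \<open>gen 0\<close> applied to \<open>\<zeta>\<close>.\<close>

definition dilates :: "'k \<Rightarrow> (nat, 'k) l2 \<Rightarrow> (nat, 'k) l2 bop \<Rightarrow> (nat, 'k) l2 bop \<Rightarrow> bool" where
  "dilates v \<zeta> t Q \<longleftrightarrow> pos t \<and> (\<forall>y. inner y (app t y) \<le> inner y y) \<and>
    t \<in> commutant (amplify ` B) \<and> (\<forall>x\<in>B. inner v (app (E x) v) = inner \<zeta> (app (amplify x) (app t \<zeta>))) \<and>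
    projection Q \<and> range (app Q) = cspan_closure {app (amplify x) \<zeta> | x. x \<in> gen 0} \<and>
    (\<forall>x \<in> cspan_closure {app (amplify x) \<zeta> | x. x \<in> gen 0}. app Q x = x)"

lemma dilates_exists: "\<exists>\<zeta> t Q. dilates v \<zeta> t Q"
proof -
  obtain \<zeta> :: "(nat, 'k) l2" and t where t: "pos t" "\<forall>y. inner y (app t y) \<le> inner y y"
    "t \<in> commutant (amplify ` B)" "\<forall>x\<in>B. inner v (app (E x) v) = inner \<zeta> (app (amplify x) (app t \<zeta>))"
    using fn_cond_exp_functional[OF vN_B E, of v] by blast
  obtain Q where "projection Q" "range (app Q) = cspan_closure {app (amplify x) \<zeta> | x. x \<in> gen 0}"
    "\<And>x. x \<in> cspan_closure {app (amplify x) \<zeta> | x. x \<in> gen 0} \<Longrightarrow> app Q x = x"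
    by (rule projection_onto[OF closed_csubspace_cspan_closure[of "{app (amplify x) \<zeta> | x. x \<in> gen 0}"]])
      (rule that)
  then show ?thesis using t unfolding dilates_def by blast
qed

context
  fixes v \<zeta> t Q
  assumes dil: "dilates v \<zeta> t Q"
begin

lemma t_pos: "pos t" and t_le: "inner y (app t y) \<le> inner y y"
  and t_adj: "adj t = t"
  and t_commute: "x \<in> B \<Longrightarrow> t * amplify x = amplify x * t"
  and functional: "x \<in> B \<Longrightarrow> inner v (app (E x) v) = inner \<zeta> (app (amplify x) (app t \<zeta>))"
  and Q_adj: "adj Q = Q" and Q_idem: "Q * Q = Q"
  using dil by (auto simp: dilates_def pos_iff projection_def commutant_def)

lemma app_t_amplify: "x \<in> B \<Longrightarrow> app t (app (amplify x) y) = app (amplify x) (app t y)"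
  using t_commute[THEN arg_cong[of _ _ "\<lambda>T. app T y"]] by simp

lemma Q_commute: "x \<in> normal_hull (gen 0) \<Longrightarrow> Q * amplify x = amplify x * Q"
proof (rule commute_normal_hull[of "gen 0"])
  let ?Z = "cspan_closure {app (amplify x) \<zeta> | x. x \<in> gen 0}"
  have inv: "app (amplify x) y \<in> ?Z" if "x \<in> gen 0" "y \<in> ?Z" for x y
  proof (rule cspan_closure_image[OF bounded_clinear_app _ that(2)])
    fix z assume "z \<in> {app (amplify x) \<zeta> | x. x \<in> gen 0}"
    then obtain x' where "x' \<in> gen 0" "z = app (amplify x') \<zeta>" by blast
    then have "app (amplify x) z = app (amplify (x * x')) \<zeta>" "x * x' \<in> gen 0"
      using gen_mult[OF that(1), of x' 0] by (simp_all add: amplify_mult)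
    then show "app (amplify x) z \<in> ?Z" by (intro subsetD[OF cspan_closure_superset]) blast
  qed
  fix r assume r: "r \<in> gen 0"
  have ra: "adj r \<in> gen 0" using gen_adj[OF r] by simp
  have Q: "projection Q" "range (app Q) = ?Z" "\<And>x. x \<in> ?Z \<Longrightarrow> app Q x = x"
    using dil unfolding dilates_def by blast+
  show "Q * amplify r = amplify r * Q"
    by (rule projection_commute[OF Q]) (simp_all add: inv r ra flip: amplify_adj)
qed

lemma Q_\<zeta>: "app Q \<zeta> = \<zeta>"
proof -
  have "app (amplify 1) \<zeta> \<in> cspan_closure {app (amplify x) \<zeta> | x. x \<in> gen 0}"
    by (rule subsetD[OF cspan_closure_superset]) (use gen_one in blast)
  then show ?thesis using dil unfolding dilates_def amplify_one one_bop.rep_eq by blast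
qed

text \<open>Between vectors \<open>x \<zeta>\<close> and \<open>x' \<zeta>\<close> with
  \<open>x\<close>, \<open>x'\<close> of degree 0, the matrix entry of \<open>t u_g\<close> is
  \<open><v, E(adj x * u_g * x') v>\<close>, and its argument has degree \<open>g\<close>. Passing
  to closed spans in both variables gives the operator identity.\<close>

lemma graded_orthogonal:
  assumes "g \<noteq> 0"
  shows "Q * t * amplify (u g) * Q = 0"
proof -
  let ?X = "{app (amplify x) \<zeta> | x. x \<in> gen 0}"
  have uB: "u g \<in> B" using u_hull hull_B by blast
  have base: "inner (c *\<^sub>C app (amplify x) \<zeta>) (app t (app (amplify (u g)) (app (amplify x') \<zeta>))) = 0"
    if x: "x \<in> gen 0" "x' \<in> gen 0" for c x x'
  proof -
    have xB: "x \<in> B" "x' \<in> B" using x gen_B by auto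
    \<comment> \<open>\<open>E\<close> is known to vanish on \<open>gen g\<close>, of which
      \<open>u g\<close> is only a limit; so the vanishing is shown for \<open>y\<close> in
      \<open>gen g\<close> and transferred by the hull. The scalar \<open>c\<close> is there because
      the closed spans are complex.\<close>
    have "inner (app (amplify x) (c *\<^sub>C \<zeta>)) (app (amplify y) (app (amplify x') (app t \<zeta>))) = 0"
      if y: "y \<in> gen g" for y
    proof -
      have m: "adj x * y * x' \<in> gen g" using gen_mult[OF gen_mult[OF gen_adj[OF x(1)] y] x(2)] by simp
      then have mB: "adj x * y * x' \<in> B" using gen_B by blast
      have "E (cnj c *\<^sub>C (adj x * y * x')) = cnj c *\<^sub>C E (adj x * y * x')"
        using E mB by (simp add: fn_cond_exp_def)
      also have "\<dots> = 0" unfolding E_gen[OF assms m] by (rule bop_eqI) simp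
      finally have "inner \<zeta> (app (amplify (cnj c *\<^sub>C (adj x * y * x'))) (app t \<zeta>)) = 0"
        using functional[OF vN_scaleC[OF vN_B mB, of "cnj c"]] by simp
      then show ?thesis
        by (simp add: amplify_scaleC amplify_mult amplify_adj inner_scaleC_right inner_adj_right)
    qed
    then have "inner (app (amplify x) (c *\<^sub>C \<zeta>)) (app (amplify (u g)) (app (amplify x') (app t \<zeta>))) = 0"
      using u_hull[of g] unfolding normal_hull_def by blast
    then show ?thesis by (simp add: app_t_amplify uB xB)
  qed
  have 1: "inner z (app t (app (amplify (u g)) (app (amplify x') \<zeta>))) = 0"
    if "z \<in> cspan_closure ?X" "x' \<in> gen 0" for z x'
  proof (rule orthogonal_cspan_closure[OF _ that(1)])
    fix y c assume "y \<in> ?X"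
    then obtain x where "x \<in> gen 0" "y = app (amplify x) \<zeta>" by blast
    then show "inner (c *\<^sub>C y) (app t (app (amplify (u g)) (app (amplify x') \<zeta>))) = 0"
      using base that(2) by simp
  qed
  have 2: "inner z' (app (adj (amplify (u g))) (app t z)) = 0"
    if z: "z \<in> cspan_closure ?X" "z' \<in> cspan_closure ?X" for z z'
  proof (rule orthogonal_cspan_closure[OF _ z(2)])
    fix y c assume "y \<in> ?X"
    then obtain x' where x': "x' \<in> gen 0" "y = app (amplify x') \<zeta>" by blast
    have "cnj c *\<^sub>C z \<in> cspan_closure ?X"
      using z(1) closed_csubspace_cspan_closure unfolding closed_csubspace_def by blast
    from 1[OF this x'(1)] have "inner z (app t (app (amplify (u g)) (c *\<^sub>C y))) = 0"
      by (simp add: x' inner_scaleC_right)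
    then have "inner (app t z) (app (amplify (u g)) (c *\<^sub>C y)) = 0"
      using inner_adj_left[of t z "app (amplify (u g)) (c *\<^sub>C y)"] by (simp only: t_adj)
    then show "inner (c *\<^sub>C y) (app (adj (amplify (u g))) (app t z)) = 0"
      by (simp only: inner_adj_right inner_commute)
  qed
  have ran: "app Q y \<in> cspan_closure ?X" for y using dil unfolding dilates_def by blast
  show ?thesis
  proof (rule bop_eqI, rule eq_by_inner)
    fix y z
    have "inner (app (Q * t * amplify (u g) * Q) y) z = inner (app Q y) (app (adj (amplify (u g))) (app t (app Q z)))"
      using inner_adj_left[of Q] inner_adj_left[of t] t_adj Q_adj
      by (simp add: inner_adj_right) 
    then show "inner (app (Q * t * amplify (u g) * Q) y) z = inner (app 0 y) z"
      using 2[OF ran ran] by simp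
  qed
qed

lemma inner_t: "inner (app t x) y = inner x (app t y)" and inner_Q: "inner (app Q x) y = inner x (app Q y)"
  using inner_adj_left[of t x y] inner_adj_left[of Q x y] by (simp_all add: t_adj Q_adj)

lemma Q_Q [simp]: "app Q (app Q y) = app Q y"
  using Q_idem[THEN arg_cong[of _ _ "\<lambda>T. app T y"]] by simp

text \<open>The ranges of \<open>u_g Q\<close> are orthogonal for the form of \<open>t\<close>. With
  \<open>S\<close> the sum in question and \<open>X\<close> the sum of the \<open>u_g x_g\<close>,
  one has \<open>S = <y, t X>\<close> and \<open><X, t X> \<le> S\<close>, so Cauchy-Schwarz for
  \<open>t\<close> gives \<open>S^2 \<le> |y|^2 S\<close>.\<close>

lemma graded_Bessel:
  assumes "finite F"
  shows "(\<Sum>g\<in>F. (norm (app (Q * t * amplify (u (- g))) y))\<^sup>2) \<le> (norm y)\<^sup>2"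
proof -
  define x where "x = (\<lambda>g. app (Q * t * amplify (u (- g))) y)"
  define X where "X = (\<Sum>g\<in>F. app (amplify (u g)) (x g))"
  define S where "S = (\<Sum>g\<in>F. inner (x g) (x g))"
  have uB: "u g \<in> B" for g using u_hull hull_B by blast
  have Qx: "app Q (x g) = x g" for g by (simp add: x_def)
  have uu: "inner (app (amplify (u g)) w) z = inner w (app (amplify (u (- g))) z)" for g w z
    using inner_adj_left[of "amplify (u (- g))" w z] by (simp add: adj_u flip: amplify_adj)
  have "inner (x g) (x g) = inner y (app t (app (amplify (u g)) (x g)))" for g
  proof -
    have "inner (x g) (x g) = inner (app t (app (amplify (u (- g))) y)) (app Q (x g))"
      by (simp add: x_def inner_Q)
    also have "\<dots> = inner y (app (amplify (u g)) (app t (x g)))"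
      using uu[of "- g" y] by (simp add: Qx inner_t)
    finally show ?thesis by (simp add: app_t_amplify uB)
  qed
  then have S1: "S = inner y (app t X)"
    by (simp add: S_def X_def app_sum_vec inner_sum_right)
  \<comment> \<open>Every \<open>x g\<close> is fixed by \<open>Q\<close>, so the entry is one of
    \<open>Q t u_k Q\<close> with \<open>k = - g + h\<close>, which vanishes off the
    diagonal.\<close>
  have "inner (app (amplify (u g)) (x g)) (app t (app (amplify (u h)) (x h))) =
      (if h = g then inner (x g) (app t (x g)) else 0)" for g h
  proof -
    have "inner (app (amplify (u g)) (x g)) (app t (app (amplify (u h)) (x h))) =
        inner (x g) (app (amplify (u (- g))) (app t (app (amplify (u h)) (x h))))"
      by (rule uu)
    also have "\<dots> = inner (app Q (x g)) (app t (app (amplify (u (- g) * u h)) (app Q (x h))))"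
      by (simp add: Qx amplify_mult app_t_amplify uB)
    also have "\<dots> = inner (x g) (app (Q * t * amplify (u (- g) * u h) * Q) (x h))"
      by (simp add: inner_Q)
    finally have eq: "inner (app (amplify (u g)) (x g)) (app t (app (amplify (u h)) (x h))) =
        inner (x g) (app (Q * t * amplify (u (- g) * u h) * Q) (x h))" .
    show ?thesis
    proof (cases "h = g")
      case True
      then show ?thesis using eq by (simp add: u_mult u_zero amplify_one Qx inner_Q[symmetric])
    next
      case False
      then have "- g + h \<noteq> 0" by (metis add.inverse_inverse neg_eq_iff_add_eq_0)
      then have "Q * t * amplify (u (- g) * u h) * Q = 0" using graded_orthogonal[of "- g + h"] by (simp add: u_mult)
      with eq False show ?thesis by (simp del: times_bop.rep_eq)
    qed
  qed
  then have "inner X (app t X) = (\<Sum>g\<in>F. inner (x g) (app t (x g)))"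
    using assms by (simp add: X_def app_sum_vec inner_sum_right inner_sum_left sum.delta)
  also have "\<dots> \<le> S" unfolding S_def by (intro sum_mono t_le)
  finally have S2: "inner X (app t X) \<le> S" .
  have S0: "0 \<le> S" unfolding S_def by (intro sum_nonneg) simp
  have "S\<^sup>2 \<le> inner y (app t y) * inner X (app t X)"
    unfolding S1 by (rule pos_Cauchy_Schwarz[OF t_pos])
  also have "\<dots> \<le> (norm y)\<^sup>2 * S"
    using S2 t_le[of y] t_pos by (intro mult_mono) (auto simp: power2_norm_eq_inner pos_iff)
  finally have "S \<le> (norm y)\<^sup>2" using S0
    by (cases "S = 0") (auto simp: power2_eq_square)
  then show ?thesis by (simp add: S_def x_def power2_norm_eq_inner)
qed

text \<open>The factors are peeled off from the left: \<open>Q t Q w = 0\<close> forces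
  \<open>t Q w = 0\<close> by positivity of \<open>t\<close>, then \<open>Q t Q t q = 0\<close>
  gives \<open>t Q t q = 0\<close> and hence \<open>Q t q = 0\<close>. As \<open>Q\<close> fixes
  \<open>\<zeta>\<close>, the functional at \<open>q\<close> is an entry of
  \<open>Q t q\<close>.\<close>

lemma annihilated_functional:
  assumes q: "q \<in> B" "projection q" and z: "Q * t * Q * t * amplify q = 0"
  shows "inner v (app (E q) v) = 0"
proof -
  have z': "app Q (app t (app Q (app t (app (amplify q) y)))) = 0" for y
    using z[THEN arg_cong[of _ _ "\<lambda>T. app T y"]] by simp
  have 1: "app t (app Q (app t (app (amplify q) y))) = 0" for y
  proof (rule pos_form_zero[OF t_pos])
    show "inner (app Q (app t (app (amplify q) y))) (app t (app Q (app t (app (amplify q) y)))) = 0"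
      by (simp add: inner_Q z')
  qed
  have 2: "app Q (app t (app (amplify q) y)) = 0" for y
  proof -
    have "inner (app Q (app t (app (amplify q) y))) (app Q (app t (app (amplify q) y))) =
        inner (app (amplify q) y) (app t (app Q (app t (app (amplify q) y))))"
      by (simp add: inner_Q inner_t)
    then show ?thesis by (simp add: 1)
  qed
  have "inner v (app (E q) v) = inner (app Q \<zeta>) (app t (app (amplify q) \<zeta>))"
    by (simp add: functional[OF q(1)] Q_\<zeta> app_t_amplify[OF q(1)])
  then show ?thesis by (simp add: inner_Q 2)
qed

end

text \<open>Common end of both separation arguments. The hypothesis ranges over \<open>w\<close> in
  the commutant so that the vanishing spreads from \<open>k\<close> to the range of its cyclic
  projection \<open>q\<close>; then \<open>E q = 0\<close>, and faithfulness gives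
  \<open>q = 0\<close>.\<close>

lemma separating_core:
  assumes k: "\<And>v \<zeta> t Q n w. dilates v \<zeta> t Q \<Longrightarrow> w \<in> commutant B \<Longrightarrow>
    app (Q * t * Q * t) (single_l2 n (app w k)) = 0"
  shows "k = 0"
proof -
  obtain q where q: "q \<in> B" "projection q"
    "range (app q) = cspan_closure {app w k | w. w \<in> commutant B}" "app q k = k"
    by (rule cyclic_projection[OF vN_B])
  have E0: "inner v (app (E q) v) = 0" for v
  proof -
    obtain \<zeta> t Q where dil: "dilates v \<zeta> t Q" using dilates_exists by blast
    have "app (Q * t * Q * t) (single_l2 n (app q x)) = 0" for n x
    proof -
      have "bounded_clinear (\<lambda>x. app (Q * t * Q * t) (single_l2 n x))"
        by (rule bounded_clinear_compose[OF bounded_clinear_app bounded_clinear_single_l2])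
      moreover have "closed_csubspace {0}" by (simp add: closed_csubspace_def subspace_def)
      ultimately have "closed_csubspace ((\<lambda>x. app (Q * t * Q * t) (single_l2 n x)) -` {0})"
        by (rule closed_csubspace_vimage)
      then have "cspan_closure {app w k | w. w \<in> commutant B} \<subseteq> (\<lambda>x. app (Q * t * Q * t) (single_l2 n x)) -` {0}"
        by (rule cspan_closure_minimal[rotated]) (use k[OF dil] in auto)
      then show ?thesis using q(3) by blast
    qed
    then have "Q * t * Q * t * amplify q = 0" by (rule annihilates_amplified)
    then show ?thesis by (rule annihilated_functional[OF dil q(1,2)])
  qed
  have pq: "pos (E q)" using E q(1) projection_pos[OF q(2)] by (simp add: fn_cond_exp_def)
  have "E q = 0" by (rule bop_eqI) (simp add: pos_form_zero[OF pq E0])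
  then have "q = 0" using E q(1) projection_pos[OF q(2)] by (simp add: fn_cond_exp_def)
  then show ?thesis using q(4) by simp
qed

text \<open>A sum type indexes both families: left summands stand for the degree-zero algebra, right
  summands for the group unitaries. Quasi-equivalence compares families with a common index.\<close>

definition cp_gen :: "'k bop + 'g \<Rightarrow> ('g, 'k) l2 bop" where
  "cp_gen = case_sum (cp_embed \<beta>) cp_translation"

definition B_gen :: "'k bop + 'g \<Rightarrow> 'k bop" where
  "B_gen = case_sum (\<lambda>b. b) u"

abbreviation gens :: "('k bop + 'g) set" where
  "gens \<equiv> Inl ` B0 \<union> range Inr"

section \<open>Intertwiners between \<open>K\<close> and \<open>l2(G, K)\<close>, and their
  separation properties\<close>

lemma \<beta>_bounded:
  assumes b: "b \<in> B0"
  obtains C where "\<And>g x. norm (app (\<beta> g b) x) \<le> C * norm x" "\<And>g x. norm (app (adj (\<beta> g b)) x) \<le> C * norm x"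
proof -
  have nu: "norm (app (u g) x) = norm x" for g x
  proof -
    have "app (adj (u g) * u g) x = x" using u_unitary[of g] by (simp add: unitary_def del: times_bop.rep_eq)
    then have "inner x x = inner (app (u g) x) (app (u g) x)"
      by (simp add: inner_adj_right flip: inner_adj_right[of x "u g"])
    then show ?thesis by (simp add: norm_eq_sqrt_inner)
  qed
  obtain C1 where C1: "C1 > 0" "\<And>x. norm (app b x) \<le> C1 * norm x" using bop_bounded by metis
  obtain C2 where C2: "C2 > 0" "\<And>x. norm (app (adj b) x) \<le> C2 * norm x" using bop_bounded by metis
  show ?thesis
  proof (rule that[of "C1 + C2"])
    fix g x
    show "norm (app (\<beta> g b) x) \<le> (C1 + C2) * norm x"
      using C1(2)[of "app (u (- g)) x"] C2(1) by (simp add: \<beta>[OF b] nu adj_u distrib_right add_increasing2)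
    show "norm (app (adj (\<beta> g b)) x) \<le> (C1 + C2) * norm x"
      using C2(2)[of "app (u (- g)) x"] C1(1) by (simp add: \<beta>[OF b] nu adj_u distrib_right add_increasing)
  qed
qed

lemma coord_cp_gen:
  assumes "b \<in> B0"
  shows "coord (app (cp_embed \<beta> b) f) g = app (\<beta> (- g) b) (coord f g)"
    and "coord (app (adj (cp_embed \<beta> b)) f) g = app (adj (\<beta> (- g) b)) (coord f g)"
proof -
  obtain C where C: "\<And>g x. norm (app (\<beta> g b) x) \<le> C * norm x" "\<And>g x. norm (app (adj (\<beta> g b)) x) \<le> C * norm x"
    by (rule \<beta>_bounded[OF assms]) (rule that)
  show "coord (app (cp_embed \<beta> b) f) g = app (\<beta> (- g) b) (coord f g)"
    using C(1) by (rule coord_cp_embed)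
  show "coord (app (adj (cp_embed \<beta> b)) f) g = app (adj (\<beta> (- g) b)) (coord f g)"
    by (rule coord_adj_cp_embed[where \<beta> = \<beta> and b = b, OF C])
qed

lemma u_\<beta>: "b \<in> B0 \<Longrightarrow> u (- g) * b = \<beta> (- g) b * u (- g)"
  and u_\<beta>_adj: "b \<in> B0 \<Longrightarrow> u (- g) * adj b = adj (\<beta> (- g) b) * u (- g)"
  by (simp_all add: \<beta> adj_u mult.assoc u_mult u_zero)

lemma intertwining_pairsI:
  assumes ap: "adjoint_pair W V"
    and b: "\<And>b x g. b \<in> B0 \<Longrightarrow> coord (W (app b x)) g = app (\<beta> (- g) b) (coord (W x) g)"
      "\<And>b x g. b \<in> B0 \<Longrightarrow> coord (W (app (adj b) x)) g = app (adj (\<beta> (- g) b)) (coord (W x) g)"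
    and h: "\<And>h x g. coord (W (app (u h) x)) g = coord (W x) (- h + g)"
  shows "(W, V) \<in> intertwining_pairs gens B_gen cp_gen"
proof -
  have "W (app b x) = app (cp_embed \<beta> b) (W x)" "W (app (adj b) x) = app (adj (cp_embed \<beta> b)) (W x)"
    if "b \<in> B0" for b x
    by (rule l2_eqI, simp add: b coord_cp_gen that)+
  moreover have "W (app (u h) x) = app (cp_translation h) (W x)" for h x
    by (rule l2_eqI) (simp add: h coord_cp_translation)
  ultimately show ?thesis using ap
    by (auto simp: intertwining_pairs_def B_gen_def cp_gen_def adj_u adj_cp_translation)
qed

text \<open>The map built from \<open>t Q t\<close> lands in vectors over \<open>G\<close> with
  values in the amplified space; fixing the coordinate \<open>n\<close>, and later the input
  position \<open>m\<close>, yields maps between the two spaces to be compared. The outer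
  \<open>t\<close> makes \<open>t Q t\<close> self-adjoint, so that the same product
  \<open>Q t Q t\<close> decides separation on either side.\<close>

lemma dilation_intertwiner:
  assumes dil: "dilates v \<zeta> t Q"
  obtains W :: "(nat, 'k) l2 \<Rightarrow> ('g, 'k) l2" where "bounded_clinear W"
    "\<And>y g. coord (W y) g = coord (app (t * Q * t * amplify (u (- g))) y) n"
    "\<And>m V. adjoint_pair (\<lambda>x. W (single_l2 m x)) V \<Longrightarrow>
      (\<lambda>x. W (single_l2 m x), V) \<in> intertwining_pairs gens B_gen cp_gen"
proof -
  obtain C where C: "C > 0" "\<And>x. norm (app t x) \<le> C * norm x" using bop_bounded by blast
  let ?F = "\<lambda>g y. coord (app (t * Q * t * amplify (u (- g))) y) n"
  obtain W where W: "bounded_clinear W" "\<And>y g. coord (W y) g = ?F g y"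
  proof (rule l2_map_exists[of ?F C])
    show "bounded_clinear (?F g)" for g
      by (rule bounded_clinear_compose[OF bounded_clinear_coord bounded_clinear_app])
    fix y and F :: "'g set" assume F: "finite F"
    have "(norm (?F g y))\<^sup>2 \<le> C\<^sup>2 * (norm (app (Q * t * amplify (u (- g))) y))\<^sup>2" for g
    proof -
      have "norm (?F g y) \<le> C * norm (app (Q * t * amplify (u (- g))) y)"
        using C(2) by (intro order_trans[OF l2_coord_le]) (simp add: mult.assoc)
      then have "(norm (?F g y))\<^sup>2 \<le> (C * norm (app (Q * t * amplify (u (- g))) y))\<^sup>2"
        by (intro power_mono) auto
      then show ?thesis by (simp add: power_mult_distrib)
    qed
    then have "(\<Sum>g\<in>F. (norm (?F g y))\<^sup>2) \<le> C\<^sup>2 * (\<Sum>g\<in>F. (norm (app (Q * t * amplify (u (- g))) y))\<^sup>2)"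
      unfolding sum_distrib_left by (intro sum_mono)
    also have "\<dots> \<le> C\<^sup>2 * (norm y)\<^sup>2"
      by (intro mult_left_mono graded_Bessel[OF dil F]) simp
    finally show "(\<Sum>g\<in>F. (norm (?F g y))\<^sup>2) \<le> (C * norm y)\<^sup>2" by (simp add: power_mult_distrib)
  qed (rule that)
  let ?R = "t * Q * t"
  have comm: "?R * amplify x = amplify x * ?R" if x: "x \<in> normal_hull (gen 0)" for x
  proof -
    have "x \<in> B" using x hull_B by blast
    moreover have "app Q (app (amplify x) y) = app (amplify x) (app Q y)" for y
      using arg_cong[OF Q_commute[OF dil x], of "\<lambda>T. app T y"] by simp
    ultimately show ?thesis by (intro bop_eqI) (simp add: app_t_amplify[OF dil])
  qed
  have Radj: "adj ?R = ?R" using t_adj[OF dil] Q_adj[OF dil] by (simp add: mult.assoc)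
  have comm': "?R * amplify (adj x) = amplify (adj x) * ?R" if x: "x \<in> normal_hull (gen 0)" for x
    using arg_cong[OF comm[OF x], of adj]
    unfolding adj_mult[of ?R "amplify x"] adj_mult[of "amplify x" ?R] Radj amplify_adj by (rule sym)
  have "(\<lambda>x. W (single_l2 m x), V) \<in> intertwining_pairs gens B_gen cp_gen"
    if ap: "adjoint_pair (\<lambda>x. W (single_l2 m x)) V" for m V
  proof (rule intertwining_pairsI[OF ap])
    fix b x g assume b: "b \<in> B0"
    have "?R * amplify (u (- g)) * amplify b = amplify (\<beta> (- g) b) * (?R * amplify (u (- g)))"
    proof -
      have "?R * amplify (u (- g)) * amplify b = ?R * amplify (\<beta> (- g) b) * amplify (u (- g))"
        unfolding mult.assoc amplify_mult[symmetric] u_\<beta>[OF b] ..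
      then show ?thesis unfolding comm[OF \<beta>_hull[OF b]] by (simp only: mult.assoc)
    qed
    from arg_cong[OF this, of "\<lambda>T. coord (app T (single_l2 m x)) n"]
    show "coord (W (single_l2 m (app b x))) g = app (\<beta> (- g) b) (coord (W (single_l2 m x)) g)"
      by (simp add: W(2) amplify_single_l2)
    have "?R * amplify (u (- g)) * amplify (adj b) = amplify (adj (\<beta> (- g) b)) * (?R * amplify (u (- g)))"
    proof -
      have "?R * amplify (u (- g)) * amplify (adj b) = ?R * amplify (adj (\<beta> (- g) b)) * amplify (u (- g))"
        unfolding mult.assoc amplify_mult[symmetric] u_\<beta>_adj[OF b] ..
      then show ?thesis unfolding comm'[OF \<beta>_hull[OF b]] by (simp only: mult.assoc)
    qed
    from arg_cong[OF this, of "\<lambda>T. coord (app T (single_l2 m x)) n"]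
    show "coord (W (single_l2 m (app (adj b) x))) g = app (adj (\<beta> (- g) b)) (coord (W (single_l2 m x)) g)"
      by (simp add: W(2) amplify_single_l2)
  next
    fix h x g
    have "amplify (u (- g)) * amplify (u h) = (amplify (u (- (- h + g))) :: (nat, 'k) l2 bop)"
      by (simp add: u_mult minus_add flip: amplify_mult)
    from arg_cong[OF this, of "\<lambda>T. coord (app (?R * T) (single_l2 m x)) n"]
    show "coord (W (single_l2 m (app (u h) x))) g = coord (W (single_l2 m x)) (- h + g)"
      by (simp add: W(2) amplify_single_l2)
  qed
  then show ?thesis using that W by blast
qed

lemma intertwining_pairs_right:
  assumes "(W, V) \<in> intertwining_pairs gens B_gen cp_gen" and w: "w \<in> commutant B"
  shows "(\<lambda>x. W (app w x), \<lambda>y. app (adj w) (V y)) \<in> intertwining_pairs gens B_gen cp_gen"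
proof -
  have WV: "bounded_clinear W" "bounded_clinear V" "\<And>x y. inner (W x) y = inner x (V y)"
    using assms(1) by (auto simp: intertwining_pairs_def adjoint_pair_def)
  have gB: "B_gen i \<in> B" if "i \<in> gens" for i
    using that by (auto simp: B_gen_def intro: subsetD[OF hull_B u_hull] subsetD[OF hull_B subsetD[OF B0_hull]])
  have cB: "app w (app x y) = app x (app w y)" if "x \<in> B" for x y
    using commutantD[OF w that, THEN arg_cong[of _ _ "\<lambda>T. app T y"]] by simp
  have "adjoint_pair (\<lambda>x. W (app w x)) (\<lambda>y. app (adj w) (V y))"
    using WV by (simp add: adjoint_pair_def bounded_clinear_compose[OF _ bounded_clinear_app]
        bounded_clinear_compose[OF bounded_clinear_app] inner_adj_right)
  then show ?thesis using assms(1) cB[OF gB] cB[OF vN_adj[OF vN_B gB]]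
    unfolding intertwining_pairs_def by auto
qed

text \<open>A coordinatewise \<open>w\<close> from the commutant of \<open>B\<close> commutes with
  the embedded algebra because all \<open>\<beta> g b\<close> remain in \<open>B\<close>, and with
  translations because it acts equally on all coordinates.\<close>

lemma intertwining_pairs_left:
  assumes "(V, W) \<in> intertwining_pairs gens cp_gen B_gen" and w: "w \<in> commutant B"
  shows "(\<lambda>x. V (app (amplify w) x), \<lambda>y. app (amplify (adj w)) (W y)) \<in> intertwining_pairs gens cp_gen B_gen"
proof -
  have WV: "bounded_clinear W" "bounded_clinear V" "\<And>x y. inner (V x) y = inner x (W y)"
    using assms(1) by (auto simp: intertwining_pairs_def adjoint_pair_def)
  have ap: "adjoint_pair (\<lambda>x. V (app (amplify w) x)) (\<lambda>y. app (amplify (adj w)) (W y))"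
    using WV by (simp add: adjoint_pair_def bounded_clinear_compose[OF _ bounded_clinear_app]
        bounded_clinear_compose[OF bounded_clinear_app] inner_adj_right amplify_adj)
  have cB: "app w (app x y) = app x (app w y)" if "x \<in> B" for x y
    using commutantD[OF w that, THEN arg_cong[of _ _ "\<lambda>T. app T y"]] by simp
  have \<beta>B: "\<beta> g b \<in> B" if "b \<in> B0" for g b using \<beta>_hull[OF that] hull_B by blast
  have "app (amplify w) (app (cp_gen i) f) = app (cp_gen i) (app (amplify w) f) \<and>
      app (amplify w) (app (adj (cp_gen i)) f) = app (adj (cp_gen i)) (app (amplify w) f)" if "i \<in> gens" for i f
    using that
  proof
    assume "i \<in> Inl ` B0"
    then obtain b where b: "b \<in> B0" "i = Inl b" by blast
    show ?thesis
      by (intro conjI l2_eqI; simp add: b cp_gen_def coord_cp_gen cB[OF \<beta>B] cB[OF vN_adj[OF vN_B \<beta>B]])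
  next
    assume "i \<in> range Inr"
    then obtain h where h: "i = Inr h" by blast
    show ?thesis
      by (intro conjI l2_eqI; simp add: h cp_gen_def coord_cp_translation adj_cp_translation)
  qed
  then show ?thesis using assms(1) ap unfolding intertwining_pairs_def by simp
qed

lemma separating_B: "separating (intertwining_pairs gens B_gen cp_gen)"
  unfolding separating_def
proof (intro allI impI)
  fix k assume k: "\<forall>W V. (W, V) \<in> intertwining_pairs gens B_gen cp_gen \<longrightarrow> W k = 0"
  show "k = 0"
  proof (rule separating_core)
    fix v \<zeta> t Q m w assume dil: "dilates v \<zeta> t Q" and w: "w \<in> commutant B"
    have "app (t * Q * t) (single_l2 m (app w k)) = 0"
    proof (rule l2_eqI)
      fix n
      obtain W :: "(nat, 'k) l2 \<Rightarrow> ('g, 'k) l2" where W: "bounded_clinear W"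
        "\<And>y g. coord (W y) g = coord (app (t * Q * t * amplify (u (- g))) y) n"
        "\<And>m V. adjoint_pair (\<lambda>x. W (single_l2 m x)) V \<Longrightarrow>
          (\<lambda>x. W (single_l2 m x), V) \<in> intertwining_pairs gens B_gen cp_gen"
        by (rule dilation_intertwiner[OF dil]) (rule that)
      obtain V where "adjoint_pair (\<lambda>x. W (single_l2 m x)) V"
        using adjoint_exists[OF bounded_clinear_compose[OF W(1) bounded_clinear_single_l2]] by blast
      from intertwining_pairs_right[OF W(3)[OF this] w] k
      have "W (single_l2 m (app w k)) = 0" by blast
      \<comment> \<open>Only the coordinate at the neutral element is read off, where
        \<open>u 0 = 1\<close> leaves \<open>t Q t\<close> itself.\<close>
      from arg_cong[OF this, of "\<lambda>y. coord y 0"]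
      show "coord (app (t * Q * t) (single_l2 m (app w k))) n = coord 0 n"
        by (simp add: W(2) u_zero amplify_one)
    qed
    then show "app (Q * t * Q * t) (single_l2 m (app w k)) = 0"
      by (simp add: mult.assoc)
  qed
qed

text \<open>By graded orthogonality \<open>W\<close> sends \<open>u_h Q x\<close> to a vector
  supported at \<open>h\<close> alone. Pairing with it isolates the coordinate \<open>f h\<close>,
  and the adjoint \<open>Q t Q t\<close> appears.\<close>

lemma separating_cp: "separating (intertwining_pairs gens cp_gen B_gen)"
  unfolding separating_def
proof (intro allI impI)
  fix f assume f: "\<forall>V W. (V, W) \<in> intertwining_pairs gens cp_gen B_gen \<longrightarrow> V f = 0"
  show "f = 0"
  proof (rule l2_eqI)
    fix h
    have "coord f h = 0"
    proof (rule separating_core)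
      fix v \<zeta> t Q n w assume dil: "dilates v \<zeta> t Q" and w: "w \<in> commutant B"
      let ?f = "app (amplify w) f"
      obtain W :: "(nat, 'k) l2 \<Rightarrow> ('g, 'k) l2" where W: "bounded_clinear W"
        "\<And>y g. coord (W y) g = coord (app (t * Q * t * amplify (u (- g))) y) n"
        "\<And>m V. adjoint_pair (\<lambda>x. W (single_l2 m x)) V \<Longrightarrow>
          (\<lambda>x. W (single_l2 m x), V) \<in> intertwining_pairs gens B_gen cp_gen"
        by (rule dilation_intertwiner[OF dil]) (rule that)
      obtain V where V: "adjoint_pair W V" using adjoint_exists[OF W(1)] by blast
      \<comment> \<open>The intertwiners start from one position \<open>m\<close>, while
        \<open>W\<close> starts from the whole amplified space; the components of
        \<open>V ?f\<close> are the adjoints of these restrictions applied to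
        \<open>?f\<close>.\<close>
      have "inner (single_l2 m k) (V ?f) = 0" for m k
      proof -
        obtain V' where V': "adjoint_pair (\<lambda>x. W (single_l2 m x)) V'"
          using adjoint_exists[OF bounded_clinear_compose[OF W(1) bounded_clinear_single_l2]] by blast
        from intertwining_pairs_left[OF intertwining_pairs_swap[OF W(3)[OF this]] w] f
        have "V' ?f = 0" by blast
        then show ?thesis using V V' by (metis adjoint_pair_def inner_zero_right)
      qed
      then have Vf: "V ?f = 0" by (rule l2_zero_by_singles)
      have "inner (app (t * Q * t * Q) x) (single_l2 n (app w (coord f h))) = 0" for x
      proof -
        let ?y = "app (amplify (u h)) (app Q x)"
        have "W ?y = single_l2 h (coord (app (t * Q * t * Q) x) n)"
        proof (rule l2_eqI)
          fix g
          have "t * Q * t * amplify (u (- g)) * (amplify (u h) * Q) = t * (Q * t * amplify (u (- g + h)) * Q)"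
            by (simp add: mult.assoc amplify_mult flip: u_mult)
          also have "\<dots> = (if g = h then t * Q * t * Q else 0)"
            using graded_orthogonal[OF dil, of "- g + h"]
            by (auto simp: u_zero amplify_one mult.assoc neg_eq_iff_add_eq_0[symmetric])
          finally have "app (t * Q * t * amplify (u (- g)) * (amplify (u h) * Q)) x =
            app (if g = h then t * Q * t * Q else 0) x" by simp
          then show "coord (W ?y) g = coord (single_l2 h (coord (app (t * Q * t * Q) x) n)) g"
            by (simp add: W(2) single_l2.rep_eq split: if_splits)
        qed
        moreover have "inner (W ?y) ?f = 0"
          using V Vf by (simp add: adjoint_pair_def)
        ultimately have "inner (coord (app (t * Q * t * Q) x) n) (coord ?f h) = 0"
          by (simp add: inner_single_l2)
        then show ?thesis by (simp add: inner_commute[of _ "single_l2 _ _"] inner_single_l2 inner_commute)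
      qed
      then have z: "inner x (app (adj (t * Q * t * Q)) (single_l2 n (app w (coord f h)))) = 0" for x
        by (simp only: inner_adj_right)
      have "adj (t * Q * t * Q) = Q * t * Q * t"
        using t_adj[OF dil] Q_adj[OF dil] by (simp add: mult.assoc)
      then show "app (Q * t * Q * t) (single_l2 n (app w (coord f h))) = 0"
        using z[of "app (Q * t * Q * t) (single_l2 n (app w (coord f h)))"] by simp
    qed
    then show "coord f h = coord 0 h" by simp
  qed
qed

theorem crossed_product_iso:
  "\<exists>\<Theta>. star_iso (crossed_product B0 \<beta>) B \<Theta> \<and> (\<forall>b\<in>B0. \<Theta> (cp_embed \<beta> b) = b)"
proof -
  obtain \<Theta> where \<Theta>: "star_iso (vN_generated (cp_gen ` gens)) (vN_generated (B_gen ` gens)) \<Theta>"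
    "\<forall>i\<in>gens. \<Theta> (cp_gen i) = B_gen i"
    using quasi_equivalence[OF separating_cp separating_B] by blast
  have "cp_gen ` gens = cp_embed \<beta> ` B0 \<union> range cp_translation" "B_gen ` gens = B0 \<union> range u"
    unfolding image_Un by (simp_all add: cp_gen_def B_gen_def image_image)
  then have "star_iso (crossed_product B0 \<beta>) B \<Theta>"
    using \<Theta>(1) by (simp add: crossed_product_def generated_eq)
  moreover have "\<Theta> (cp_embed \<beta> b) = b" if "b \<in> B0" for b
    using \<Theta>(2)[THEN bspec, of "Inl b"] that by (simp add: cp_gen_def B_gen_def)
  ultimately show ?thesis by blast
qed

end

section \<open>Tensor products of operators\<close>

lemma cinner_add_right: "cinner x (y + z) = cinner x y + cinner x z"
  by (simp add: cinner_def inner_add_right complex_eq_iff)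

lemma cinner_scaleC_right: "cinner x (c *\<^sub>C y) = c * cinner x y"
proof -
  have "inner x (\<i> *\<^sub>C y) = - inner (\<i> *\<^sub>C x) y"
    using inner_ii[of x "\<i> *\<^sub>C y"] by simp
  then show ?thesis
    by (subst scaleC_eq) (simp add: cinner_def complex_eq_iff inner_add_right inner_ii algebra_simps)
qed

lemma cinner_cnj: "cinner y x = cnj (cinner x y)"
proof -
  have "inner x (\<i> *\<^sub>C y) = - inner (\<i> *\<^sub>C x) y"
    using inner_ii[of x "\<i> *\<^sub>C y"] by simp
  then show ?thesis by (simp add: cinner_def complex_eq_iff inner_commute)
qed

lemma cinner_scaleC_left: "cinner (c *\<^sub>C x) y = cnj c * cinner x y"
  by (metis cinner_cnj cinner_scaleC_right complex_cnj_mult)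

lemma cinner_self: "cinner x x = complex_of_real ((norm x)\<^sup>2)"
  using arg_cong[OF cinner_cnj[of x x], of Im]
  by (simp add: complex_eq_iff Re_cinner power2_norm_eq_inner)

context
  fixes t :: "'h::chilbert_space \<Rightarrow> 'p::chilbert_space \<Rightarrow> 't::chilbert_space"
  assumes ht: "hilbert_tensor t"
begin

lemma cinner_tensor: "cinner (t x y) (t x' y') = cinner x x' * cinner y y'"
  using ht by (simp add: hilbert_tensor_def)

lemma tensor_dense: "cspan_closure {t x y | x y. True} = UNIV"
proof -
  let ?X = "{t x y | x y. True}"
  have "?X \<subseteq> {c *\<^sub>C x | c x. x \<in> ?X}"
  proof
    fix z assume "z \<in> ?X"
    then have "1 *\<^sub>C z \<in> {c *\<^sub>C x | c x. x \<in> ?X}" by blast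
    then show "z \<in> {c *\<^sub>C x | c x. x \<in> ?X}" by (simp only: scaleC_one)
  qed
  then have "closure (span ?X) \<subseteq> cspan_closure ?X"
    unfolding cspan_closure_def by (intro closure_mono span_mono)
  then show ?thesis using ht by (auto simp: hilbert_tensor_def)
qed

lemma tensor_eqI:
  assumes "\<And>a b. cinner (t a b) v = cinner (t a b) w"
  shows "v = w"
proof -
  have "inner (c *\<^sub>C z) (v - w) = 0" if "z \<in> {t x y | x y. True}" for c z
  proof -
    have "cinner (c *\<^sub>C z) v = cinner (c *\<^sub>C z) w" using that assms by (auto simp: cinner_scaleC_left)
    then have "inner (c *\<^sub>C z) v = inner (c *\<^sub>C z) w" by (simp only: Re_cinner[symmetric])
    then show ?thesis by (simp add: inner_diff_right)
  qed
  from orthogonal_cspan_closure[where X = "{t x y | x y. True}" and z = "v - w", OF this]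
  show ?thesis unfolding tensor_dense by simp
qed

lemma norm_tensor: "norm (t x y) = norm x * norm y"
proof -
  have "complex_of_real ((norm (t x y))\<^sup>2) = complex_of_real ((norm x * norm y)\<^sup>2)"
    unfolding cinner_self[symmetric] cinner_tensor power_mult_distrib of_real_mult ..
  then show ?thesis by (simp only: of_real_eq_iff) (simp add: power2_eq_iff_nonneg)
qed

text \<open>Linearity is a consequence of the inner product formula, tested against the total set of
  elementary tensors.\<close>

lemma bounded_clinear_tensor_left: "bounded_clinear (\<lambda>x. t x y)"
proof -
  have scale: "t (c *\<^sub>C x) y = c *\<^sub>C t x y" for c x
    by (rule tensor_eqI) (simp add: cinner_tensor cinner_scaleC_right)
  have add: "t (x + x') y = t x y + t x' y" for x x'
    by (rule tensor_eqI) (simp add: cinner_tensor cinner_add_right algebra_simps)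
  show ?thesis unfolding bounded_clinear_def
  proof (intro conjI allI scale bounded_linear_intro[where K = "norm y"] add)
    show "t (r *\<^sub>R x) y = r *\<^sub>R t x y" for r x
      using scale[of "complex_of_real r" x] by (simp only: scaleC_of_real)
    show "norm (t x y) \<le> norm x * norm y" for x by (simp add: norm_tensor)
  qed
qed

text \<open>The operator \<open>S\<close> tensor 1, with its boundedness, comes from the extension
  theorem for the maps \<open>x \<mapsto> t x y\<close>: the compositions \<open>W V'\<close> are
  scalars, so they commute with any \<open>S\<close>.\<close>

lemma tensor_left_exists: "\<exists>U. \<forall>x y. app U (t x y) = t (app S x) y"
proof -
  define VV where "VV = {(\<lambda>x. t x y, W) | y W. adjoint_pair (\<lambda>x. t x y) W}"
  have WV: "W (t h y') = cnj (cinner y' y) *\<^sub>C h" if "adjoint_pair (\<lambda>x. t x y) W" for y y' W h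
  proof (rule eq_by_inner)
    fix k
    have "inner (W (t h y')) k = inner (t h y') (t k y)"
      using that by (metis adjoint_pair_def inner_commute)
    also have "\<dots> = inner (cnj (cinner y' y) *\<^sub>C h) k"
      by (simp add: Re_cinner[symmetric] cinner_tensor cinner_scaleC_left mult.commute)
    finally show "inner (W (t h y')) k = inner (cnj (cinner y' y) *\<^sub>C h) k" .
  qed
  have "{V h | V W h. (V, W) \<in> VV} = {t x y | x y. True}"
  proof -
    have "t x y \<in> {V h | V W h. (V, W) \<in> VV}" for x y
    proof -
      obtain W where "adjoint_pair (\<lambda>x. t x y) W"
        using adjoint_exists[OF bounded_clinear_tensor_left] by blast
      then have "(\<lambda>x. t x y, W) \<in> VV" unfolding VV_def by blast
      then show ?thesis unfolding mem_Collect_eq by (intro exI[of _ "\<lambda>x. t x y"] exI[of _ W] exI[of _ x]) simp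
    qed
    then show ?thesis by (auto simp: VV_def)
  qed
  then have dense: "cspan_closure {V h | V W h. (V, W) \<in> VV} = UNIV" using tensor_dense by simp
  have "\<exists>U. \<forall>V W h. (V, W) \<in> VV \<longrightarrow> app U (V h) = V (app S h)"
    by (rule intertwining_extension[OF _ _ dense]) (auto simp: VV_def WV)
  then obtain U where U: "\<And>V W h. (V, W) \<in> VV \<Longrightarrow> app U (V h) = V (app S h)" by blast
  have "app U (t x y) = t (app S x) y" for x y
  proof -
    obtain W where "adjoint_pair (\<lambda>x. t x y) W" using adjoint_exists[OF bounded_clinear_tensor_left] by blast
    then have "(\<lambda>x. t x y, W) \<in> VV" by (auto simp: VV_def)
    from U[OF this] show ?thesis .
  qed
  then show ?thesis by blast
qed

end

lemma hilbert_tensor_swap: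
  assumes "hilbert_tensor t"
  shows "hilbert_tensor (\<lambda>y x. t x y)"
proof -
  have "{t x y | y x. True} = {t x y | x y. True}" by blast
  then show ?thesis using assms by (simp add: hilbert_tensor_def mult.commute)
qed

text \<open>Existence comes from the product of \<open>S\<close> tensor 1 and 1 tensor
  \<open>T\<close>, uniqueness from density; together they evaluate the definite
  description.\<close>

lemma app_tensor_op:
  assumes ht: "hilbert_tensor t"
  shows "app (tensor_op t S T) (t x y) = t (app S x) (app T y)"
proof -
  obtain U1 where U1: "\<And>x y. app U1 (t x y) = t (app S x) y"
    using tensor_left_exists[OF ht] by blast
  obtain U2 where U2: "\<And>x y. app U2 (t x y) = t x (app T y)"
    using tensor_left_exists[OF hilbert_tensor_swap[OF ht]] by blast
  have U: "\<forall>x y. app (U1 * U2) (t x y) = t (app S x) (app T y)" by (simp add: U1 U2)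
  have "\<exists>!U. \<forall>x y. app U (t x y) = t (app S x) (app T y)"
  proof (rule ex1I[of _ "U1 * U2"], rule U)
    fix U' assume "\<forall>x y. app U' (t x y) = t (app S x) (app T y)"
    with U show "U' = U1 * U2" by (intro bop_eq_on_dense[OF tensor_dense[OF ht]]) auto
  qed
  from theI'[OF this] show ?thesis unfolding tensor_op_def by blast
qed

lemma tensor_op_eqI:
  assumes ht: "hilbert_tensor t" and U: "\<And>x y. app U (t x y) = t (app S x) (app T y)"
  shows "tensor_op t S T = U"
  by (rule bop_eq_on_dense[OF tensor_dense[OF ht]]) (auto simp: app_tensor_op[OF ht] U)

lemma tensor_op_mult:
  "hilbert_tensor t \<Longrightarrow> tensor_op t (S * S') (T * T') = tensor_op t S T * tensor_op t S' T'"
  by (rule tensor_op_eqI) (simp_all add: app_tensor_op)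

lemma tensor_op_one: "hilbert_tensor t \<Longrightarrow> tensor_op t 1 1 = 1"
  by (rule tensor_op_eqI) simp_all

lemma tensor_op_sum:
  assumes ht: "hilbert_tensor t"
  shows "tensor_op t (\<Sum>i\<in>F. S i) T = (\<Sum>i\<in>F. tensor_op t (S i) T)"
  by (rule tensor_op_eqI[OF ht])
    (simp add: app_sum app_tensor_op[OF ht] bounded_clinear_sum[OF bounded_clinear_tensor_left[OF ht]])

section \<open>Complete reducibility\<close>

lemma amplify_pow: "amplify (X ^ n) = amplify X ^ n"
  by (induction n) (simp_all add: amplify_one amplify_mult)

lemma pos_amplify:
  assumes "pos X"
  shows "pos (amplify X)"
  using assms unfolding pos_iff
  by (auto simp: inner_l2_def intro!: infsum_nonneg simp flip: amplify_adj)

lemma adj_pow: "adj X = X \<Longrightarrow> adj (X ^ n) = X ^ n"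
  by (induction n) (simp_all add: power_commutes)

text \<open>The scalars \<open>a\<^sub>m = \<langle>X\<^sup>m y, y\<rangle>\<close> decrease, so
  \<open>\<parallel>X\<^sup>n y - X\<^sup>n\<^sup>+\<^sup>1 y\<parallel>\<^sup>2 = a\<^bsub>2n\<^esub> - 2 a\<^bsub>2n+1\<^esub> + a\<^bsub>2n+2\<^esub>\<close> tends to \<open>0\<close>.\<close>

lemma positive_contraction_powers:
  assumes X: "pos X" "pos (1 - X)" and inj: "\<And>y. app X y = y \<Longrightarrow> y = 0"
  shows "(\<lambda>n. app (X ^ n) y) \<longlonglongrightarrow> 0"
proof -
  have sa: "adj X = X" and nn: "\<And>z. 0 \<le> inner z (app X z)" using X(1) by (auto simp: pos_iff)
  have le: "inner z (app X z) \<le> inner z z" for z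
    using X(2) by (auto simp: pos_iff inner_diff_right)
  have sq: "inner (app X z) (app X z) \<le> inner z (app X z)" for z
  proof -
    let ?s = "inner (app X z) (app X z)"
    have "?s\<^sup>2 \<le> inner (app X z) (app X (app X z)) * inner z (app X z)"
      by (rule pos_Cauchy_Schwarz[OF X(1)])
    also have "\<dots> \<le> ?s * inner z (app X z)" by (intro mult_right_mono le nn)
    finally show ?thesis using nn[of z] by (cases "?s = 0") (auto simp: power2_eq_square)
  qed
  have contr: "norm (app X z) \<le> norm z" for z
    using sq[of z] le[of z] by (simp add: norm_le)
  have contr_n: "norm (app (X ^ n) z) \<le> norm z" for n z
    by (induction n) (use contr order_trans in auto)
  have Xcomm: "app (X ^ n) (app X z) = app X (app (X ^ n) z)" for n z
    using power_commutes[of X n] by (metis times_bop.rep_eq)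
  have main: "(\<lambda>n. app (X ^ n) (z - app X z)) \<longlonglongrightarrow> 0" for z
  proof -
    \<comment> \<open>In the notation above, \<open>a n\<close> and \<open>b n\<close> are the
      scalars with indices \<open>2n\<close> and \<open>2n + 1\<close>; the interlacing makes them
      converge to one limit.\<close>
    define a where "a = (\<lambda>n. inner (app (X ^ n) z) (app (X ^ n) z))"
    define b where "b = (\<lambda>n. inner (app (X ^ n) z) (app X (app (X ^ n) z)))"
    have ab: "b n \<le> a n" "a (Suc n) \<le> b n" for n
      using le[of "app (X ^ n) z"] sq[of "app (X ^ n) z"] by (simp_all add: a_def b_def)
    have "decseq a" by (intro decseq_SucI) (use ab order_trans in blast)
    moreover have "0 \<le> a n" for n by (simp add: a_def)
    ultimately obtain l where l: "a \<longlonglongrightarrow> l" using decseq_convergent by blast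
    have l': "(\<lambda>n. a (Suc n)) \<longlonglongrightarrow> l" using l by (rule LIMSEQ_Suc)
    have lb: "b \<longlonglongrightarrow> l"
      by (rule tendsto_sandwich[OF _ _ l' l]) (use ab in auto)
    have eq: "(norm (app (X ^ n) (z - app X z)))\<^sup>2 = a n - 2 * b n + a (Suc n)" for n
      unfolding power2_norm_eq_inner a_def b_def
      by (simp add: Xcomm inner_diff_left inner_diff_right inner_commute)
    have "(\<lambda>n. a n - 2 * b n + a (Suc n)) \<longlonglongrightarrow> l - 2 * l + l" by (intro tendsto_intros l lb l')
    then have "(\<lambda>n. (norm (app (X ^ n) (z - app X z)))\<^sup>2) \<longlonglongrightarrow> 0" unfolding eq by simp
    then have "(\<lambda>n. sqrt ((norm (app (X ^ n) (z - app X z)))\<^sup>2)) \<longlonglongrightarrow> sqrt 0"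
      by (rule tendsto_real_sqrt)
    then show ?thesis by (simp add: tendsto_norm_zero_iff)
  qed
  \<comment> \<open>Injectivity of the self-adjoint operator \<open>1 - X\<close> makes its range
    dense, and since all powers of \<open>X\<close> are contractions, convergence on this range
    extends to every vector.\<close>
  let ?R = "range (app (1 - X))"
  have sub: "subspace ?R"
    using bounded_linear_app[of "1 - X"] by (intro linear_subspace_image) (auto simp: bounded_linear.linear)
  have sc: "c *\<^sub>C v \<in> ?R" if "v \<in> ?R" for c v
    using that by (metis app_scaleC imageE rangeI)
  have "cspan_closure ?R = UNIV"
  proof (rule cspan_closure_UNIV)
    fix v assume v: "\<And>x c. x \<in> ?R \<Longrightarrow> inner (c *\<^sub>C x) v = 0"
    have "inner w (app (1 - X) v) = 0" for w
    proof -
      have "inner (1 *\<^sub>C app (1 - X) w) v = 0" by (rule v) blast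
      moreover have "adj (1 - X) = 1 - X" using sa by simp
      ultimately show ?thesis using inner_adj_left[of "1 - X" w v] by simp
    qed
    from this[of "app (1 - X) v"] have "app X v = v" by simp
    then show "v = 0" by (rule inj)
  qed
  then have dense: "closure ?R = UNIV" using closure_csubspace[OF sub sc] by simp
  show ?thesis
  proof (rule LIMSEQ_I)
    fix e :: real assume e: "e > 0"
    have "y \<in> closure ?R" using dense by simp
    then obtain z where z: "dist (app (1 - X) z) y < e / 2"
      using e unfolding closure_approachable by (metis half_gt_zero imageE)
    obtain N where N: "\<And>n. n \<ge> N \<Longrightarrow> norm (app (X ^ n) (z - app X z)) < e / 2"
      using LIMSEQ_D[OF main, of "e / 2" z] e by auto
    have "norm (app (X ^ n) y - 0) < e" if "n \<ge> N" for n
    proof -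
      have "app (X ^ n) y = app (X ^ n) (z - app X z) - app (X ^ n) (app (1 - X) z - y)" by simp
      then have "norm (app (X ^ n) y) \<le> norm (app (X ^ n) (z - app X z)) + norm (app (X ^ n) (app (1 - X) z - y))"
        by (metis norm_triangle_ineq4)
      also have "\<dots> < e / 2 + e / 2"
        using N[OF that] contr_n[of n "app (1 - X) z - y"] z by (intro add_strict_mono) (auto simp: dist_norm)
      finally show ?thesis by simp
    qed
    then show "\<exists>N. \<forall>n\<ge>N. norm (app (X ^ n) y - 0) < e" by blast
  qed
qed

section \<open>Intertwiner spaces and the Pimsner-Popa functional\<close>

lemma End_vN_star:
  assumes "\<sigma> \<in> End_vN M"
  shows "star_hom M M \<sigma>" "x \<in> M \<Longrightarrow> \<sigma> x \<in> M" "\<sigma> 1 = 1" "x \<in> M \<Longrightarrow> \<sigma> (adj x) = adj (\<sigma> x)"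
    "x \<in> M \<Longrightarrow> y \<in> M \<Longrightarrow> \<sigma> (x * y) = \<sigma> x * \<sigma> y" "x \<in> M \<Longrightarrow> \<sigma> (c *\<^sub>C x) = c *\<^sub>C \<sigma> x"
  using assms by (auto simp: End_vN_def star_hom_def)

lemma intertwiners_mult:
  assumes "vN_algebra M" "S \<in> intertwiners M \<sigma> \<tau>" "T \<in> intertwiners M \<rho> \<sigma>"
  shows "S * T \<in> intertwiners M \<rho> \<tau>"
proof -
  have "S * T * \<rho> x = \<tau> x * (S * T)" if "x \<in> M" for x
  proof -
    have "S * T * \<rho> x = S * (\<sigma> x * T)" using assms(3) that by (simp add: intertwiners_def mult.assoc)
    also have "\<dots> = \<tau> x * (S * T)" using assms(2) that by (simp add: intertwiners_def flip: mult.assoc)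
    finally show ?thesis .
  qed
  then show ?thesis using assms vN_mult[OF assms(1)] by (simp add: intertwiners_def)
qed

lemma intertwiners_adj:
  assumes M: "vN_algebra M" and \<rho>: "\<rho> \<in> End_vN M" and \<sigma>: "\<sigma> \<in> End_vN M"
    and T: "T \<in> intertwiners M \<rho> \<sigma>"
  shows "adj T \<in> intertwiners M \<sigma> \<rho>"
proof -
  have "adj T * \<sigma> x = \<rho> x * adj T" if "x \<in> M" for x
  proof -
    have "T * \<rho> (adj x) = \<sigma> (adj x) * T" using T vN_adj[OF M that] by (simp add: intertwiners_def)
    from arg_cong[OF this, of adj] show ?thesis
      using End_vN_star(4)[OF \<rho> that] End_vN_star(4)[OF \<sigma> that] by simp
  qed
  then show ?thesis using T vN_adj[OF M] by (simp add: intertwiners_def)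
qed

lemma
  assumes M: "vN_algebra M"
  shows intertwiners_add: "S \<in> intertwiners M \<rho> \<sigma> \<Longrightarrow> T \<in> intertwiners M \<rho> \<sigma> \<Longrightarrow> S + T \<in> intertwiners M \<rho> \<sigma>"
    and intertwiners_diff: "S \<in> intertwiners M \<rho> \<sigma> \<Longrightarrow> T \<in> intertwiners M \<rho> \<sigma> \<Longrightarrow> S - T \<in> intertwiners M \<rho> \<sigma>"
    and intertwiners_scaleC: "S \<in> intertwiners M \<rho> \<sigma> \<Longrightarrow> c *\<^sub>C S \<in> intertwiners M \<rho> \<sigma>"
    and intertwiners_one: "1 \<in> intertwiners M \<rho> \<rho>"
  using vN_add[OF M] vN_diff[OF M] vN_scaleC[OF M] vN_one[OF M]
  by (simp_all add: intertwiners_def distrib_left distrib_right left_diff_distrib right_diff_distrib)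

lemma intertwiners_pow:
  "vN_algebra M \<Longrightarrow> S \<in> intertwiners M \<rho> \<rho> \<Longrightarrow> S ^ n \<in> intertwiners M \<rho> \<rho>"
  by (induction n) (auto intro: intertwiners_mult intertwiners_one)

text \<open>\<open>R \<sigma> * x\<close> is \<open>cj \<sigma> (\<sigma> x) * R \<sigma>\<close>,
  so it depends on \<open>\<sigma> x\<close> only, and \<open>adj (R \<sigma>)\<close> recovers a
  multiple of \<open>x\<close>. The multiple is nonzero, for otherwise \<open>R \<sigma>\<close>
  would vanish, against the conjugate equation.\<close>

lemma endo_injective:
  assumes M: "type_III_factor M" and cs: "conjugate_solutions M cj R R'" and \<sigma>: "\<sigma> \<in> End_fin M"
  shows "inj_on \<sigma> M"
proof (rule inj_onI)
  fix x y assume xy: "x \<in> M" "y \<in> M" "\<sigma> x = \<sigma> y"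
  let ?d = "complex_of_real (dimension M \<sigma>)"
  have R: "R \<sigma> \<in> intertwiners M (id_endo M) (compose M (cj \<sigma>) \<sigma>)"
    and RR: "adj (R \<sigma>) * R \<sigma> = ?d *\<^sub>C 1" and RR': "adj (R \<sigma>) * cj \<sigma> (R' \<sigma>) = 1"
    using cs \<sigma> by (auto simp: conjugate_solutions_def)
  have "R \<sigma> * x = R \<sigma> * y"
    using R xy unfolding intertwiners_def by (simp add: compose_def)
  then have "adj (R \<sigma>) * R \<sigma> * x = adj (R \<sigma>) * R \<sigma> * y" by (simp add: mult.assoc)
  then have eq: "?d *\<^sub>C x = ?d *\<^sub>C y" by (simp add: RR)
  have "?d \<noteq> 0"
  proof
    assume "?d = 0"
    then have "adj (R \<sigma>) * R \<sigma> = 0" unfolding RR by (intro bop_eqI) simp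
    then have "R \<sigma> = 0" by (rule adj_mult_self_eq_0)
    then have "(1 :: 'a bop) = 0" using RR' by simp
    then show False using M by (simp add: type_III_factor_def)
  qed
  then have "inverse ?d *\<^sub>C ?d *\<^sub>C z = z" for z :: "'a bop"
    by (intro bop_eqI) (simp add: scaleC_scaleC)
  then show "x = y" using eq by metis
qed

text \<open>The Pimsner-Popa inequality for relative commutants: the conditional expectation maps
  \<open>(\<sigma>, \<sigma>)\<close> to the scalars and thus becomes a normal functional.\<close>

lemma index_functional:
  fixes M :: "'h::chilbert_space bop set"
  assumes M: "type_III_factor M" and cs: "conjugate_solutions M cj R R'" and \<sigma>: "\<sigma> \<in> End_fin M"
  shows "\<exists>c>0. \<exists>\<phi> :: 'h bop \<Rightarrow> real. (\<forall>x\<in>M. \<forall>y\<in>M. \<phi> (x + y) = \<phi> x + \<phi> y) \<and> \<phi> 1 = 1 \<and>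
    (\<exists>\<xi> \<eta> :: (nat, 'h) l2. \<forall>x\<in>M. \<phi> x = inner \<xi> (app (amplify x) \<eta>)) \<and>
    (\<forall>x\<in>intertwiners M \<sigma> \<sigma>. pos x \<longrightarrow> (\<forall>v. c * inner v (app x v) \<le> \<phi> x * inner v v))"
proof -
  have vM: "vN_algebra M" and center: "M \<inter> commutant M = {c *\<^sub>C 1 | c. True}"
    and one_ne: "(1 :: 'h bop) \<noteq> 0"
    using M by (auto simp: type_III_factor_def)
  have \<sigma>': "\<sigma> \<in> End_vN M" using \<sigma> by (simp add: End_fin_def)
  obtain c \<epsilon> where c: "0 < c" and \<epsilon>: "fn_cond_exp M (\<sigma> ` M) \<epsilon>"
    and bound: "\<And>x. x \<in> M \<Longrightarrow> pos x \<Longrightarrow> pos (\<epsilon> x - complex_of_real c *\<^sub>C x)"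
    using \<sigma> unfolding End_fin_def index_bounds_def by auto
  have add: "\<epsilon> (x + y) = \<epsilon> x + \<epsilon> y" if "x \<in> M" "y \<in> M" for x y
    using \<epsilon> that by (simp add: fn_cond_exp_def)
  have scale: "\<epsilon> (d *\<^sub>C x) = d *\<^sub>C \<epsilon> x" if "x \<in> M" for x d
    using \<epsilon> that by (simp add: fn_cond_exp_def)
  have bimod: "\<epsilon> (a * x * b) = a * \<epsilon> x * b" if "x \<in> M" "a \<in> \<sigma> ` M" "b \<in> \<sigma> ` M" for x a b
    using \<epsilon> that unfolding fn_cond_exp_def by blast
  have one\<sigma>: "1 \<in> \<sigma> ` M" using End_vN_star(3)[OF \<sigma>'] vN_one[OF vM] by force
  have "\<forall>a\<in>\<sigma> ` M. \<epsilon> a = a" using \<epsilon> unfolding fn_cond_exp_def by (elim conjE)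
  then have \<epsilon>1: "\<epsilon> 1 = 1" using one\<sigma> by blast
  have normal: "normal_map M (\<sigma> ` M) \<epsilon>" using \<epsilon> by (simp add: fn_cond_exp_def)
  have ran: "\<epsilon> x \<in> \<sigma> ` M" if "x \<in> M" for x
    using normal that unfolding normal_map_def by (auto simp: continuous_map_def)
  have scalar: "\<exists>z. \<epsilon> x = z *\<^sub>C 1" if x: "x \<in> intertwiners M \<sigma> \<sigma>" for x
  proof -
    have xM: "x \<in> M" using x by (simp add: intertwiners_def)
    obtain m where m: "m \<in> M" "\<epsilon> x = \<sigma> m" using ran[OF xM] by blast
    \<comment> \<open>The bimodule property carries commutation with \<open>\<sigma> y\<close> from
      \<open>x\<close> to \<open>\<epsilon> x = \<sigma> m\<close>; injectivity of
      \<open>\<sigma>\<close> brings it down to \<open>m\<close>, which is therefore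
      central.\<close>
    have "m * y = y * m" if y: "y \<in> M" for y
    proof -
      have "\<epsilon> x * \<sigma> y = \<epsilon> (1 * x * \<sigma> y)" using bimod[OF xM one\<sigma>, of "\<sigma> y"] y by simp
      also have "1 * x * \<sigma> y = \<sigma> y * x * 1" using x y by (simp add: intertwiners_def)
      also have "\<epsilon> \<dots> = \<sigma> y * \<epsilon> x" using bimod[OF xM _ one\<sigma>, of "\<sigma> y"] y by simp
      finally have "\<sigma> (m * y) = \<sigma> (y * m)" using m y by (simp add: End_vN_star(5)[OF \<sigma>'])
      then show ?thesis
        using inj_onD[OF endo_injective[OF M cs \<sigma>]] vN_mult[OF vM] m y by blast
    qed
    then have "m \<in> M \<inter> commutant M" using m by (auto intro: commutantI)
    then obtain z where "m = z *\<^sub>C 1" using center by blast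
    then have "\<epsilon> x = z *\<^sub>C 1"
      using m End_vN_star(6)[OF \<sigma>' vN_one[OF vM]] End_vN_star(3)[OF \<sigma>'] by simp
    then show ?thesis by blast
  qed
  obtain w where "app (1 :: 'h bop) w \<noteq> app 0 w" using one_ne bop_eqI by blast
  then have w: "w \<noteq> 0" by simp
  define k where "k = inverse (norm w) *\<^sub>R w"
  have k: "inner k k = 1" using w by (simp add: k_def power2_norm_eq_inner[symmetric] power2_eq_square field_simps)
  \<comment> \<open>On \<open>(\<sigma>, \<sigma>)\<close> the expectation is scalar, so one unit
    vector captures it completely, and normality of \<open>\<epsilon>\<close> makes the evaluation
    normal on all of \<open>M\<close>.\<close>
  define \<phi> where "\<phi> = (\<lambda>x. inner k (app (\<epsilon> x) k))"
  have "c * inner v (app x v) \<le> \<phi> x * inner v v" if x: "x \<in> intertwiners M \<sigma> \<sigma>" "pos x" for x v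
  proof -
    obtain z where z: "\<epsilon> x = z *\<^sub>C 1" using scalar[OF x(1)] by blast
    have p: "pos (\<epsilon> x - complex_of_real c *\<^sub>C x)" using bound x by (simp add: intertwiners_def)
    have "pos (\<epsilon> x)" using \<epsilon> x by (simp add: fn_cond_exp_def intertwiners_def)
    then have sa: "adj (\<epsilon> x) = \<epsilon> x" by (simp add: pos_iff)
    then have "cnj z *\<^sub>C k = z *\<^sub>C k" unfolding z by (metis adj_one adj_scaleC one_bop.rep_eq scaleC_bop.rep_eq)
    then have "(cnj z - z) *\<^sub>C k = 0"
      by (metis diff_add_cancel scaleC_add_left add_cancel_left_left)
    then have "cnj z - z = 0" using k by (metis inner_zero_left norm_scaleC norm_eq_zero mult_eq_0_iff zero_neq_one)
    then obtain r where r: "z = complex_of_real r" by (metis Reals_cases Reals_cnj_iff right_minus_eq)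
    have "\<phi> x = r" unfolding \<phi>_def z r by (simp add: scaleC_of_real k)
    moreover have "0 \<le> inner v (app (\<epsilon> x - complex_of_real c *\<^sub>C x) v)" using p by (simp add: pos_iff)
    ultimately show ?thesis unfolding z r by (simp add: scaleC_of_real inner_diff_right)
  qed
  moreover have "\<exists>\<xi> \<eta> :: (nat, 'h) l2. \<forall>x\<in>M. \<phi> x = inner \<xi> (app (amplify x) \<eta>)"
    unfolding \<phi>_def
    by (rule normal_map_functional[OF normal vN_add[OF vM] vN_scaleC[OF vM] add scale])
  moreover have "\<phi> 1 = 1" by (simp add: \<phi>_def \<epsilon>1 k)
  moreover have "\<phi> (x + y) = \<phi> x + \<phi> y" if "x \<in> M" "y \<in> M" for x y
    by (simp add: \<phi>_def add[OF that] inner_add_right)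
  ultimately show ?thesis using c by blast
qed

lemma projection_norm_eigen:
  assumes "projection p" "p \<noteq> 0"
  obtains v where "inner v v = 1" "app p v = v"
proof -
  obtain w where w: "app p w \<noteq> app 0 w" using assms(2) bop_eqI by blast
  let ?w = "app p w"
  have "app p ?w = ?w" using assms(1) by (metis projection_def times_bop.rep_eq)
  then show ?thesis using w
    by (intro that[of "inverse (norm ?w) *\<^sub>R ?w"])
      (auto simp: power2_norm_eq_inner[symmetric] power2_eq_square field_simps)
qed

text \<open>\<open>S\<close> is \<open>T\<close> shifted by the bottom \<open>m\<close> of its
  numerical range. If \<open>S\<close> were nonzero, near-minimal vectors, almost fixed by the
  powers of \<open>X = 1 - S / D\<close>, would keep \<open>\<phi> (X ^ n * X ^ n)\<close> above
  \<open>c / 4\<close>, whereas triviality of the kernel of \<open>S\<close> sends these numbers to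
  0.\<close>

lemma self_adjoint_scalar:
  fixes M :: "'h::chilbert_space bop set"
  assumes M: "type_III_factor M" and cs: "conjugate_solutions M cj R R'" and \<sigma>: "\<sigma> \<in> End_fin M"
    and triv: "\<And>p. p \<in> intertwiners M \<sigma> \<sigma> \<Longrightarrow> projection p \<Longrightarrow> p = 0 \<or> p = 1"
    and T: "T \<in> intertwiners M \<sigma> \<sigma>" "adj T = T"
  shows "\<exists>c. T = c *\<^sub>C 1"
proof -
  have vM: "vN_algebra M" and one_ne: "(1 :: 'h bop) \<noteq> 0"
    using M by (auto simp: type_III_factor_def)
  have \<sigma>': "\<sigma> \<in> End_vN M" using \<sigma> by (simp add: End_fin_def)
  define Rg where "Rg = {inner v (app T v) | v. inner v v = 1}"
  obtain K where K: "K > 0" "\<And>x. norm (app T x) \<le> K * norm x" using bop_bounded by blast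
  have TK: "\<bar>inner v (app T v)\<bar> \<le> K * inner v v" for v
  proof -
    have "\<bar>inner v (app T v)\<bar> \<le> norm v * norm (app T v)" by (rule Cauchy_Schwarz_ineq2)
    also have "\<dots> \<le> norm v * (K * norm v)" by (intro mult_left_mono K) simp
    finally show ?thesis by (simp add: power2_norm_eq_inner[symmetric] power2_eq_square mult_ac)
  qed
  obtain v1 :: 'h where v1: "inner v1 v1 = 1"
    using projection_norm_eigen[of "1 :: 'h bop"] one_ne by (auto simp: projection_def)
  have Rg_ne: "Rg \<noteq> {}" using v1 by (auto simp: Rg_def)
  have bdd: "bdd_below Rg" 
  proof (rule bdd_belowI[of _ "- K"])
    fix r assume "r \<in> Rg"
    then obtain v where "inner v v = 1" "r = inner v (app T v)" by (auto simp: Rg_def)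
    then show "- K \<le> r" using TK[of v] by simp
  qed
  define m where "m = Inf Rg"
  define S where "S = T - complex_of_real m *\<^sub>C 1"
  have appS: "app S v = app T v - m *\<^sub>R v" for v by (simp add: S_def scaleC_of_real)
  have S_adj: "adj S = S" using T(2) by (simp add: S_def)
  have S_int: "S \<in> intertwiners M \<sigma> \<sigma>"
    unfolding S_def by (intro intertwiners_diff intertwiners_scaleC intertwiners_one vM T)
  have S_nn: "0 \<le> inner v (app S v)" for v
  proof (cases "v = 0")
    case False
    let ?u = "inverse (norm v) *\<^sub>R v"
    have u1: "inner ?u ?u = 1" using False by (simp add: power2_norm_eq_inner[symmetric] power2_eq_square field_simps)
    then have "m \<le> inner ?u (app T ?u)"
      unfolding m_def by (intro cInf_lower bdd) (unfold Rg_def, blast)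
    also have "inner ?u (app T ?u) = inner v (app T v) / (norm v)\<^sup>2"
      using False by (simp add: power2_eq_square field_simps)
    finally have "m * (norm v)\<^sup>2 \<le> inner v (app T v)"
      using False by (simp add: field_simps)
    then show ?thesis by (simp add: appS inner_diff_right power2_norm_eq_inner)
  qed simp
  have S_pos: "pos S" using S_adj S_nn by (simp add: pos_iff)
  define D where "D = K + \<bar>m\<bar> + 1"
  have D: "D > 0" using K(1) by (simp add: D_def)
  have S_le: "inner v (app S v) \<le> D * inner v v" for v
  proof -
    have "- m * inner v v \<le> (\<bar>m\<bar> + 1) * inner v v" by (intro mult_right_mono) auto
    then show ?thesis using TK[of v] by (simp add: appS inner_diff_right D_def algebra_simps)
  qed
  \<comment> \<open>Turns a small value of the form at \<open>v\<close> into a small vector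
    \<open>app S v\<close>, by Cauchy-Schwarz for \<open>S\<close> and
    \<open>S \<le> D\<close>.\<close>
  have S_small: "(norm (app S v))\<^sup>2 \<le> D * inner v (app S v)" for v
  proof -
    let ?s = "(norm (app S v))\<^sup>2"
    have "?s\<^sup>2 \<le> inner (app S v) (app S (app S v)) * inner v (app S v)"
      using pos_Cauchy_Schwarz[OF S_pos, of "app S v" v] by (simp add: power2_norm_eq_inner)
    also have "\<dots> \<le> (D * ?s) * inner v (app S v)"
      using S_le[of "app S v"] S_nn by (intro mult_right_mono) (auto simp: power2_norm_eq_inner)
    finally have "?s * ?s \<le> ?s * (D * inner v (app S v))" by (simp add: power2_eq_square mult_ac)
    then have le: "?s \<le> D * inner v (app S v)" if "0 < ?s"
      using mult_le_cancel_left_pos[OF that, of ?s "D * inner v (app S v)"] by blast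
    show ?thesis
    proof (cases "app S v = 0")
      case False
      then show ?thesis by (intro le) simp
    qed simp
  qed
  have "S = 0"
  proof (rule ccontr)
    assume S_ne: "S \<noteq> 0"
    define X where "X = 1 - complex_of_real (1 / D) *\<^sub>C S"
    have appX: "app X v = v - (1 / D) *\<^sub>R app S v" for v by (simp add: X_def scaleC_of_real del: of_real_divide)
    have X_adj: "adj X = X" using S_adj by (simp add: X_def)
    have X_int: "X \<in> intertwiners M \<sigma> \<sigma>"
      unfolding X_def by (intro intertwiners_diff intertwiners_scaleC intertwiners_one vM S_int)
    have X_pos: "pos X"
      unfolding pos_iff using X_adj S_le D by (auto simp: appX inner_diff_right field_simps)
    have X1_pos: "pos (1 - X)"
      unfolding pos_iff using X_adj S_nn D by (auto simp: appX inner_diff_right)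
    have ker: "closed_csubspace {v. app S v = app 0 v}" by (rule closed_csubspace_eq)
    obtain p where p: "projection p" "range (app p) = {v. app S v = app 0 v}"
      "\<And>v. v \<in> {v. app S v = app 0 v} \<Longrightarrow> app p v = v"
      by (rule projection_onto[OF ker]) (rule that)
    \<comment> \<open>The kernel projection inherits commutation from \<open>S\<close>: applied to
      the commutant of \<open>M\<close> this puts \<open>p\<close> into \<open>M\<close>, applied to
      \<open>\<sigma> x\<close> it makes \<open>p\<close> an intertwiner.\<close>
    have p_comm: "p * y = y * p" if y: "S * y = y * S" "S * adj y = adj y * S" for y
    proof (rule projection_commute[OF p])
      have "app S (app z v) = app z (app S v)" if "S * z = z * S" for z v
        using arg_cong[OF that, of "\<lambda>T. app T v"] by simp
      then show "app y v \<in> {v. app S v = app 0 v}" "app (adj y) v \<in> {v. app S v = app 0 v}"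
        if "v \<in> {v. app S v = app 0 v}" for v using y that by auto
    qed
    have SM: "S \<in> M" using S_int by (simp add: intertwiners_def)
    have "p \<in> commutant (commutant M)"
    proof (rule commutantI)
      fix y assume y: "y \<in> commutant M"
      have "adj y \<in> commutant M" using vM y by (intro commutant_adj) (auto simp: vN_algebra_def)
      then show "p * y = y * p" using y SM by (intro p_comm) (auto simp: commutant_def)
    qed
    then have pM: "p \<in> M" using vM by (simp add: vN_algebra_def)
    have "p * \<sigma> x = \<sigma> x * p" if x: "x \<in> M" for x
    proof (rule p_comm)
      show "S * \<sigma> x = \<sigma> x * S" using S_int x by (simp add: intertwiners_def)
      show "S * adj (\<sigma> x) = adj (\<sigma> x) * S"
        using S_int vN_adj[OF vM x] by (simp add: intertwiners_def flip: End_vN_star(4)[OF \<sigma>' x])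
    qed
    then have "p \<in> intertwiners M \<sigma> \<sigma>" using pM by (simp add: intertwiners_def)
    then consider "p = 0" | "p = 1" using triv p(1) by blast
    then have inj: "v = 0" if "app S v = 0" for v
    proof cases
      case 1
      then show ?thesis using p(3)[of v] that by simp
    next
      case 2
      have "app S z = 0" for z using p(2) 2 by (auto simp: set_eq_iff)
      then have "S = 0" by (intro bop_eqI) simp
      then show ?thesis using S_ne by simp
    qed
    obtain c \<phi> where c: "c > 0" and nrm: "\<exists>\<xi> \<eta> :: (nat, 'h) l2. \<forall>x\<in>M. \<phi> x = inner \<xi> (app (amplify x) \<eta>)"
      and PP: "\<And>x v. x \<in> intertwiners M \<sigma> \<sigma> \<Longrightarrow> pos x \<Longrightarrow> c * inner v (app x v) \<le> \<phi> x * inner v v"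
      using index_functional[OF M cs \<sigma>] by metis
    obtain \<xi> \<eta> :: "(nat, 'h) l2" where \<phi>: "\<And>x. x \<in> M \<Longrightarrow> \<phi> x = inner \<xi> (app (amplify x) \<eta>)"
      using nrm by blast
    let ?X = "amplify X :: (nat, 'h) l2 bop"
    \<comment> \<open>Convergence is wanted on the amplified space, where the normal functional
      \<open>\<phi>\<close> is given by two vectors.\<close>
    have lim: "(\<lambda>n. app (?X ^ n) y) \<longlonglongrightarrow> 0" for y
    proof (rule positive_contraction_powers)
      show "pos ?X" by (rule pos_amplify[OF X_pos])
      show "pos (1 - ?X)" using pos_amplify[OF X1_pos] by (simp add: amplify_diff amplify_one)
      fix z assume z: "app ?X z = z"
      have "app S (coord z n) = 0" for n
        using arg_cong[OF z, of "\<lambda>z. coord z n"] D by (simp add: appX)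
      then show "z = 0" by (intro l2_eqI) (simp add: inj)
    qed
    have "\<phi> (X ^ n * X ^ n) = inner (app (?X ^ n) \<xi>) (app (?X ^ n) \<eta>)" for n
    proof -
      have "X ^ n * X ^ n \<in> M"
        using intertwiners_mult[OF vM intertwiners_pow[OF vM X_int] intertwiners_pow[OF vM X_int]]
        by (simp add: intertwiners_def)
      moreover have "adj (?X ^ n) = ?X ^ n" by (rule adj_pow) (simp add: X_adj flip: amplify_adj)
      ultimately show ?thesis
        using inner_adj_left[of "?X ^ n" \<xi>] by (simp add: \<phi> amplify_mult amplify_pow)
    qed
    moreover have "(\<lambda>n. inner (app (?X ^ n) \<xi>) (app (?X ^ n) \<eta>)) \<longlonglongrightarrow> inner (0 :: (nat, 'h) l2) 0"
      by (intro tendsto_inner lim)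
    ultimately have \<phi>_lim: "(\<lambda>n. \<phi> (X ^ n * X ^ n)) \<longlonglongrightarrow> 0" by simp
    have "c / 4 \<le> \<phi> (X ^ n * X ^ n)" for n
    proof -
      \<comment> \<open>Chosen so that one application of \<open>X\<close> moves \<open>v\<close> by
        at most \<open>1 / (2 (n + 1))\<close>; then \<open>n\<close> applications move it by at
        most \<open>1 / 2\<close>, which leaves norm at least \<open>1 / 2\<close> and accounts for
        the bound \<open>c / 4\<close>.\<close>
      define \<delta> where "\<delta> = D / (4 * (real n + 1)\<^sup>2)"
      have \<delta>: "\<delta> > 0" using D by (simp add: \<delta>_def)
      obtain r where r: "r \<in> Rg" "r < m + \<delta>"
        using cInf_lessD[OF Rg_ne, of "m + \<delta>"] \<delta> by (auto simp: m_def)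
      then obtain v where v: "inner v v = 1" "inner v (app T v) < m + \<delta>" by (auto simp: Rg_def)
      have nv: "norm v = 1" using v(1) by (simp add: norm_eq_sqrt_inner)
      have "inner v (app S v) \<le> \<delta>" using v by (simp add: appS inner_diff_right)
      then have "(norm (app S v))\<^sup>2 \<le> D * \<delta>" using S_small[of v] D by (meson mult_left_mono less_imp_le order_trans)
      also have "D * \<delta> = (D / (2 * (real n + 1)))\<^sup>2"
        by (simp add: \<delta>_def power2_eq_square field_simps)
      finally have "norm (app S v) \<le> D / (2 * (real n + 1))"
        using D by (simp add: power2_le_iff_abs_le)
      then have step: "norm (app X v - v) \<le> 1 / (2 * (real n + 1))"
        using D by (simp add: appX field_simps)
      have contr: "norm (app X z) \<le> norm z" for z
      proof -
        have "(norm (app X z))\<^sup>2 \<le> (norm z)\<^sup>2"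
        proof -
          have "(norm (app X z))\<^sup>2 = (norm z)\<^sup>2 - 2 / D * inner z (app S z) + (norm (app S z))\<^sup>2 / D\<^sup>2"
            unfolding power2_norm_eq_inner appX
            by (simp add: inner_diff_left inner_diff_right inner_commute power2_eq_square)
          also have "(norm (app S z))\<^sup>2 / D\<^sup>2 \<le> D * inner z (app S z) / D\<^sup>2"
            by (intro divide_right_mono S_small) simp
          also have "D * inner z (app S z) / D\<^sup>2 = inner z (app S z) / D" using D by (simp add: power2_eq_square)
          finally have "(norm (app X z))\<^sup>2 \<le> (norm z)\<^sup>2 - 2 / D * inner z (app S z) + inner z (app S z) / D"
            by simp
          moreover have "2 / D * inner z (app S z) = 2 * (inner z (app S z) / D)" by simp
          moreover have "0 \<le> inner z (app S z) / D" using S_nn[of z] D by simp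
          ultimately show ?thesis by linarith
        qed
        then show ?thesis by (simp add: power2_le_iff_abs_le)
      qed
      have "norm (app (X ^ j) v - v) \<le> real j * (1 / (2 * (real n + 1)))" for j
      proof (induction j)
        case (Suc j)
        have "app (X ^ Suc j) v - v = app X (app (X ^ j) v - v) + (app X v - v)" by simp
        then have "norm (app (X ^ Suc j) v - v) \<le> norm (app (X ^ j) v - v) + norm (app X v - v)"
          using contr[of "app (X ^ j) v - v"] by (metis norm_triangle_le add_right_mono)
        then show ?case using Suc step by (simp add: algebra_simps add_divide_distrib)
      qed simp
      from this[of n] have "norm (app (X ^ n) v - v) \<le> 1 / 2"
        by (rule order_trans) (simp add: field_simps)
      then have half: "1 / 2 \<le> norm (app (X ^ n) v)"
        using nv norm_triangle_ineq2[of v "app (X ^ n) v"] by (simp add: norm_minus_commute)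
      have Xn: "adj (X ^ n) = X ^ n" using X_adj by (rule adj_pow)
      have "c * (1 / 2)\<^sup>2 \<le> c * (norm (app (X ^ n) v))\<^sup>2"
        using c half by (intro mult_left_mono power_mono) auto
      also have "(norm (app (X ^ n) v))\<^sup>2 = inner v (app (X ^ n * X ^ n) v)"
        using inner_adj_left[of "X ^ n" v "app (X ^ n) v"] by (simp add: Xn power2_norm_eq_inner)
      also have "c * \<dots> \<le> \<phi> (X ^ n * X ^ n) * inner v v"
        using pos_adj_mult[of "X ^ n"] unfolding Xn
        by (intro PP intertwiners_mult[OF vM intertwiners_pow[OF vM X_int] intertwiners_pow[OF vM X_int]])
      finally show ?thesis using v(1) by (simp add: power2_eq_square)
    qed
    then have "c / 4 \<le> 0" using \<phi>_lim by (intro LIMSEQ_le_const) auto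
    then show False using c by simp
  qed
  then have "T = complex_of_real m *\<^sub>C 1" by (simp add: S_def)
  then show ?thesis by blast
qed

lemma irreducible_endoI:
  assumes M: "type_III_factor M" and cs: "conjugate_solutions M cj R R'" and \<sigma>: "\<sigma> \<in> End_fin M"
    and triv: "\<And>p. p \<in> intertwiners M \<sigma> \<sigma> \<Longrightarrow> projection p \<Longrightarrow> p = 0 \<or> p = 1"
  shows "irreducible_endo M \<sigma>"
proof -
  have vM: "vN_algebra M" using M by (simp add: type_III_factor_def)
  have \<sigma>': "\<sigma> \<in> End_vN M" using \<sigma> by (simp add: End_fin_def)
  have "\<exists>c. T = c *\<^sub>C 1" if T: "T \<in> intertwiners M \<sigma> \<sigma>" for T
  proof -
    have Ta: "adj T \<in> intertwiners M \<sigma> \<sigma>" by (rule intertwiners_adj[OF vM \<sigma>' \<sigma>' T])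
    let ?S1 = "T + adj T" and ?S2 = "\<i> *\<^sub>C (T - adj T)"
    have "adj ?S2 = ?S2" by (rule bop_eqI) (simp add: scaleC_diff scaleC_minus_left)
    then obtain c2 where c2: "?S2 = c2 *\<^sub>C 1"
      using self_adjoint_scalar[OF M cs \<sigma> triv] intertwiners_scaleC[OF vM intertwiners_diff[OF vM T Ta]] by blast
    obtain c1 where c1: "?S1 = c1 *\<^sub>C 1"
      using self_adjoint_scalar[OF M cs \<sigma> triv intertwiners_add[OF vM T Ta]] by (auto simp: add.commute)
    \<comment> \<open>\<open>T\<close> is half of \<open>?S1 - \<i> *\<^sub>C ?S2\<close>, with both
      parts self-adjoint.\<close>
    have "T = ((c1 - \<i> * c2) / 2) *\<^sub>C 1"
    proof (rule bop_eqI)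
      fix v
      have 1: "app T v + app (adj T) v = c1 *\<^sub>C v" using arg_cong[OF c1, of "\<lambda>T. app T v"] by simp
      have "\<i> *\<^sub>C (app T v - app (adj T) v) = c2 *\<^sub>C v" using arg_cong[OF c2, of "\<lambda>T. app T v"] by simp
      then have "(- \<i>) *\<^sub>C \<i> *\<^sub>C (app T v - app (adj T) v) = (- \<i>) *\<^sub>C c2 *\<^sub>C v" by simp
      then have 2: "app T v - app (adj T) v = (- (\<i> * c2)) *\<^sub>C v" by (simp add: scaleC_scaleC)
      have "2 *\<^sub>R app T v = (app T v + app (adj T) v) + (app T v - app (adj T) v)"
        by (simp add: scaleR_2)
      also have "\<dots> = (c1 - \<i> * c2) *\<^sub>C v" unfolding 1 2 by (simp flip: scaleC_add_left)
      finally have "(1/2) *\<^sub>R (2 *\<^sub>R app T v) = (1/2) *\<^sub>R ((c1 - \<i> * c2) *\<^sub>C v)" by simp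
      also have "\<dots> = ((c1 - \<i> * c2) / 2) *\<^sub>C v"
        unfolding scaleC_of_real[symmetric] scaleC_scaleC by simp
      finally show "app T v = app (((c1 - \<i> * c2) / 2) *\<^sub>C 1) v" by simp
    qed
    then show ?thesis by blast
  qed
  moreover have "c *\<^sub>C 1 \<in> intertwiners M \<sigma> \<sigma>" for c
    by (intro intertwiners_scaleC intertwiners_one vM)
  ultimately show ?thesis unfolding irreducible_endo_def by blast
qed

section \<open>Maximal partitions of unity\<close>

definition orthogonal_partition :: "'h::chilbert_space bop set \<Rightarrow> 'h endo \<Rightarrow> 'h bop set \<Rightarrow> bool" where
  "orthogonal_partition M \<rho> F \<longleftrightarrow> finite F \<and> F \<subseteq> intertwiners M \<rho> \<rho> \<and>
     (\<forall>p\<in>F. projection p \<and> p \<noteq> 0) \<and> (\<forall>p\<in>F. \<forall>q\<in>F. p \<noteq> q \<longrightarrow> p * q = 0) \<and> sum (\<lambda>p. p) F = 1"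

text \<open>Testing the Pimsner-Popa bound on a unit vector in the range of \<open>p\<close> gives
  \<open>\<phi> p \<ge> c\<close>; since \<open>\<phi>\<close> adds up to 1, there are at most
  \<open>1 / c\<close> members.\<close>

lemma maximal_partition:
  fixes M :: "'h::chilbert_space bop set"
  assumes M: "type_III_factor M" and cs: "conjugate_solutions M cj R R'" and \<rho>: "\<rho> \<in> End_fin M"
  obtains F where "orthogonal_partition M \<rho> F" "\<And>F'. orthogonal_partition M \<rho> F' \<Longrightarrow> card F' \<le> card F"
proof -
  have vM: "vN_algebra M" and one_ne: "(1 :: 'h bop) \<noteq> 0"
    using M by (auto simp: type_III_factor_def)
  obtain c \<phi> where c: "c > 0" and \<phi>: "\<And>x y. x \<in> M \<Longrightarrow> y \<in> M \<Longrightarrow> \<phi> (x + y) = \<phi> x + \<phi> y" "\<phi> 1 = 1"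
    and PP: "\<And>x v. x \<in> intertwiners M \<rho> \<rho> \<Longrightarrow> pos x \<Longrightarrow> c * inner v (app x v) \<le> \<phi> x * inner v v"
    using index_functional[OF M cs \<rho>] by metis
  have \<phi>0: "\<phi> 0 = 0" using \<phi>(1)[OF vN_zero[OF vM] vN_zero[OF vM]] by simp
  have \<phi>_sum: "\<phi> (sum (\<lambda>p. p) F) = sum \<phi> F" if "finite F" "F \<subseteq> M" for F
    using that by (induction F) (auto simp: \<phi>0 \<phi>(1) vN_sum[OF vM] subset_iff)
  have bound: "real (card F) \<le> 1 / c" if F: "orthogonal_partition M \<rho> F" for F
  proof -
    have "c \<le> \<phi> p" if p: "p \<in> F" for p
    proof -
      have pp: "projection p" "p \<noteq> 0" "p \<in> intertwiners M \<rho> \<rho>" using F p by (auto simp: orthogonal_partition_def)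
      obtain v where "inner v v = 1" "app p v = v" using projection_norm_eigen[OF pp(1,2)] by blast
      then show ?thesis using PP[OF pp(3) projection_pos[OF pp(1)], of v] by simp
    qed
    then have "real (card F) * c \<le> sum \<phi> F" using sum_bounded_below[of F c \<phi>] by simp
    also have "\<dots> = \<phi> 1"
    proof -
      have "finite F" "F \<subseteq> M" "sum (\<lambda>p. p) F = 1"
        using F by (auto simp: orthogonal_partition_def intertwiners_def)
      then show ?thesis using \<phi>_sum[of F] by simp
    qed
    finally show ?thesis using c \<phi>(2) by (simp add: field_simps)
  qed
  obtain b :: nat where b: "1 / c < real b" using reals_Archimedean2 by blast
  have lt: "\<forall>F. orthogonal_partition M \<rho> F \<longrightarrow> card F < b"
    using bound b by (metis of_nat_less_iff order_le_less_trans)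
  have "orthogonal_partition M \<rho> {1}"
    using one_ne intertwiners_one[OF vM] by (simp add: orthogonal_partition_def projection_def)
  from ex_has_greatest_nat[of "orthogonal_partition M \<rho>", OF this lt] show ?thesis using that by blast
qed

lemma partition_refine:
  fixes M :: "'h::chilbert_space bop set"
  assumes F: "orthogonal_partition M \<rho> F" and p: "p \<in> F"
    and a: "a \<in> intertwiners M \<rho> \<rho>" "projection a" "a \<noteq> 0"
    and b: "b \<in> intertwiners M \<rho> \<rho>" "projection b" "b \<noteq> 0"
    and ab: "a * b = 0" "a + b = p"
  shows "\<exists>F'. orthogonal_partition M \<rho> F' \<and> card F < card F'"
proof -
  have fin: "finite F" and Fsub: "F \<subseteq> intertwiners M \<rho> \<rho>" and proj: "\<And>q. q \<in> F \<Longrightarrow> projection q \<and> q \<noteq> 0"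
    and orth: "\<And>q r. q \<in> F \<Longrightarrow> r \<in> F \<Longrightarrow> q \<noteq> r \<Longrightarrow> q * r = 0" and sum1: "sum (\<lambda>p. p) F = 1"
    using F by (auto simp: orthogonal_partition_def)
  have aa: "a * a = a" "adj a = a" and bb: "b * b = b" "adj b = b"
    using a b by (auto simp: projection_def)
  have ba: "b * a = 0" using arg_cong[OF ab(1), of adj] aa bb by simp
  have pa: "p * a = a" "a * p = a" and pb: "p * b = b" "b * p = b"
    using aa bb ab ba by (simp_all add: distrib_left distrib_right flip: ab(2))
  let ?G = "F - {p}"
  have qz: "q * a = 0" "a * q = 0" "q * b = 0" "b * q = 0" if "q \<in> ?G" for q
  proof -
    have "q * p = 0" "p * q = 0" using orth that p by auto
    then show "q * a = 0" "a * q = 0" "q * b = 0" "b * q = 0"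
      using pa pb by (metis mult.assoc mult_zero_left mult_zero_right)+
  qed
  \<comment> \<open>Partitions are sets, so the cardinality grows only if the two pieces are
    distinct from each other and from the remaining members.\<close>
  have aG: "a \<notin> ?G" using qz(1)[of a] aa a by auto
  have bG: "b \<notin> ?G" using qz(3)[of b] bb b by auto
  have anb: "a \<noteq> b" using ab(1) aa a by auto
  let ?F = "insert a (insert b ?G)"
  have "sum (\<lambda>p. p) ?F = a + (b + sum (\<lambda>p. p) ?G)"
    using fin aG bG anb by simp
  also have "\<dots> = p + sum (\<lambda>p. p) ?G" using ab(2) by (simp add: add.assoc[symmetric])
  also have "\<dots> = 1" using sum1 sum.remove[OF fin p, of "\<lambda>p. p"] by simp
  finally have "sum (\<lambda>p. p) ?F = 1" .
  moreover have "\<forall>x\<in>?F. \<forall>y\<in>?F. x \<noteq> y \<longrightarrow> x * y = 0"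
    using qz ab(1) ba orth by auto
  ultimately have "orthogonal_partition M \<rho> ?F"
    using a b fin Fsub proj by (auto simp: orthogonal_partition_def)
  moreover have "card F < card ?F"
    using fin aG bG anb p by (simp add: card_Diff_singleton card_gt_0_iff)
  ultimately show ?thesis by blast
qed

text \<open>Applied with \<open>D\<close> a homogeneous component, it keeps all constituents in that
  component, although the representatives are chosen in the whole category. The projections of the
  partition serve as index set.\<close>

lemma complete_reducibility:
  fixes M :: "'h::chilbert_space bop set"
  assumes M: "type_III_factor M" and cs: "conjugate_solutions M cj R R'"
    and D: "closed_subcategory M D" and C: "closed_subcategory M C" and DC: "D \<subseteq> C"
    and I: "irr_representatives M C I" and \<rho>: "\<rho> \<in> D"
  shows "\<exists>F :: 'h bop set. \<exists>\<pi> S. finite F \<and>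
    (\<forall>p\<in>F. \<pi> p \<in> I \<inter> D \<and> S p \<in> intertwiners M (\<pi> p) \<rho>) \<and> (\<Sum>p\<in>F. S p * adj (S p)) = 1"
proof -
  have vM: "vN_algebra M" using M by (simp add: type_III_factor_def)
  have fin: "\<sigma> \<in> End_fin M" "\<sigma> \<in> End_vN M" if "\<sigma> \<in> C" for \<sigma>
    using C that by (auto simp: closed_subcategory_def End_fin_def)
  have \<rho>fin: "\<rho> \<in> End_fin M" "\<rho> \<in> End_vN M" using fin \<rho> DC by auto
  obtain F where F: "orthogonal_partition M \<rho> F" and max: "\<And>F'. orthogonal_partition M \<rho> F' \<Longrightarrow> card F' \<le> card F"
    using maximal_partition[OF M cs \<rho>fin(1)] by blast
  have "\<exists>\<pi> S. \<pi> \<in> I \<inter> D \<and> S \<in> intertwiners M \<pi> \<rho> \<and> S * adj S = p" if p: "p \<in> F" for p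
  proof -
    have pp: "p \<in> intertwiners M \<rho> \<rho>" "projection p" "p \<noteq> 0" using F p by (auto simp: orthogonal_partition_def)
    then obtain \<sigma> S where \<sigma>: "\<sigma> \<in> D" and S: "S \<in> intertwiners M \<sigma> \<rho>" "adj S * S = 1" "S * adj S = p"
      using D \<rho> unfolding closed_subcategory_def by blast
    have \<sigma>C: "\<sigma> \<in> C" using \<sigma> DC by blast
    have S': "adj S \<in> intertwiners M \<rho> \<sigma>" by (rule intertwiners_adj[OF vM fin(2)[OF \<sigma>C] \<rho>fin(2) S(1)])
    have compress: "S * x * adj S \<in> intertwiners M \<rho> \<rho>" if "x \<in> intertwiners M \<sigma> \<sigma>" for x
      using intertwiners_mult[OF vM intertwiners_mult[OF vM S(1) that] S'] .
    have SxS: "adj S * (S * x * adj S) * S = x" for x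
    proof -
      have "adj S * (S * x * adj S) * S = (adj S * S) * x * (adj S * S)" by (simp only: mult.assoc)
      then show ?thesis by (simp add: S(2))
    qed
    have mult: "(S * x * adj S) * (S * y * adj S) = S * (x * y) * adj S" for x y
    proof -
      have "(S * x * adj S) * (S * y * adj S) = S * x * (adj S * S) * y * adj S" by (simp only: mult.assoc)
      then show ?thesis by (simp add: S(2) mult.assoc)
    qed
    have "irreducible_endo M \<sigma>"
    proof (rule irreducible_endoI[OF M cs fin(1)[OF \<sigma>C]])
      fix e assume e: "e \<in> intertwiners M \<sigma> \<sigma>" "projection e"
      show "e = 0 \<or> e = 1"
      proof (rule ccontr)
        \<comment> \<open>A nontrivial \<open>e\<close> in \<open>(\<sigma>, \<sigma>)\<close>,
          carried over by the isometry \<open>S\<close>, would split \<open>p\<close> and refine a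
          maximal partition.\<close>
        assume ne: "\<not> (e = 0 \<or> e = 1)"
        have ee: "e * e = e" "adj e = e" using e(2) by (auto simp: projection_def)
        let ?a = "S * e * adj S" and ?b = "S * (1 - e) * adj S"
        have e': "1 - e \<in> intertwiners M \<sigma> \<sigma>" by (intro intertwiners_diff intertwiners_one vM e)
        have "\<exists>F'. orthogonal_partition M \<rho> F' \<and> card F < card F'"
        proof (rule partition_refine[OF F p])
          show "?a \<in> intertwiners M \<rho> \<rho>" "?b \<in> intertwiners M \<rho> \<rho>" using compress e(1) e' by auto
          show "projection ?a" unfolding projection_def mult by (simp add: ee mult.assoc)
          show "projection ?b" unfolding projection_def mult
            by (simp add: ee mult.assoc left_diff_distrib right_diff_distrib)
          show "?a \<noteq> 0" using SxS[of e] ne by auto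
          show "?b \<noteq> 0" using SxS[of "1 - e"] ne by auto
          show "?a * ?b = 0" unfolding mult by (simp add: right_diff_distrib ee)
          show "?a + ?b = p" by (simp add: right_diff_distrib left_diff_distrib S(3))
        qed
        then show False using max by fastforce
      qed
    qed
    then obtain \<pi> where \<pi>: "\<pi> \<in> I" "unitarily_equiv M \<sigma> \<pi>"
      using I \<sigma>C unfolding irr_representatives_def by blast
    obtain U where U: "U \<in> intertwiners M \<sigma> \<pi>" "unitary U" using \<pi>(2) by (auto simp: unitarily_equiv_def)
    have \<pi>C: "\<pi> \<in> C" using I \<pi>(1) by (auto simp: irr_representatives_def)
    \<comment> \<open>Closure of \<open>D\<close> under unitary equivalence brings the chosen
      representative back into \<open>D\<close>.\<close>
    have "\<forall>\<sigma>\<in>D. \<forall>\<tau>\<in>End_vN M. unitarily_equiv M \<sigma> \<tau> \<longrightarrow> \<tau> \<in> D"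
      using D by (simp add: closed_subcategory_def)
    then have "\<pi> \<in> D" using \<sigma> \<pi>(2) fin(2)[OF \<pi>C] by blast
    moreover have "S * adj U \<in> intertwiners M \<pi> \<rho>"
      using intertwiners_mult[OF vM S(1) intertwiners_adj[OF vM fin(2)[OF \<sigma>C] fin(2)[OF \<pi>C] U(1)]] .
    moreover have "(S * adj U) * adj (S * adj U) = p"
    proof -
      have "(S * adj U) * adj (S * adj U) = S * (adj U * U) * adj S" by (simp add: mult.assoc)
      then show ?thesis using U(2) S(3) by (simp add: unitary_def)
    qed
    ultimately show ?thesis using \<pi>(1) by blast
  qed
  then obtain \<pi> S where \<pi>S: "\<And>p. p \<in> F \<Longrightarrow> \<pi> p \<in> I \<inter> D \<and> S p \<in> intertwiners M (\<pi> p) \<rho> \<and> S p * adj (S p) = p"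
    by metis
  have "(\<Sum>p\<in>F. S p * adj (S p)) = (\<Sum>p\<in>F. p)" using \<pi>S by (intro sum.cong) auto
  also have "\<dots> = 1" using F by (simp add: orthogonal_partition_def)
  finally show ?thesis using \<pi>S F unfolding orthogonal_partition_def by blast
qed

section \<open>Graded Longo-Rehren inclusions\<close>

locale graded_longo_rehren =
  fixes M :: "'h::chilbert_space bop set"
    and P :: "'p::chilbert_space bop set"
    and t :: "'h \<Rightarrow> 'p \<Rightarrow> 't::chilbert_space"
    and cj :: "'h endo \<Rightarrow> 'h endo" and R R' :: "'h endo \<Rightarrow> 'h bop"
    and C I :: "'h endo set"
    and Cg :: "'g::group_add \<Rightarrow> 'h endo set"
    and opp :: "'h bop \<Rightarrow> 'p bop"
    and \<iota> :: "'t bop \<Rightarrow> 'k::chilbert_space bop"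
    and lam :: "'h endo \<Rightarrow> 'k bop"
    and A B :: "'k bop set"
    and E :: "'k bop \<Rightarrow> 'k bop"
  assumes M: "type_III_factor M"
    and cs: "conjugate_solutions M cj R R'"
    and C: "rigid_tensor_category M cj C"
    and I: "irr_representatives M C I"
    and Cg: "graded_category M cj C Cg"
    and P: "opposite_vN M P opp"
    and t: "hilbert_tensor t"
    and LR: "longo_rehren M cj R C I P opp t \<iota> lam B E"
    and A_eq: "A = \<iota> ` tensor_vN t M P"
begin

abbreviation "T \<equiv> tensor_vN t M P"

definition gen :: "'g \<Rightarrow> 'k bop set" where
  "gen g = {a * lam \<pi> | a \<pi>. a \<in> A \<and> \<pi> \<in> Cg g}"

lemma vM: "vN_algebra M" and vP: "vN_algebra P" and vT: "vN_algebra T"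
  using M P vN_algebra_vN_generated by (auto simp: type_III_factor_def opposite_vN_def tensor_vN_def)

lemma tensor_mem: "x \<in> M \<Longrightarrow> y \<in> P \<Longrightarrow> tensor_op t x y \<in> T"
  unfolding tensor_vN_def by (rule subsetD[OF vN_generated_base]) blast

lemma opp_conj_mem: "x \<in> M \<Longrightarrow> opp_conj opp x \<in> P"
  unfolding opp_conj_def using P vN_adj[OF vM] by (meson bij_betw_apply opposite_vN_def)

lemma \<iota>: "star_hom T UNIV \<iota>"
  using LR by (simp add: longo_rehren_def)

lemma \<iota>_mult: "x \<in> T \<Longrightarrow> y \<in> T \<Longrightarrow> \<iota> (x * y) = \<iota> x * \<iota> y"
  and \<iota>_add: "x \<in> T \<Longrightarrow> y \<in> T \<Longrightarrow> \<iota> (x + y) = \<iota> x + \<iota> y"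
  and \<iota>_adj: "x \<in> T \<Longrightarrow> \<iota> (adj x) = adj (\<iota> x)"
  and \<iota>_one: "\<iota> 1 = 1"
  using \<iota> by (simp_all add: star_hom_def)

lemma \<iota>_zero: "\<iota> 0 = 0"
proof -
  have "\<iota> 0 = \<iota> (0 + 0)" by simp
  also have "\<dots> = \<iota> 0 + \<iota> 0" using vN_zero[OF vT] by (intro \<iota>_add)
  finally show ?thesis by simp
qed

lemma \<iota>_sum: "(\<And>i. i \<in> F \<Longrightarrow> x i \<in> T) \<Longrightarrow> \<iota> (\<Sum>i\<in>F. x i) = (\<Sum>i\<in>F. \<iota> (x i))"
proof (induction F rule: infinite_finite_induct)
  case (insert i F)
  then show ?case using vN_sum[OF vT, of F x] by (simp add: \<iota>_add)
qed (simp_all add: \<iota>_zero)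

lemma \<iota>_mem: "x \<in> T \<Longrightarrow> \<iota> x \<in> A"
  by (simp add: A_eq)

lemma A_mult: "a \<in> A \<Longrightarrow> b \<in> A \<Longrightarrow> a * b \<in> A"
  and A_adj: "a \<in> A \<Longrightarrow> adj a \<in> A"
  and A_one: "1 \<in> A"
proof -
  show "a \<in> A \<Longrightarrow> b \<in> A \<Longrightarrow> a * b \<in> A"
    unfolding A_eq using vN_mult[OF vT] \<iota>_mult by (auto simp: image_iff) metis
  show "a \<in> A \<Longrightarrow> adj a \<in> A"
    unfolding A_eq using vN_adj[OF vT] \<iota>_adj by (auto simp: image_iff) metis
  show "1 \<in> A" using \<iota>_mem[OF vN_one[OF vT]] by (simp add: \<iota>_one)
qed

lemma closed_C: "closed_subcategory M C"
  using C by (simp add: rigid_tensor_category_def)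

lemma closed_Cg: "closed_subcategory M (Cg g)" and Cg_subset: "Cg g \<subseteq> C"
  using Cg by (simp_all add: graded_category_def)

lemma Cg_compose: "\<pi> \<in> Cg g \<Longrightarrow> \<rho> \<in> Cg h \<Longrightarrow> compose M \<pi> \<rho> \<in> Cg (g + h)"
  and Cg_cj: "\<pi> \<in> Cg g \<Longrightarrow> cj \<pi> \<in> Cg (- g)"
  and Cg_ex1: "\<pi> \<in> C \<Longrightarrow> irreducible_endo M \<pi> \<Longrightarrow> \<exists>!g. \<pi> \<in> Cg g"
  using Cg by (simp_all add: graded_category_def)

lemma C_End: "\<pi> \<in> C \<Longrightarrow> \<pi> \<in> End_fin M" and C_End_vN: "\<pi> \<in> C \<Longrightarrow> \<pi> \<in> End_vN M"
  using closed_C by (auto simp: closed_subcategory_def End_fin_def)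

lemma id_C: "id_endo M \<in> C" and cj_C: "\<pi> \<in> C \<Longrightarrow> cj \<pi> \<in> C"
  using C by (simp_all add: rigid_tensor_category_def)

lemma id_I: "id_endo M \<in> I" and I_C: "I \<subseteq> C"
  and I_irreducible: "\<pi> \<in> I \<Longrightarrow> irreducible_endo M \<pi>"
  using I by (auto simp: irr_representatives_def)

lemma lam_A:
  assumes "\<pi> \<in> C" "a \<in> A"
  obtains b where "b \<in> A" "lam \<pi> * a = b * lam \<pi>"
proof -
  obtain \<theta> where \<theta>: "is_tensor_endo t M P \<pi> (opp_endo M P opp \<pi>) \<theta>"
    "\<And>x. x \<in> T \<Longrightarrow> lam \<pi> * \<iota> x = \<iota> (\<theta> x) * lam \<pi>"
  proof -
    have "\<forall>\<pi>\<in>C. \<exists>\<theta>. is_tensor_endo t M P \<pi> (opp_endo M P opp \<pi>) \<theta> \<and>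
        (\<forall>a\<in>T. lam \<pi> * \<iota> a = \<iota> (\<theta> a) * lam \<pi>)"
      using LR unfolding longo_rehren_def by (elim conjE)
    then show ?thesis using assms(1) that by blast
  qed
  obtain x where x: "x \<in> T" "a = \<iota> x" using assms(2) by (auto simp: A_eq)
  have "\<theta> x \<in> T" using \<theta>(1) x(1) by (auto simp: is_tensor_endo_def intro: End_vN_star(2))
  then show ?thesis using that \<theta>(2)[OF x(1)] x(2) \<iota>_mem by blast
qed

lemma lam_mult: "\<pi> \<in> C \<Longrightarrow> \<rho> \<in> C \<Longrightarrow> lam \<pi> * lam \<rho> = lam (compose M \<pi> \<rho>)"
  using LR by (simp add: longo_rehren_def)

lemma lam_adj:
  assumes "\<pi> \<in> C"
  obtains r where "r \<in> A" "adj (lam \<pi>) = r * lam (cj \<pi>)"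
proof -
  have "R \<pi> \<in> M" using cs C_End[OF assms] by (auto simp: conjugate_solutions_def intertwiners_def)
  then have "adj (\<iota> (tensor_op t (R \<pi>) (opp_conj opp (R \<pi>)))) \<in> A"
    by (intro A_adj \<iota>_mem tensor_mem opp_conj_mem)
  moreover have "adj (lam \<pi>) = adj (\<iota> (tensor_op t (R \<pi>) (opp_conj opp (R \<pi>)))) * lam (cj \<pi>)"
    using LR assms unfolding longo_rehren_def by blast
  ultimately show ?thesis using that by blast
qed

lemma lam_intertwiner:
  "\<pi> \<in> C \<Longrightarrow> \<rho> \<in> C \<Longrightarrow> S \<in> intertwiners M \<pi> \<rho> \<Longrightarrow>
    \<iota> (tensor_op t S 1) * lam \<pi> = \<iota> (tensor_op t 1 (opp_conj opp (adj S))) * lam \<rho>"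
  using LR unfolding longo_rehren_def by blast

lemma B_eq: "B = vN_generated (A \<union> lam ` C)"
  using LR unfolding longo_rehren_def A_eq by (elim conjE)

lemma E: "fn_cond_exp B A E"
  using LR unfolding longo_rehren_def A_eq by (elim conjE)

lemma vB: "vN_algebra B"
  unfolding B_eq by (rule vN_algebra_vN_generated)

lemma A_B: "A \<subseteq> B" and lam_B: "\<pi> \<in> C \<Longrightarrow> lam \<pi> \<in> B"
  unfolding B_eq using vN_generated_base[of "A \<union> lam ` C"] by auto

lemma E_lam: "\<pi> \<in> I \<Longrightarrow> a \<in> A \<Longrightarrow> E (a * lam \<pi>) = (if \<pi> = id_endo M then a else 0)"
  using LR by (auto simp: longo_rehren_def A_eq)

lemma E_add: "x \<in> B \<Longrightarrow> y \<in> B \<Longrightarrow> E (x + y) = E x + E y"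
  using E by (simp add: fn_cond_exp_def)

lemma E_zero: "E 0 = 0"
  using E_add[OF vN_zero[OF vB] vN_zero[OF vB]] by simp

lemma E_sum: "(\<And>i. i \<in> F \<Longrightarrow> x i \<in> B) \<Longrightarrow> E (\<Sum>i\<in>F. x i) = (\<Sum>i\<in>F. E (x i))"
proof (induction F rule: infinite_finite_induct)
  case (insert i F)
  then show ?case using vN_sum[OF vB, of F x] by (simp add: E_add)
qed (simp_all add: E_zero)

lemma compose_id:
  assumes "\<pi> \<in> C"
  shows "compose M (id_endo M) \<pi> = \<pi>" "compose M \<pi> (id_endo M) = \<pi>"
proof -
  have "\<pi> \<in> extensional M" using C_End_vN[OF assms] by (simp add: End_vN_def)
  then show "compose M (id_endo M) \<pi> = \<pi>" "compose M \<pi> (id_endo M) = \<pi>"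
    using End_vN_star(2)[OF C_End_vN[OF assms]]
    by (auto simp: compose_def extensional_def fun_eq_iff)
qed

text \<open>The relations make \<open>\<lambda>\<^bsub>id\<^esub>\<close> a projection with \<open>E(1 - \<lambda>\<^bsub>id\<^esub>) = 0\<close>.\<close>

lemma lam_id: "lam (id_endo M) = 1"
proof -
  let ?e = "lam (id_endo M)"
  obtain r where r: "r \<in> A" "adj ?e = r * lam (cj (id_endo M))" by (rule lam_adj[OF id_C])
  have 1: "adj ?e * ?e = adj ?e"
    unfolding r(2) mult.assoc lam_mult[OF cj_C[OF id_C] id_C] compose_id(2)[OF cj_C[OF id_C]] ..
  from arg_cong[OF 1, of adj] have "adj ?e * ?e = ?e" by (simp only: adj_mult adj_adj)
  then have sa: "adj ?e = ?e" and idem: "?e * ?e = ?e" using 1 by simp_all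
  have eB: "?e \<in> B" "1 - ?e \<in> B" using lam_B[OF id_C] vN_diff[OF vB vN_one[OF vB]] by auto
  have p: "pos (1 - ?e)"
    by (rule projection_pos) (simp add: projection_def sa idem left_diff_distrib right_diff_distrib)
  have "E 1 = 1" using E A_one unfolding fn_cond_exp_def by blast
  moreover have "E ?e = 1" using E_lam[OF id_I A_one] by simp
  moreover have "E 1 = E (1 - ?e) + E ?e" using E_add[OF eB(2,1)] by simp
  ultimately have "E (1 - ?e) = 0" by simp
  then have "1 - ?e = 0" using E p eB(2) unfolding fn_cond_exp_def by blast
  then show ?thesis by simp
qed

text \<open>The degree of the identity is idempotent in the group, hence neutral.\<close>

lemma id_Cg: "id_endo M \<in> Cg g \<longleftrightarrow> g = 0"
proof -
  have "\<exists>!g. id_endo M \<in> Cg g"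
    by (rule Cg_ex1[OF id_C I_irreducible[OF id_I]])
  then obtain h where h: "id_endo M \<in> Cg h" and uniq: "\<And>g. id_endo M \<in> Cg g \<Longrightarrow> g = h" by blast
  have "compose M (id_endo M) (id_endo M) \<in> Cg (h + h)"
    by (rule Cg_compose[OF h h])
  then have "id_endo M \<in> Cg (h + h)" unfolding compose_id(1)[OF id_C] .
  then have "h + h = h" by (rule uniq)
  then have "h = 0" by (metis add.right_neutral add_left_cancel)
  then show ?thesis using h uniq by blast
qed

text \<open>Insert \<open>1 = \<Sum> S p * adj (S p)\<close> in the first tensor factor and use
  naturality of \<open>lam\<close> to trade \<open>adj (S p)\<close> on the left of
  \<open>lam \<pi>\<close> for an element of the second factor in front of
  \<open>lam (\<sigma> p)\<close>.\<close>

lemma lam_decomposition: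
  assumes D: "closed_subcategory M D" "D \<subseteq> C" and \<pi>: "\<pi> \<in> D"
  shows "\<exists>F :: 'h bop set. \<exists>b \<sigma>. finite F \<and> (\<forall>p\<in>F. b p \<in> A \<and> \<sigma> p \<in> I \<inter> D) \<and>
    lam \<pi> = (\<Sum>p\<in>F. b p * lam (\<sigma> p))"
proof -
  have \<pi>C: "\<pi> \<in> C" using \<pi> D by blast
  obtain F :: "'h bop set" and \<sigma> S where F: "finite F"
    "\<And>p. p \<in> F \<Longrightarrow> \<sigma> p \<in> I \<inter> D" "\<And>p. p \<in> F \<Longrightarrow> S p \<in> intertwiners M (\<sigma> p) \<pi>"
    and sum: "(\<Sum>p\<in>F. S p * adj (S p)) = 1"
    using complete_reducibility[OF M cs D(1) closed_C D(2) I \<pi>] by blast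
  have SM: "S p \<in> M" "adj (S p) \<in> M" if "p \<in> F" for p
    using F(3)[OF that] vN_adj[OF vM] by (auto simp: intertwiners_def)
  note one = vN_one[OF vP] vN_one[OF vM]
  have T1: "tensor_op t (S p) 1 \<in> T" "tensor_op t (adj (S p)) 1 \<in> T"
    "tensor_op t 1 (opp_conj opp (adj (adj (S p)))) \<in> T" if "p \<in> F" for p
    using SM[OF that] by (intro tensor_mem opp_conj_mem one; simp)+
  have "1 = \<iota> (tensor_op t (\<Sum>p\<in>F. S p * adj (S p)) (1 * 1))"
    by (simp add: sum tensor_op_one[OF t] \<iota>_one)
  also have "\<dots> = \<iota> (\<Sum>p\<in>F. tensor_op t (S p) 1 * tensor_op t (adj (S p)) 1)"
    unfolding tensor_op_sum[OF t] tensor_op_mult[OF t] ..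
  also have "\<dots> = (\<Sum>p\<in>F. \<iota> (tensor_op t (S p) 1 * tensor_op t (adj (S p)) 1))"
    by (rule \<iota>_sum) (intro vN_mult[OF vT] T1)
  finally have "lam \<pi> = (\<Sum>p\<in>F. \<iota> (tensor_op t (S p) 1 * tensor_op t (adj (S p)) 1)) * lam \<pi>" by simp
  also have "\<dots> = (\<Sum>p\<in>F. \<iota> (tensor_op t (S p) 1) * \<iota> (tensor_op t 1 (opp_conj opp (adj (adj (S p))))) * lam (\<sigma> p))"
    unfolding sum_distrib_right
  proof (rule sum.cong[OF refl])
    fix p assume p: "p \<in> F"
    have \<sigma>C: "\<sigma> p \<in> C" using F(2)[OF p] I_C by blast
    have "adj (S p) \<in> intertwiners M \<pi> (\<sigma> p)"
      by (rule intertwiners_adj[OF vM C_End_vN[OF \<sigma>C] C_End_vN[OF \<pi>C] F(3)[OF p]])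
    from lam_intertwiner[OF \<pi>C \<sigma>C this]
    show "\<iota> (tensor_op t (S p) 1 * tensor_op t (adj (S p)) 1) * lam \<pi> =
      \<iota> (tensor_op t (S p) 1) * \<iota> (tensor_op t 1 (opp_conj opp (adj (adj (S p))))) * lam (\<sigma> p)"
      by (simp only: \<iota>_mult[OF T1(1,2)[OF p]] mult.assoc)
  qed
  finally have "lam \<pi> = (\<Sum>p\<in>F. \<iota> (tensor_op t (S p) 1) * \<iota> (tensor_op t 1 (opp_conj opp (adj (adj (S p))))) * lam (\<sigma> p))" .
  moreover have "\<iota> (tensor_op t (S p) 1) * \<iota> (tensor_op t 1 (opp_conj opp (adj (adj (S p))))) \<in> A" if "p \<in> F" for p
    by (intro A_mult \<iota>_mem T1 that)
  ultimately show ?thesis using F(1,2)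
    by (intro exI[of _ F] exI[of _ "\<lambda>p. \<iota> (tensor_op t (S p) 1) * \<iota> (tensor_op t 1 (opp_conj opp (adj (adj (S p)))))"]
        exI[of _ \<sigma>]) blast
qed

lemma gen_decomposition:
  assumes "x \<in> gen g"
  obtains F :: "'h bop set" and b \<sigma> where "finite F"
    "\<And>p. p \<in> F \<Longrightarrow> b p \<in> A" "\<And>p. p \<in> F \<Longrightarrow> \<sigma> p \<in> I \<inter> Cg g" "x = (\<Sum>p\<in>F. b p * lam (\<sigma> p))"
proof -
  obtain a \<pi> where a: "a \<in> A" "\<pi> \<in> Cg g" "x = a * lam \<pi>" using assms by (auto simp: gen_def)
  obtain F :: "'h bop set" and b \<sigma> where F: "finite F" "\<forall>p\<in>F. b p \<in> A \<and> \<sigma> p \<in> I \<inter> Cg g"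
    "lam \<pi> = (\<Sum>p\<in>F. b p * lam (\<sigma> p))"
    using lam_decomposition[OF closed_Cg Cg_subset a(2)] by blast
  have "x = (\<Sum>p\<in>F. (a * b p) * lam (\<sigma> p))"
    unfolding a(3) F(3) sum_distrib_left mult.assoc ..
  moreover have "a * b p \<in> A" if "p \<in> F" for p using A_mult a(1) F(2) that by blast
  ultimately show ?thesis using that[OF F(1), of "\<lambda>p. a * b p" \<sigma>] F(2) by blast
qed

section \<open>The grading of \<open>B\<close>\<close>

lemma gen_mult:
  assumes "x \<in> gen g" "y \<in> gen h"
  shows "x * y \<in> gen (g + h)"
proof -
  obtain a \<pi> b \<rho> where a: "a \<in> A" "\<pi> \<in> Cg g" "x = a * lam \<pi>" and b: "b \<in> A" "\<rho> \<in> Cg h" "y = b * lam \<rho>"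
    using assms by (auto simp: gen_def)
  have C: "\<pi> \<in> C" "\<rho> \<in> C" using a b Cg_subset by blast+
  obtain b' where b': "b' \<in> A" "lam \<pi> * b = b' * lam \<pi>" using lam_A[OF C(1) b(1)] by blast
  have "x * y = a * (lam \<pi> * b) * lam \<rho>" by (simp add: a b mult.assoc)
  also have "\<dots> = (a * b') * lam (compose M \<pi> \<rho>)" by (simp add: b' mult.assoc lam_mult[OF C])
  finally have "x * y = (a * b') * lam (compose M \<pi> \<rho>)" .
  moreover have "compose M \<pi> \<rho> \<in> Cg (g + h)" by (rule Cg_compose[OF a(2) b(2)])
  ultimately show ?thesis using A_mult[OF a(1) b'(1)] unfolding gen_def by blast
qed

lemma gen_adj:
  assumes "x \<in> gen g"
  shows "adj x \<in> gen (- g)"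
proof -
  obtain a \<pi> where a: "a \<in> A" "\<pi> \<in> Cg g" "x = a * lam \<pi>" using assms by (auto simp: gen_def)
  have C: "\<pi> \<in> C" using a Cg_subset by blast
  obtain r where r: "r \<in> A" "adj (lam \<pi>) = r * lam (cj \<pi>)" by (rule lam_adj[OF C])
  obtain b where b: "b \<in> A" "lam (cj \<pi>) * adj a = b * lam (cj \<pi>)" by (rule lam_A[OF cj_C[OF C] A_adj[OF a(1)]])
  have "adj x = (r * b) * lam (cj \<pi>)" by (simp add: a r b mult.assoc)
  moreover have "cj \<pi> \<in> Cg (- g)" by (rule Cg_cj[OF a(2)])
  ultimately show ?thesis using A_mult[OF r(1) b(1)] unfolding gen_def by blast
qed

lemma A_gen: "A \<subseteq> gen 0"
proof
  fix a assume "a \<in> A"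
  moreover have "a = a * lam (id_endo M)" by (simp add: lam_id)
  ultimately show "a \<in> gen 0" using id_Cg[of 0] unfolding gen_def by blast
qed

lemma gen_B: "gen g \<subseteq> B"
  using vN_mult[OF vB] A_B lam_B Cg_subset unfolding gen_def by blast

text \<open>The expectation is prescribed on irreducible representatives only; all constituents of
  an object of degree \<open>g\<close> have degree \<open>g\<close>, so none of them is the
  identity.\<close>

lemma E_gen:
  assumes "g \<noteq> 0" "x \<in> gen g"
  shows "E x = 0"
proof -
  obtain F :: "'h bop set" and b \<sigma> where F: "\<And>p. p \<in> F \<Longrightarrow> b p \<in> A" "\<And>p. p \<in> F \<Longrightarrow> \<sigma> p \<in> I \<inter> Cg g"
    "x = (\<Sum>p\<in>F. b p * lam (\<sigma> p))"
    by (rule gen_decomposition[OF assms(2)]) (rule that)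
  have "E x = (\<Sum>p\<in>F. E (b p * lam (\<sigma> p)))"
    unfolding F(3)
  proof (rule E_sum)
    fix p assume "p \<in> F"
    then have "b p * lam (\<sigma> p) \<in> gen g" using F(1,2) unfolding gen_def by blast
    then show "b p * lam (\<sigma> p) \<in> B" using gen_B by blast
  qed
  also have "\<dots> = 0"
  proof (rule sum.neutral, rule ballI)
    fix p assume p: "p \<in> F"
    have \<sigma>: "\<sigma> p \<in> I" "\<sigma> p \<in> Cg g" using F(2)[OF p] by auto
    have "\<sigma> p \<noteq> id_endo M" using \<sigma>(2) id_Cg[of g] assms(1) by metis
    then show "E (b p * lam (\<sigma> p)) = 0" using E_lam[OF \<sigma>(1) F(1)[OF p]] by simp
  qed
  finally show ?thesis .
qed

text \<open>An object of the category may mix several degrees and then lies in no component, but its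
  irreducible constituents are homogeneous.\<close>

lemma B_gen: "B = commutant (commutant (\<Union>g. gen g))"
proof
  let ?N = "commutant (commutant (\<Union>g. gen g))"
  have "adj ` (\<Union>g. gen g) \<subseteq> (\<Union>g. gen g)" using gen_adj by blast
  then have "vN_generated (\<Union>g. gen g) = ?N" by (simp add: vN_generated_def Un_absorb2)
  then have N: "vN_algebra ?N" using vN_algebra_vN_generated by metis
  have ext: "gen g \<subseteq> ?N" for g using commutant_commutant_extensive[of "\<Union>g. gen g"] by blast
  have "lam \<pi> \<in> ?N" if \<pi>: "\<pi> \<in> C" for \<pi>
  proof -
    obtain F :: "'h bop set" and b \<sigma> where F: "\<forall>p\<in>F. b p \<in> A \<and> \<sigma> p \<in> I \<inter> C"
      "lam \<pi> = (\<Sum>p\<in>F. b p * lam (\<sigma> p))"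
      using lam_decomposition[OF closed_C subset_refl \<pi>] by blast
    have "b p * lam (\<sigma> p) \<in> ?N" if p: "p \<in> F" for p
    proof -
      obtain g where "\<sigma> p \<in> Cg g"
        using Cg_ex1[of "\<sigma> p"] F(1) p I_irreducible by blast
      then have "b p * lam (\<sigma> p) \<in> gen g" using F(1) p unfolding gen_def by blast
      then show ?thesis using ext by blast
    qed
    then show ?thesis unfolding F(2) by (rule vN_sum[OF N])
  qed
  then have "A \<union> lam ` C \<subseteq> ?N" using A_gen ext by blast
  then have "A \<union> lam ` C \<union> adj ` (A \<union> lam ` C) \<subseteq> ?N" using vN_adj[OF N] by blast
  from bicommutant_least[OF this] show "B \<subseteq> ?N" by (simp add: B_eq vN_generated_def)
  have "(\<Union>g. gen g) \<subseteq> B" using gen_B by blast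
  from bicommutant_mono[OF this] show "?N \<subseteq> B" using vN_algebra_bicommutant[OF vB] by simp
qed

text \<open>This bounds the sigma-weakly closed component from above by a hull;
  \<open>gen_LR_component\<close> bounds it from below through the bicommutant. Between them they
  replace an exact description of the component.\<close>

lemma LR_component_hull: "LR_component A lam (I \<inter> Cg g) \<subseteq> normal_hull (gen g)"
  unfolding LR_component_def
proof (rule sigma_weak_closure_subset)
  fix s assume "s \<in> {\<Sum>\<pi>\<in>F. a \<pi> * lam \<pi> | F a. finite F \<and> F \<subseteq> I \<inter> Cg g \<and> a ` F \<subseteq> A}"
  then obtain F a where F: "F \<subseteq> I \<inter> Cg g" "a ` F \<subseteq> A" and s: "s = (\<Sum>\<pi>\<in>F. a \<pi> * lam \<pi>)" by blast
  show "s \<in> normal_hull (gen g)" unfolding s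
  proof (rule normal_hull_sum)
    fix \<pi> assume "\<pi> \<in> F"
    then have "a \<pi> * lam \<pi> \<in> gen g" using F unfolding gen_def by blast
    then show "a \<pi> * lam \<pi> \<in> normal_hull (gen g)" using normal_hull_superset by blast
  qed
qed

lemma LR_component_mem:
  assumes "a \<in> A" "\<pi> \<in> I \<inter> Cg g"
  shows "a * lam \<pi> \<in> LR_component A lam (I \<inter> Cg g)"
proof -
  let ?S = "{\<Sum>\<pi>\<in>F. a \<pi> * lam \<pi> | F a. finite F \<and> F \<subseteq> I \<inter> Cg g \<and> a ` F \<subseteq> A}"
  have "a * lam \<pi> = (\<Sum>\<pi>\<in>{\<pi>}. (\<lambda>_. a) \<pi> * lam \<pi>)" by simp
  then have "a * lam \<pi> \<in> ?S"
    unfolding mem_Collect_eq using assms by (intro exI[of _ "{\<pi>}"] exI[of _ "\<lambda>_. a"]) auto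
  moreover have "?S \<subseteq> sigma_weak closure_of ?S" by (rule closure_of_subset) simp
  ultimately show ?thesis unfolding LR_component_def by blast
qed

lemma A_LR_component: "A \<subseteq> LR_component A lam (I \<inter> Cg 0)"
proof
  fix a assume "a \<in> A"
  from LR_component_mem[OF this, of "id_endo M" 0] show "a \<in> LR_component A lam (I \<inter> Cg 0)"
    using id_I id_Cg by (simp add: lam_id)
qed

lemma gen_LR_component: "gen g \<subseteq> commutant (commutant (LR_component A lam (I \<inter> Cg g)))"
proof
  fix x assume "x \<in> gen g"
  then obtain F :: "'h bop set" and b \<sigma> where F: "\<And>p. p \<in> F \<Longrightarrow> b p \<in> A" "\<And>p. p \<in> F \<Longrightarrow> \<sigma> p \<in> I \<inter> Cg g"
    "x = (\<Sum>p\<in>F. b p * lam (\<sigma> p))"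
    by (rule gen_decomposition) (rule that)
  show "x \<in> commutant (commutant (LR_component A lam (I \<inter> Cg g)))"
    unfolding F(3)
    by (rule commutant_sum)
      (use LR_component_mem[OF F(1,2)] commutant_commutant_extensive in blast)
qed

end

theorem theorem4p1:
  fixes M :: "'h::chilbert_space bop set"
    and P :: "'p::chilbert_space bop set"
    and t :: "'h \<Rightarrow> 'p \<Rightarrow> 't::chilbert_space"
    and C :: "'h endo set"
    and Cg :: "'g::group_add \<Rightarrow> 'h endo set"
    and \<iota> :: "'t bop \<Rightarrow> 'k::chilbert_space bop"
    and lam :: "'h endo \<Rightarrow> 'k bop"
    and A B :: "'k bop set"
    and u :: "'g \<Rightarrow> 'k bop"
    and \<beta> :: "'g \<Rightarrow> 'k bop \<Rightarrow> 'k bop"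
  assumes "type_III_factor M"
    and "\<exists>\<phi>. faithful_normal_state M \<phi>"
    and "conjugate_solutions M cj R R'"
    and "rigid_tensor_category M cj C"
    and "irr_representatives M C I" and "countable I"
    and "graded_category M cj C Cg"
    and "opposite_vN M P opp"
    and "hilbert_tensor t"
    and "longo_rehren M cj R C I P opp t \<iota> lam B E"
    and "A = \<iota> ` tensor_vN t M P"
    and "\<And>g. Bg g = LR_component A lam (I \<inter> Cg g)"
    and "\<And>g. u g \<in> Bg g" and "\<And>g. unitary (u g)"
    and "\<And>g h. u g * u h = u (g + h)"
    and "\<And>g b. b \<in> Bg 0 \<Longrightarrow> \<beta> g b = u g * b * adj (u g)"
  shows "\<exists>\<Theta>. star_iso (crossed_product (Bg 0) \<beta>) B \<Theta> \<and> \<Theta> ` (cp_embed \<beta> ` A) = A"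
proof -
  interpret LR: graded_longo_rehren M P t cj R R' C I Cg opp \<iota> lam A B E
    by (rule graded_longo_rehren.intro) (fact assms)+
  interpret graded_vN_algebra LR.gen A B "Bg 0" E u \<beta>
  proof (rule graded_vN_algebra.intro)
    fix x y g h
    show "x * y \<in> LR.gen (g + h)" if "x \<in> LR.gen g" "y \<in> LR.gen h" by (rule LR.gen_mult[OF that])
    show "adj x \<in> LR.gen (- g)" if "x \<in> LR.gen g" by (rule LR.gen_adj[OF that])
    show "1 \<in> LR.gen 0" using LR.A_one LR.A_gen by blast
    show "B = commutant (commutant (\<Union>g. LR.gen g))" by (rule LR.B_gen)
    show "fn_cond_exp B A E" by (rule LR.E)
    show "E x = 0" if "g \<noteq> 0" "x \<in> LR.gen g" by (rule LR.E_gen[OF that])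
    show "u g \<in> normal_hull (LR.gen g)"
      using assms(12,13) LR.LR_component_hull by blast
    show "unitary (u g)" "u g * u h = u (g + h)" by (fact assms)+
    show "Bg 0 \<subseteq> normal_hull (LR.gen 0)" unfolding assms(12) by (rule LR.LR_component_hull)
    show "LR.gen 0 \<subseteq> commutant (commutant (Bg 0))" unfolding assms(12) by (rule LR.gen_LR_component)
    show "\<beta> g x = u g * x * adj (u g)" if "x \<in> Bg 0" by (rule assms(16)[OF that])
  qed
  obtain \<Theta> where \<Theta>: "star_iso (crossed_product (Bg 0) \<beta>) B \<Theta>" "\<And>b. b \<in> Bg 0 \<Longrightarrow> \<Theta> (cp_embed \<beta> b) = b"
    using crossed_product_iso by blast
  \<comment> \<open>As \<open>\<Theta>\<close> undoes the embedding on \<open>Bg 0\<close>,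
    containment of \<open>A\<close> there already yields that the embedded copy of \<open>A\<close>
    is mapped onto \<open>A\<close> pointwise.\<close>
  have "A \<subseteq> Bg 0" unfolding assms(12) by (rule LR.A_LR_component)
  then have "\<Theta> ` (cp_embed \<beta> ` A) = A" using \<Theta>(2) by (force simp: image_image image_iff)
  then show ?thesis using \<Theta>(1) by blast
qed

end
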